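(* For $\kappa>0$ let $\mathsf U^\kappa=(w^\kappa,u_0^\kappa,u_1^\kappa)\in\mathcal W\times\mathcal N^\perp\times\mathcal N$, $u^\kappa=u_0^\kappa+u_1^\kappa$, be the (unique) solution of the stationarity problem. As $\kappa\to+\infty$ it admits the expansion $$\mathsf U^\kappa=\mathsf U^{(0)}+O(\kappa^{-1})$$ in the norm $\|\cdot\|_{\mathbb U}$, where the components $(w^{(0)},u_0^{(0)},u_1^{(0)})\in\mathcal W\times\mathcal N^\perp\times\mathcal N$ of $\mathsf U^{(0)}$ solve the well-posed problems $$Du_0^{(0)}=\mathbf d_0\ \text{ in }(\mathcal N^\perp)'\quad(\text{i.e. }u_0^{(0)}=u^{\rm m}),$$ $$Aw^{(0)}+B_1u_1^{(0)}=\mathbf f-B_0u^{\rm m}\ \text{ in }\mathcal W',\qquad B_1^tw^{(0)}=0\ \text{ in }\mathcal N'.$$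
   Context: Setting. $\Omega\subset\mathbb R^s$ ($1\le s\le 3$) is a bounded connected domain with boundary $\Gamma$ regular enough (e.g. Lipschitz) for the usual trace, Korn and compact embedding results in $H^1$. $\Gamma_D,\Gamma_N\subseteq\Gamma$ satisfy $\Gamma_D\cap\Gamma_N=\emptyset$ and $\Gamma_c:=\Gamma\setminus(\Gamma_N\cup\Gamma_D)$ may be nonempty. $\rho\in L^\infty(\Omega)$ is bounded below by a positive constant; $\omega>0$ is fixed. $\mathcal C\in L^\infty(\Omega;\mathbb Q)$ is an elasticity tensor field, where $\mathbb Q$ is the space of fourth-order tensors with $C_{ijkl}=C_{klij}=C_{jikl}$, uniformly elliptic: $\varepsilon:\mathcal C(x):\varepsilon\ge c_0\,\varepsilon:\varepsilon$ for all symmetric $\varepsilon$, $c_0>0$. Spaces (real): $\mathcal V=H^1(\Omega;\mathbb R^s)$, $\mathcal U=\{v\in\mathcal V: v=0\text{ on }\Gamma_D\}$, $\mathcal W=\{v\in\mathcal V: v=0\text{ on }\Gamma_D\cup\Gamma_c\}\subseteq\mathcal U$. $(\cdot,\cdot)$ is the $L^2(\Omega)$ scalar product, $\varepsilon[v]=\frac12(\nabla v+\nabla v^T)$. Forms: $\mathcal A(v,\tilde v)=(\varepsilon[v],\mathcal C:\varepsilon[\tilde v])$; $\mathcal B(v,\tilde v)=\mathcal A(v,\tilde v)-\omega^2(\rho v,\tilde v)$; $\mathcal D:\mathcal U\times\mathcal U\to\mathbb R$ is a symmetric positive (semidefinite) continuous bilinear form. Inner product and norm on $\mathcal U,\mathcal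 W$: $(v,\tilde v)_\omega=\mathcal A(v,\tilde v)+\omega^2(\rho v,\tilde v)$, $\|v\|_\omega^2=(v,v)_\omega$; orthogonal complements are for this inner product. $\mathbb U=\mathcal W\times\mathcal U$ with $\|(w,u)\|_{\mathbb U}^2=\|w\|_\omega^2+\|u\|_\omega^2$. $\mathcal H=\{u\in\mathcal U:\mathcal B(u,\tilde w)=0\ \forall\tilde w\in\mathcal W\}$; $\mathcal N=\{u\in\mathcal U:\mathcal D(u,\tilde u)=0\ \forall\tilde u\in\mathcal U\}$. Every $u\in\mathcal U$ is split as $u=u_0+u_1$ with $u_0\in\mathcal N^\perp$, $u_1\in\mathcal N$. Operators: $A:\mathcal W\to\mathcal W'$, $\langle Aw,\tilde w\rangle=\mathcal A(w,\tilde w)$; $B_0:\mathcal N^\perp\to\mathcal W'$, $B_1:\mathcal N\to\mathcal W'$ are the restrictions to $\mathcal N^\perp$, $\mathcal N$ of $u\mapsto\mathcal B(u,\cdot)$; $B_0^t,B_1^t$ are the transposes; $D:\mathcal N^\perp\to(\mathcal N^\perp)'$, $\langle Du_0,\tilde u_0\rangle=\mathcal D(u_0,\tilde u_0)$. Standing assumptions: $|\Gamma_D\cup\Gamma_c|>0$, so $\mathcal A$ is coercive on $\mathcal W\times\mathcal W$; $\mathcal N$ is a proper subspace of $\mathcal H^\perp$; $\mathcal D$ is coercive on $\mathcal N^\perp\times\mathcal N^\perp$: $\mathcal D(v,v)\ge\delta\|v\|_\omega^2$ for all $v\in\mathcal N^\perp$, $\delta>0$. Data independent of $\kappa$: $\mathbf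 f\in\mathcal W'$; measured displacement $u^{\rm m}$, taken in $\mathcal N^\perp$; $\mathbf d\in\mathcal U'$ with $\langle\mathbf d,\tilde u\rangle=\mathcal D(u^{\rm m},\tilde u)$, so the restriction of $\mathbf d$ to $\mathcal N$ is $0$ and its restriction to $\mathcal N^\perp$ is $\mathbf d_0=Du^{\rm m}$. Stationarity problem: find $(w,u)\in\mathcal W\times\mathcal U$ with $\mathcal A(w,\tilde w)+\mathcal B(u,\tilde w)=\langle\mathbf f,\tilde w\rangle$ for all $\tilde w\in\mathcal W$ and $\mathcal B(\tilde u,w)-\kappa\mathcal D(u,\tilde u)=-\kappa\langle\mathbf d,\tilde u\rangle$ for all $\tilde u\in\mathcal U$. *)

theory Defs
  imports "HOL-Analysis.Analysis" "HOL-Library.Landau_Symbols"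
begin

(* Elements of function spaces over a domain are represented by functions on the whole of R^s;
   only their values almost everywhere in the domain matter, and equality of elements is ae_eq. *)

type_synonym 's field = "real^'s \<Rightarrow> real^'s"

definition ae_eq :: "(real^'s::finite) set \<Rightarrow> 's field \<Rightarrow> 's field \<Rightarrow> bool" where
  "ae_eq \<Omega> u v \<longleftrightarrow> (AE x in lebesgue_on \<Omega>. u x = v x)"

definition fadd :: "'s::finite field \<Rightarrow> 's field \<Rightarrow> 's field" where
  "fadd u v = (\<lambda>x. u x + v x)"

definition fdiff :: "'s::finite field \<Rightarrow> 's field \<Rightarrow> 's field" where
  "fdiff u v = (\<lambda>x. u x - v x)"


section \<open>Lebesgue and Sobolev spaces\<close>

definition L2 :: "'a measure \<Rightarrow> ('a \<Rightarrow> 'b::euclidean_space) set" where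
  "L2 M = {f \<in> borel_measurable M. integrable M (\<lambda>x. (norm (f x))\<^sup>2)}"

definition L2_norm :: "'a measure \<Rightarrow> ('a \<Rightarrow> 'b::euclidean_space) \<Rightarrow> real" where
  "L2_norm M f = sqrt (LINT x|M. (norm (f x))\<^sup>2)"

definition Linf :: "'a measure \<Rightarrow> ('a \<Rightarrow> 'b::euclidean_space) set" where
  "Linf M = {f \<in> borel_measurable M. \<exists>K. AE x in M. norm (f x) \<le> K}"

definition partial :: "'s::finite \<Rightarrow> (real^'s \<Rightarrow> real) \<Rightarrow> real^'s \<Rightarrow> real" where
  "partial j \<phi> x = frechet_derivative \<phi> (at x) (axis j 1)"

(* C^infinity: the largest class of differentiable functions closed under partial derivatives *)
coinductive smooth :: "(real^'s::finite \<Rightarrow> real) \<Rightarrow> bool" where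
  "(\<And>x. \<phi> differentiable (at x)) \<Longrightarrow> (\<And>j. smooth (partial j \<phi>)) \<Longrightarrow> smooth \<phi>"

definition test_functions :: "(real^'s::finite) set \<Rightarrow> (real^'s \<Rightarrow> real) set" where
  "test_functions \<Omega> = {\<phi>. smooth \<phi> \<and> compact (closure {x. \<phi> x \<noteq> 0}) \<and> closure {x. \<phi> x \<noteq> 0} \<subseteq> \<Omega>}"

(* G x $ i $ j is the weak derivative of the i-th component in direction j *)
definition has_weak_gradient ::
    "(real^'s::finite) set \<Rightarrow> 's field \<Rightarrow> (real^'s \<Rightarrow> real^'s^'s) \<Rightarrow> bool" where
  "has_weak_gradient \<Omega> v G \<longleftrightarrow>
     (\<forall>\<phi>\<in>test_functions \<Omega>. \<forall>i j.
        (LINT x|lebesgue_on \<Omega>. v x $ i * partial j \<phi> x) =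
        - (LINT x|lebesgue_on \<Omega>. G x $ i $ j * \<phi> x))"

definition H1 :: "(real^'s::finite) set \<Rightarrow> 's field set" where
  "H1 \<Omega> = {v \<in> L2 (lebesgue_on \<Omega>). \<exists>G\<in>L2 (lebesgue_on \<Omega>). has_weak_gradient \<Omega> v G}"

definition weak_grad :: "(real^'s::finite) set \<Rightarrow> 's field \<Rightarrow> real^'s \<Rightarrow> real^'s^'s" where
  "weak_grad \<Omega> v = (SOME G. G \<in> L2 (lebesgue_on \<Omega>) \<and> has_weak_gradient \<Omega> v G)"

definition H1_norm :: "(real^'s::finite) set \<Rightarrow> 's field \<Rightarrow> real" where
  "H1_norm \<Omega> v =
     sqrt ((L2_norm (lebesgue_on \<Omega>) v)\<^sup>2 + (L2_norm (lebesgue_on \<Omega>) (weak_grad \<Omega> v))\<^sup>2)"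

definition strain :: "(real^'s::finite) set \<Rightarrow> 's field \<Rightarrow> real^'s \<Rightarrow> real^'s^'s" where
  "strain \<Omega> v x = (1/2) *\<^sub>R (weak_grad \<Omega> v x + transpose (weak_grad \<Omega> v x))"


section \<open>Boundary measure and traces\<close>

definition hausdorff_delta :: "nat \<Rightarrow> real \<Rightarrow> 'a::metric_space set \<Rightarrow> ennreal" where
  "hausdorff_delta d \<delta> E =
     (INF U\<in>{U::nat \<Rightarrow> 'a set. E \<subseteq> (\<Union>i. U i) \<and> (\<forall>i. bounded (U i) \<and> diameter (U i) \<le> \<delta>)}.
        \<Sum>i. if U i = {} then 0 else ennreal (unit_ball_vol (real d) * (diameter (U i) / 2) ^ d))"

definition hausdorff_outer :: "nat \<Rightarrow> 'a::metric_space set \<Rightarrow> ennreal" where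
  "hausdorff_outer d E = (SUP \<delta>\<in>{0<..}. hausdorff_delta d \<delta> E)"

(* hausdorff_outer is a metric outer measure, hence countably additive on the Borel sets by
   Caratheodory's criterion; the factor unit_ball_vol makes the (s-1)-dimensional measure of a
   hypersurface its area (the counting measure if s = 1) *)
definition hausdorff_measure :: "nat \<Rightarrow> 'a::metric_space measure" where
  "hausdorff_measure d = measure_of UNIV (sets borel) (hausdorff_outer d)"

definition surface_measure :: "(real^'s::finite) set \<Rightarrow> (real^'s) measure" where
  "surface_measure \<Omega> = restrict_space (hausdorff_measure (CARD('s) - 1)) (frontier \<Omega>)"

definition smooth_fields :: "(real^'s::finite) set \<Rightarrow> 's field set" where
  "smooth_fields \<Omega> = {\<phi> \<in> H1 \<Omega>. \<forall>i. smooth (\<lambda>x. \<phi> x $ i)}"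

(* The trace operator is the continuous extension from H^1 to L^2 of the boundary of the
   restriction map on fields smooth up to the boundary. *)
definition has_trace :: "(real^'s::finite) set \<Rightarrow> 's field \<Rightarrow> 's field \<Rightarrow> bool" where
  "has_trace \<Omega> v g \<longleftrightarrow>
     g \<in> borel_measurable (surface_measure \<Omega>) \<and>
     (\<exists>\<phi>::nat \<Rightarrow> 's field. (\<forall>n. \<phi> n \<in> smooth_fields \<Omega>) \<and>
        (\<lambda>n. H1_norm \<Omega> (fdiff (\<phi> n) v)) \<longlonglongrightarrow> 0 \<and>
        (\<lambda>n. \<integral>\<^sup>+ x. ennreal ((norm (\<phi> n x - g x))\<^sup>2) \<partial>surface_measure \<Omega>) \<longlonglongrightarrow> 0)"

definition vanishes_on :: "(real^'s::finite) set \<Rightarrow> (real^'s) set \<Rightarrow> 's field \<Rightarrow> bool" where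
  "vanishes_on \<Omega> S v \<longleftrightarrow>
     (\<exists>g. has_trace \<Omega> v g \<and> (AE x in surface_measure \<Omega>. x \<in> S \<longrightarrow> g x = 0))"

definition H1_zero_on :: "(real^'s::finite) set \<Rightarrow> (real^'s) set \<Rightarrow> 's field set" where
  "H1_zero_on \<Omega> S = {v \<in> H1 \<Omega>. vanishes_on \<Omega> S v}"


section \<open>Domains for which the usual results in H1 are available\<close>

definition bounded_domain :: "(real^'s::finite) set \<Rightarrow> bool" where
  "bounded_domain \<Omega> \<longleftrightarrow> open \<Omega> \<and> connected \<Omega> \<and> bounded \<Omega> \<and> \<Omega> \<noteq> {}"

definition trace_theorem :: "(real^'s::finite) set \<Rightarrow> bool" where
  "trace_theorem \<Omega> \<longleftrightarrow>
     (\<forall>v\<in>H1 \<Omega>. \<forall>e>0. \<exists>\<phi>\<in>smooth_fields \<Omega>. H1_norm \<Omega> (fdiff \<phi> v) < e) \<and>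
     (\<exists>K. \<forall>\<phi>\<in>smooth_fields \<Omega>.
        (\<integral>\<^sup>+ x. ennreal ((norm (\<phi> x))\<^sup>2) \<partial>surface_measure \<Omega>) \<le> ennreal (K * (H1_norm \<Omega> \<phi>)\<^sup>2))"

definition korn_inequality :: "(real^'s::finite) set \<Rightarrow> bool" where
  "korn_inequality \<Omega> \<longleftrightarrow>
     (\<exists>K. \<forall>v\<in>H1 \<Omega>. H1_norm \<Omega> v \<le>
        K * (L2_norm (lebesgue_on \<Omega>) v + L2_norm (lebesgue_on \<Omega>) (strain \<Omega> v)))"

definition korn_inequality_bc :: "(real^'s::finite) set \<Rightarrow> bool" where
  "korn_inequality_bc \<Omega> \<longleftrightarrow>
     (\<forall>S\<in>sets borel. S \<subseteq> frontier \<Omega> \<and> emeasure (surface_measure \<Omega>) S > 0 \<longrightarrow>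
        (\<exists>K. \<forall>v\<in>H1_zero_on \<Omega> S. H1_norm \<Omega> v \<le> K * L2_norm (lebesgue_on \<Omega>) (strain \<Omega> v)))"

definition compact_embedding :: "(real^'s::finite) set \<Rightarrow> bool" where
  "compact_embedding \<Omega> \<longleftrightarrow>
     (\<forall>v::nat \<Rightarrow> 's field. (\<forall>n. v n \<in> H1 \<Omega>) \<and> (\<exists>K. \<forall>n. H1_norm \<Omega> (v n) \<le> K) \<longrightarrow>
        (\<exists>r u. strict_mono r \<and> u \<in> L2 (lebesgue_on \<Omega>) \<and>
           (\<lambda>n. L2_norm (lebesgue_on \<Omega>) (fdiff (v (r n)) u)) \<longlonglongrightarrow> 0))"

(* A boundary regular enough (Lipschitz suffices) for trace, Korn and compact embedding results;
   Korn's inequality is taken in both its usual forms. *)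
definition regular_boundary :: "(real^'s::finite) set \<Rightarrow> bool" where
  "regular_boundary \<Omega> \<longleftrightarrow>
     trace_theorem \<Omega> \<and> korn_inequality \<Omega> \<and> korn_inequality_bc \<Omega> \<and> compact_embedding \<Omega>"


section \<open>Material and the energy forms\<close>

type_synonym 's tensor4 = "real^'s^'s^'s^'s"

definition tensor_symmetric :: "'s::finite tensor4 \<Rightarrow> bool" where
  "tensor_symmetric T \<longleftrightarrow>
     (\<forall>i j k l. T $ i $ j $ k $ l = T $ k $ l $ i $ j \<and> T $ i $ j $ k $ l = T $ j $ i $ k $ l)"

definition contract :: "'s::finite tensor4 \<Rightarrow> real^'s^'s \<Rightarrow> real^'s^'s" where
  "contract T e = (\<chi> i j. \<Sum>k\<in>UNIV. \<Sum>l\<in>UNIV. T $ i $ j $ k $ l * e $ k $ l)"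

(* the inner product of matrices in real^'s^'s is the double contraction e : e *)
definition elasticity_tensor ::
    "(real^'s::finite) set \<Rightarrow> real \<Rightarrow> (real^'s \<Rightarrow> 's tensor4) \<Rightarrow> bool" where
  "elasticity_tensor \<Omega> c0 C \<longleftrightarrow>
     C \<in> Linf (lebesgue_on \<Omega>) \<and>
     (AE x in lebesgue_on \<Omega>. tensor_symmetric (C x)) \<and>
     (AE x in lebesgue_on \<Omega>. \<forall>e. transpose e = e \<longrightarrow> e \<bullet> contract (C x) e \<ge> c0 * (e \<bullet> e))"

definition stiffness_form ::
    "(real^'s::finite) set \<Rightarrow> (real^'s \<Rightarrow> 's tensor4) \<Rightarrow> 's field \<Rightarrow> 's field \<Rightarrow> real" where
  "stiffness_form \<Omega> C v v' = (LINT x|lebesgue_on \<Omega>. strain \<Omega> v x \<bullet> contract (C x) (strain \<Omega> v' x))"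

definition mass_form ::
    "(real^'s::finite) set \<Rightarrow> (real^'s \<Rightarrow> real) \<Rightarrow> 's field \<Rightarrow> 's field \<Rightarrow> real" where
  "mass_form \<Omega> \<rho> v v' = (LINT x|lebesgue_on \<Omega>. (\<rho> x *\<^sub>R v x) \<bullet> v' x)"


section \<open>Forms and functionals on spaces of fields\<close>

definition form_norm :: "('s::finite field \<Rightarrow> 's field \<Rightarrow> real) \<Rightarrow> 's field \<Rightarrow> real" where
  "form_norm ip v = sqrt (ip v v)"

definition orth_compl ::
    "('s::finite field \<Rightarrow> 's field \<Rightarrow> real) \<Rightarrow> 's field set \<Rightarrow> 's field set \<Rightarrow> 's field set" where
  "orth_compl ip X S = {u \<in> X. \<forall>v\<in>S. ip u v = 0}"

definition linear_on_fields :: "'s::finite field set \<Rightarrow> ('s field \<Rightarrow> real) \<Rightarrow> bool" where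
  "linear_on_fields X l \<longleftrightarrow>
     (\<forall>u\<in>X. \<forall>v\<in>X. \<forall>a b. l (\<lambda>x. a *\<^sub>R u x + b *\<^sub>R v x) = a * l u + b * l v)"

definition dual ::
    "('s::finite field \<Rightarrow> real) \<Rightarrow> 's field set \<Rightarrow> ('s field \<Rightarrow> real) set" where
  "dual nrm X = {l. linear_on_fields X l \<and> (\<exists>K. \<forall>v\<in>X. \<bar>l v\<bar> \<le> K * nrm v)}"

definition dual_norm ::
    "('s::finite field \<Rightarrow> real) \<Rightarrow> 's field set \<Rightarrow> ('s field \<Rightarrow> real) \<Rightarrow> real" where
  "dual_norm nrm X l = (SUP v\<in>{v \<in> X. nrm v \<le> 1}. \<bar>l v\<bar>)"

definition sym_psd_continuous_form ::
    "('s::finite field \<Rightarrow> real) \<Rightarrow> 's field set \<Rightarrow> ('s field \<Rightarrow> 's field \<Rightarrow> real) \<Rightarrow> bool" where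
  "sym_psd_continuous_form nrm X D \<longleftrightarrow>
     (\<forall>u\<in>X. linear_on_fields X (D u)) \<and>
     (\<forall>u\<in>X. linear_on_fields X (\<lambda>v. D v u)) \<and>
     (\<forall>u\<in>X. \<forall>v\<in>X. D u v = D v u) \<and>
     (\<forall>u\<in>X. D u u \<ge> 0) \<and>
     (\<exists>K. \<forall>u\<in>X. \<forall>v\<in>X. \<bar>D u v\<bar> \<le> K * nrm u * nrm v)"


section \<open>Problems\<close>

definition stationary ::
    "'s::finite field set \<Rightarrow> 's field set \<Rightarrow> ('s field \<Rightarrow> 's field \<Rightarrow> real) \<Rightarrow>
     ('s field \<Rightarrow> 's field \<Rightarrow> real) \<Rightarrow> ('s field \<Rightarrow> 's field \<Rightarrow> real) \<Rightarrow>
     ('s field \<Rightarrow> real) \<Rightarrow> ('s field \<Rightarrow> real) \<Rightarrow> real \<Rightarrow> 's field \<Rightarrow> 's field \<Rightarrow> bool" where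
  "stationary W U A B D f d \<kappa> w u \<longleftrightarrow>
     w \<in> W \<and> u \<in> U \<and>
     (\<forall>w'\<in>W. A w w' + B u w' = f w') \<and>
     (\<forall>u'\<in>U. B u' w - \<kappa> * D u u' = - \<kappa> * d u')"

(* the equation D u = e in X' *)
definition solves_misfit ::
    "'s::finite field set \<Rightarrow> ('s field \<Rightarrow> 's field \<Rightarrow> real) \<Rightarrow> ('s field \<Rightarrow> real) \<Rightarrow> 's field \<Rightarrow> bool" where
  "solves_misfit X D e u \<longleftrightarrow> u \<in> X \<and> (\<forall>v\<in>X. D u v = e v)"

(* the system A w + B u = F in W', B^t w = G in N' *)
definition solves_mixed ::
    "'s::finite field set \<Rightarrow> 's field set \<Rightarrow> ('s field \<Rightarrow> 's field \<Rightarrow> real) \<Rightarrow>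
     ('s field \<Rightarrow> 's field \<Rightarrow> real) \<Rightarrow> ('s field \<Rightarrow> real) \<Rightarrow> ('s field \<Rightarrow> real) \<Rightarrow>
     's field \<Rightarrow> 's field \<Rightarrow> bool" where
  "solves_mixed W N A B F G w u \<longleftrightarrow>
     w \<in> W \<and> u \<in> N \<and>
     (\<forall>w'\<in>W. A w w' + B u w' = F w') \<and>
     (\<forall>v\<in>N. B v w = G v)"

(* Well-posedness in the sense of Hadamard, for arbitrary right-hand sides. *)
definition misfit_well_posed ::
    "(real^'s::finite) set \<Rightarrow> ('s field \<Rightarrow> real) \<Rightarrow> 's field set \<Rightarrow>
     ('s field \<Rightarrow> 's field \<Rightarrow> real) \<Rightarrow> bool" where
  "misfit_well_posed \<Omega> nrm X D \<longleftrightarrow>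
     (\<exists>K. \<forall>e\<in>dual nrm X. \<exists>u. solves_misfit X D e u \<and>
        (\<forall>u'. solves_misfit X D e u' \<longrightarrow> ae_eq \<Omega> u' u) \<and>
        nrm u \<le> K * dual_norm nrm X e)"

definition mixed_well_posed ::
    "(real^'s::finite) set \<Rightarrow> ('s field \<Rightarrow> real) \<Rightarrow> 's field set \<Rightarrow> 's field set \<Rightarrow>
     ('s field \<Rightarrow> 's field \<Rightarrow> real) \<Rightarrow> ('s field \<Rightarrow> 's field \<Rightarrow> real) \<Rightarrow> bool" where
  "mixed_well_posed \<Omega> nrm W N A B \<longleftrightarrow>
     (\<exists>K. \<forall>F\<in>dual nrm W. \<forall>G\<in>dual nrm N. \<exists>w u. solves_mixed W N A B F G w u \<and>
        (\<forall>w' u'. solves_mixed W N A B F G w' u' \<longrightarrow> ae_eq \<Omega> w' w \<and> ae_eq \<Omega> u' u) \<and>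
        nrm w + nrm u \<le> K * (dual_norm nrm W F + dual_norm nrm N G))"

end

theory Submission
  imports Defs "HOL-Library.Function_Algebras"
begin

text \<open>The map w \<mapsto> B(., w) from W to the dual of U is a compact perturbation of an isometry, so its range
  is closed and equals the annihilator of H. Hence B is bounded below on every subspace of the
  orthogonal complement of H, in particular on N. Let S u be the solution in W of A(S u, .) = B(u, .).
  Eliminating w turns the systems into elliptic problems for u with the forms A(S u, S v) on N and
  A(S u, S v) + \<kappa> D(u, v) on U: the first is coercive by the lower bound for B, the second
  because D is coercive on the complement of N. For the difference of the two systems, the energy
  identity bounds the component in the complement of N by O(1/\<kappa>), and the stability of the limit
  system on N transfers this rate to the remaining components.

  On fields the abstract hypotheses come from Riesz--Fischer completeness, uniqueness of weak
  gradients, continuity of traces, Korn's inequalities and the compact embedding. Since all spaces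
  consist of functions rather than classes, every inner product below may be degenerate.\<close>

section \<open>Semi-inner product spaces on subspaces\<close>

text \<open>\<open>B\<close> is indefinite, and \<open>W\<close> can be much smaller than
  \<open>U\<close>: w |-> B(., w) may have a nontrivial kernel and a range of infinite codimension,
  so no Fredholm alternative on a single space applies. The compact part is 2 \<omega>^2 times the
  mass form, because \<open>B\<close> is the inner product of \<open>U\<close> minus this form.
  Closed range is what is needed: for u in N, orthogonality to H puts the functional (u, .) into the
  range, say (u, .) = B(., w) with the norm of w controlled by that of u, and testing the lifting of
  u with this w is the inf-sup condition.

  For the rate, stability of the penalised system by itself would only keep the error bounded:
  inserting the limit leaves the residual B(., w0) in the second equation, which does not shrink as
  \<kappa> grows. But the second limit equation makes this residual vanish on N, and on the
  complement it is opposed by \<kappa> D; this is where the factor 1/\<kappa> arises.\<close>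

definition linear_form :: "'v::real_vector set \<Rightarrow> ('v \<Rightarrow> real) \<Rightarrow> bool" where
  "linear_form X l \<longleftrightarrow> (\<forall>u\<in>X. \<forall>v\<in>X. \<forall>a b. l (a *\<^sub>R u + b *\<^sub>R v) = a * l u + b * l v)"

text \<open>Linearity is demanded on the given subspaces only. Outside them integrals may fail to
  exist and take a default value, and \<open>weak_grad\<close> is an arbitrary choice, so the forms
  of the application are not linear on all functions.\<close>

definition bilinear_form ::
    "'v::real_vector set \<Rightarrow> 'w::real_vector set \<Rightarrow> ('v \<Rightarrow> 'w \<Rightarrow> real) \<Rightarrow> bool" where
  "bilinear_form X Y b \<longleftrightarrow>
     (\<forall>x\<in>X. linear_form Y (b x)) \<and> (\<forall>y\<in>Y. linear_form X (\<lambda>x. b x y))"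

definition ipnorm :: "('v \<Rightarrow> 'v \<Rightarrow> real) \<Rightarrow> 'v \<Rightarrow> real" where
  "ipnorm ip v = sqrt (ip v v)"

definition bounded_form :: "'v set \<Rightarrow> ('v \<Rightarrow> 'v \<Rightarrow> real) \<Rightarrow> ('v \<Rightarrow> real) \<Rightarrow> bool" where
  "bounded_form X ip l \<longleftrightarrow> (\<exists>K. \<forall>v\<in>X. \<bar>l v\<bar> \<le> K * ipnorm ip v)"

text \<open>The limit lies in \<open>X\<close> but is determined only up to vectors of seminorm
  zero.\<close>

definition complete_form :: "'v::real_vector set \<Rightarrow> ('v \<Rightarrow> 'v \<Rightarrow> real) \<Rightarrow> bool" where
  "complete_form X ip \<longleftrightarrow>
     (\<forall>s. (\<forall>n::nat. s n \<in> X) \<and> (\<forall>e>0. \<exists>M. \<forall>m\<ge>M. \<forall>n\<ge>M. ipnorm ip (s m - s n) < e) \<longrightarrow>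
        (\<exists>l\<in>X. (\<lambda>n. ipnorm ip (s n - l)) \<longlonglongrightarrow> 0))"

lemma linear_form_add: "linear_form X l \<Longrightarrow> u \<in> X \<Longrightarrow> v \<in> X \<Longrightarrow> l (u + v) = l u + l v"
  unfolding linear_form_def by (metis scaleR_one mult_1)

lemma linear_form_scale: "linear_form X l \<Longrightarrow> u \<in> X \<Longrightarrow> l (a *\<^sub>R u) = a * l u"
  unfolding linear_form_def by (metis add.right_neutral mult_zero_left scaleR_zero_left)

lemma linear_form_diff: "linear_form X l \<Longrightarrow> u \<in> X \<Longrightarrow> v \<in> X \<Longrightarrow> l (u - v) = l u - l v"
  unfolding linear_form_def
  by (metis (no_types, opaque_lifting) diff_conv_add_uminus mult_1 mult_minus1 scaleR_minus1_left scaleR_one)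

lemma linear_form_zero: "linear_form X l \<Longrightarrow> 0 \<in> X \<Longrightarrow> l 0 = 0"
  using linear_form_scale[of X l 0 0] by simp

lemma bilinear_form_left: "bilinear_form X Y b \<Longrightarrow> y \<in> Y \<Longrightarrow> linear_form X (\<lambda>x. b x y)"
  and bilinear_form_right: "bilinear_form X Y b \<Longrightarrow> x \<in> X \<Longrightarrow> linear_form Y (b x)"
  by (auto simp: bilinear_form_def)

lemma linear_form_mono: "linear_form X l \<Longrightarrow> Y \<subseteq> X \<Longrightarrow> linear_form Y l"
  by (force simp: linear_form_def)

lemma bilinear_form_mono:
  "bilinear_form X Y b \<Longrightarrow> X' \<subseteq> X \<Longrightarrow> Y' \<subseteq> Y \<Longrightarrow> bilinear_form X' Y' b"
  unfolding bilinear_form_def by (blast intro: linear_form_mono)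

text \<open>This extracts the Euler equation from minimality in \<open>riesz\<close>. The test value
  -q/(p+1) replaces the minimiser -q/p so that p = 0 needs no separate case.\<close>

lemma quadratic_nonneg_imp_zero:
  fixes p q :: real
  assumes "\<And>t. 0 \<le> t\<^sup>2 * p + 2 * t * q" and "0 \<le> p"
  shows "q = 0"
proof -
  have "0 \<le> (- q / (p + 1))\<^sup>2 * p + 2 * (- q / (p + 1)) * q" by (rule assms(1))
  also have "\<dots> = - q\<^sup>2 * (p + 2) / (p + 1)\<^sup>2"
    using assms(2) by (simp add: divide_simps power2_eq_square) (auto simp: algebra_simps)
  finally have "q\<^sup>2 * (p + 2) / (p + 1)\<^sup>2 \<le> 0" by simp
  then have "q\<^sup>2 * (p + 2) \<le> 0" using assms(2) by (simp add: divide_le_0_iff)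
  then show ?thesis using assms(2) by (auto simp: mult_le_0_iff)
qed

section \<open>Geometry of a possibly degenerate inner product: Cauchy-Schwarz, closed subspaces,
  Riesz representation\<close>

locale semi_inner =
  fixes X :: "'v::real_vector set" and ip :: "'v \<Rightarrow> 'v \<Rightarrow> real"
  assumes subspace: "subspace X"
    and bilinear: "bilinear_form X X ip"
    and sym: "u \<in> X \<Longrightarrow> v \<in> X \<Longrightarrow> ip u v = ip v u"
    and nonneg: "u \<in> X \<Longrightarrow> 0 \<le> ip u u"
begin

abbreviation nm ("\<parallel>_\<parallel>") where "\<parallel>u\<parallel> \<equiv> ipnorm ip u"

lemmas mem = subspace_0[OF subspace] subspace_add[OF subspace] subspace_diff[OF subspace]
  subspace_scale[OF subspace] subspace_neg[OF subspace]

lemma ip_add_diff: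
  assumes "u \<in> X" "v \<in> X" "w \<in> X"
  shows "ip (u + v) w = ip u w + ip v w" "ip w (u + v) = ip w u + ip w v"
    "ip (u - v) w = ip u w - ip v w" "ip w (u - v) = ip w u - ip w v"
  using assms linear_form_add[OF bilinear_form_left[OF bilinear assms(3)] assms(1,2)]
    linear_form_diff[OF bilinear_form_left[OF bilinear assms(3)] assms(1,2)]
    linear_form_add[OF bilinear_form_right[OF bilinear assms(3)] assms(1,2)]
    linear_form_diff[OF bilinear_form_right[OF bilinear assms(3)] assms(1,2)]
  by auto

lemma ip_scale:
  assumes "u \<in> X" "w \<in> X"
  shows "ip (a *\<^sub>R u) w = a * ip u w" "ip w (a *\<^sub>R u) = a * ip w u"
  using linear_form_scale[OF bilinear_form_left[OF bilinear assms(2)] assms(1)]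
    linear_form_scale[OF bilinear_form_right[OF bilinear assms(2)] assms(1)]
  by auto

lemmas ip_simps = ip_add_diff ip_scale

lemma norm_sq: "u \<in> X \<Longrightarrow> \<parallel>u\<parallel>\<^sup>2 = ip u u"
  by (simp add: ipnorm_def nonneg)

lemma norm_nonneg: "u \<in> X \<Longrightarrow> 0 \<le> \<parallel>u\<parallel>"
  by (simp add: ipnorm_def nonneg)

lemma norm_zero: "\<parallel>0\<parallel> = 0"
  using ip_scale(1)[of 0 0 0] mem(1) by (simp add: ipnorm_def)

lemma norm_scale: "u \<in> X \<Longrightarrow> \<parallel>a *\<^sub>R u\<parallel> = \<bar>a\<bar> * \<parallel>u\<parallel>"
  by (simp add: ipnorm_def ip_simps mem real_sqrt_mult flip: mult.assoc)

lemma norm_minus_commute: "u \<in> X \<Longrightarrow> v \<in> X \<Longrightarrow> \<parallel>u - v\<parallel> = \<parallel>v - u\<parallel>"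
  using norm_scale[of "v - u" "-1"] mem by simp

lemma Cauchy_Schwarz:
  assumes "u \<in> X" "v \<in> X"
  shows "\<bar>ip u v\<bar> \<le> \<parallel>u\<parallel> * \<parallel>v\<parallel>"
proof -
  have pos: "0 \<le> t\<^sup>2 * ip v v + 2 * t * ip u v + ip u u" for t
  proof -
    have "0 \<le> ip (t *\<^sub>R v + u) (t *\<^sub>R v + u)" using assms mem nonneg by simp
    then show ?thesis
      using assms mem sym[of v u] by (simp add: ip_simps algebra_simps power2_eq_square)
  qed
  have "(ip u v)\<^sup>2 \<le> ip u u * ip v v"
  proof (cases "ip v v = 0")
    case True
    have "ip u v = 0"
    proof (rule ccontr)
      assume nz: "ip u v \<noteq> 0"
      \<comment> \<open>With \<open>ip v v = 0\<close> the polynomial \<open>pos\<close> is affine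
        in t, and this t would give it the value -1.\<close>
      have "0 \<le> 2 * (- (ip u u + 1) / (2 * ip u v)) * ip u v + ip u u"
        using pos[of "- (ip u u + 1) / (2 * ip u v)"] True by simp
      then show False using nz by (simp add: field_simps)
    qed
    then show ?thesis using assms nonneg by simp
  next
    case False
    then have v: "ip v v > 0" using nonneg assms by (simp add: order_less_le)
    \<comment> \<open>The value of the polynomial at its minimiser.\<close>
    have "(- ip u v / ip v v)\<^sup>2 * ip v v + 2 * (- ip u v / ip v v) * ip u v + ip u u
        = ip u u - (ip u v)\<^sup>2 / ip v v"
      using v by (simp add: field_simps power2_eq_square)
    then have "(ip u v)\<^sup>2 / ip v v \<le> ip u u" using pos[of "- ip u v / ip v v"] by linarith
    then show ?thesis using v by (simp add: field_simps)
  qed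
  then have "sqrt ((ip u v)\<^sup>2) \<le> sqrt (ip u u * ip v v)" by (rule real_sqrt_le_mono)
  then show ?thesis by (simp add: ipnorm_def real_sqrt_mult)
qed

lemma norm_triangle:
  assumes "u \<in> X" "v \<in> X"
  shows "\<parallel>u + v\<parallel> \<le> \<parallel>u\<parallel> + \<parallel>v\<parallel>"
proof (rule power2_le_imp_le)
  have "\<parallel>u + v\<parallel>\<^sup>2 = \<parallel>u\<parallel>\<^sup>2 + \<parallel>v\<parallel>\<^sup>2 + 2 * ip u v"
    using assms mem sym[of v u] by (simp add: norm_sq ip_simps)
  also have "\<dots> \<le> (\<parallel>u\<parallel> + \<parallel>v\<parallel>)\<^sup>2"
    using Cauchy_Schwarz[OF assms] by (simp add: power2_sum)
  finally show "\<parallel>u + v\<parallel>\<^sup>2 \<le> (\<parallel>u\<parallel> + \<parallel>v\<parallel>)\<^sup>2" .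
  show "0 \<le> \<parallel>u\<parallel> + \<parallel>v\<parallel>" using assms norm_nonneg by simp
qed

lemma norm_triangle_diff:
  assumes "u \<in> X" "v \<in> X"
  shows "\<parallel>u - v\<parallel> \<le> \<parallel>u\<parallel> + \<parallel>v\<parallel>"
  using norm_triangle[of u "- v"] norm_scale[of v "-1"] assms mem by simp

lemma norm_triangle_via:
  assumes "u \<in> X" "v \<in> X" "w \<in> X"
  shows "\<parallel>u - w\<parallel> \<le> \<parallel>u - v\<parallel> + \<parallel>v - w\<parallel>"
  using norm_triangle[of "u - v" "v - w"] assms mem by simp

lemma norm_tendsto:
  assumes "\<And>n. s n \<in> X" "l \<in> X" "(\<lambda>n. \<parallel>s n - l\<parallel>) \<longlonglongrightarrow> 0"
  shows "(\<lambda>n. \<parallel>s n\<parallel>) \<longlonglongrightarrow> \<parallel>l\<parallel>"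
proof -
  have "\<bar>\<parallel>s n\<parallel> - \<parallel>l\<parallel>\<bar> \<le> \<parallel>s n - l\<parallel>" for n
    using norm_triangle[of "s n - l" l] norm_triangle[of "l - s n" "s n"]
      norm_minus_commute[of l "s n"] assms(1)[of n] assms(2) mem by (simp add: abs_le_iff)
  then have "(\<lambda>n. \<parallel>s n\<parallel> - \<parallel>l\<parallel>) \<longlonglongrightarrow> 0"
    by (intro Lim_null_comparison[OF _ assms(3)]) simp
  then show ?thesis by (rule LIM_zero_cancel)
qed

lemma bounded_form_tendsto:
  assumes "linear_form X f" "\<And>v. v \<in> X \<Longrightarrow> \<bar>f v\<bar> \<le> K * \<parallel>v\<parallel>"
    and "\<And>n. s n \<in> X" "l \<in> X" "(\<lambda>n. \<parallel>s n - l\<parallel>) \<longlonglongrightarrow> 0"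
  shows "(\<lambda>n. f (s n)) \<longlonglongrightarrow> f l"
proof -
  have "(\<lambda>n. f (s n) - f l) \<longlonglongrightarrow> 0"
  proof (rule Lim_null_comparison)
    show "\<forall>\<^sub>F n in sequentially. norm (f (s n) - f l) \<le> K * \<parallel>s n - l\<parallel>"
      using assms mem by (simp add: linear_form_diff[OF assms(1), symmetric])
    show "(\<lambda>n. K * \<parallel>s n - l\<parallel>) \<longlonglongrightarrow> 0" using tendsto_mult_right_zero[OF assms(5)] .
  qed
  then show ?thesis by (rule LIM_zero_cancel)
qed

text \<open>The subspaces cut out below by a form or by orthogonality (\<open>N\<close>,
  \<open>P\<close>, and \<open>Z\<close>, \<open>Y\<close> in the closed range argument) are common
  kernels of bounded forms, and each of these equations survives a limit in the seminorm.\<close>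

lemma complete_annihilator:
  assumes "complete_form X ip"
    and "\<And>i. i \<in> I \<Longrightarrow> linear_form X (f i)" "\<And>i. i \<in> I \<Longrightarrow> bounded_form X ip (f i)"
  shows "complete_form {x \<in> X. \<forall>i\<in>I. f i x = 0} ip"
  unfolding complete_form_def
proof (intro allI impI, elim conjE)
  fix s :: "nat \<Rightarrow> 'v"
  assume s: "\<forall>n. s n \<in> {x \<in> X. \<forall>i\<in>I. f i x = 0}"
    and c: "\<forall>e>0. \<exists>M. \<forall>m\<ge>M. \<forall>n\<ge>M. \<parallel>s m - s n\<parallel> < e"
  obtain l where l: "l \<in> X" "(\<lambda>n. \<parallel>s n - l\<parallel>) \<longlonglongrightarrow> 0"
    using assms(1) s c unfolding complete_form_def by blast
  have "f i l = 0" if i: "i \<in> I" for i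
  proof -
    obtain K where "\<forall>v\<in>X. \<bar>f i v\<bar> \<le> K * \<parallel>v\<parallel>"
      using assms(3)[OF i] unfolding bounded_form_def by blast
    then have "(\<lambda>n. f i (s n)) \<longlonglongrightarrow> f i l"
      using bounded_form_tendsto[of "f i" K s l] assms(2)[OF i] s l by auto
    moreover have "(\<lambda>n. f i (s n)) = (\<lambda>n. 0)" using s i by auto
    ultimately show "f i l = 0" using LIMSEQ_unique tendsto_const by metis
  qed
  then show "\<exists>l\<in>{x \<in> X. \<forall>i\<in>I. f i x = 0}. (\<lambda>n. \<parallel>s n - l\<parallel>) \<longlonglongrightarrow> 0" using l by blast
qed

lemma subspace_annihilator:
  assumes "\<And>i. i \<in> I \<Longrightarrow> linear_form X (f i)"
  shows "subspace {x \<in> X. \<forall>i\<in>I. f i x = 0}"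
proof -
  have "f i 0 = 0" if "i \<in> I" for i
    by (rule linear_form_zero[OF assms[OF that] mem(1)])
  moreover have "f i (x + y) = 0" if "i \<in> I" "x \<in> X" "y \<in> X" "f i x = 0" "f i y = 0" for i x y
    using linear_form_add[OF assms[OF that(1)] that(2,3)] that by simp
  moreover have "f i (c *\<^sub>R x) = 0" if "i \<in> I" "x \<in> X" "f i x = 0" for i x c
    using linear_form_scale[OF assms[OF that(1)] that(2)] that by simp
  ultimately show ?thesis using mem by (auto simp: subspace_def)
qed

lemma semi_inner_subspace:
  assumes "subspace Y" "Y \<subseteq> X"
  shows "semi_inner Y ip"
  by unfold_locales (use assms bilinear_form_mono[OF bilinear assms(2,2)] in \<open>auto intro: sym nonneg\<close>)

lemma bounded_form_ip: "u \<in> X \<Longrightarrow> bounded_form X ip (\<lambda>v. ip v u)"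
  unfolding bounded_form_def
  by (rule exI[of _ "\<parallel>u\<parallel>"]) (use Cauchy_Schwarz in \<open>auto simp: mult.commute\<close>)

text \<open>The representer minimises J v = ip v v - 2 l v. Working with a minimising sequence
  avoids passing to the quotient by the vectors of seminorm zero; accordingly the representer is
  unique only modulo these.\<close>

lemma riesz:
  assumes "complete_form X ip" "linear_form X l" "bounded_form X ip l"
  obtains r where "r \<in> X" "\<And>v. v \<in> X \<Longrightarrow> ip r v = l v"
proof -
  obtain K where K: "\<And>v. v \<in> X \<Longrightarrow> \<bar>l v\<bar> \<le> K * \<parallel>v\<parallel>"
    using assms(3) by (auto simp: bounded_form_def)
  define J where "J v = ip v v - 2 * l v" for v
  \<comment> \<open>Completing the square in the seminorm of v.\<close>
  have Jlow: "- K\<^sup>2 \<le> J v" if "v \<in> X" for v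
  proof -
    have "0 \<le> (\<parallel>v\<parallel> - K)\<^sup>2" by simp
    then show ?thesis using K[OF that] norm_sq[OF that] by (simp add: J_def power2_diff algebra_simps)
  qed
  define m where "m = Inf (J ` X)"
  have bdd: "bdd_below (J ` X)" using Jlow by (intro bdd_belowI2) auto
  have ne: "J ` X \<noteq> {}" using mem(1) by auto
  have m: "m \<le> J v" if "v \<in> X" for v
    unfolding m_def using that bdd by (intro cInf_lower) auto
  have "\<exists>v\<in>X. J v < m + 1 / real (Suc n)" for n
    using cInf_lessD[OF ne, of "m + 1 / real (Suc n)"] by (auto simp: m_def)
  then obtain s where s: "\<And>n. s n \<in> X" "\<And>n. J (s n) < m + 1 / real (Suc n)" by metis
  \<comment> \<open>Parallelogram identity: in 2 J(s i) + 2 J(s j) - 4 J(midpoint) the linear parts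
    cancel and the squared distance remains. The midpoint value is at least m, so the distance is
    controlled by the excesses of J(s i) and J(s j) over m.\<close>
  have par: "\<parallel>s i - s j\<parallel>\<^sup>2 \<le> 2 / real (Suc i) + 2 / real (Suc j)" for i j
  proof -
    let ?h = "(1/2) *\<^sub>R (s i + s j)"
    have sX: "s i \<in> X" "s j \<in> X" "s i + s j \<in> X" "s i - s j \<in> X" using s(1) mem by auto
    have 1: "\<parallel>s i - s j\<parallel>\<^sup>2 = ip (s i) (s i) + ip (s j) (s j) - 2 * ip (s i) (s j)"
      using ip_add_diff(3)[OF sX(1,2,4)] ip_add_diff(4)[OF sX(1,2,1)] ip_add_diff(4)[OF sX(1,2,2)]
        sym[OF sX(2,1)] norm_sq[OF sX(4)] by linarith
    have 2: "ip (s i + s j) (s i + s j) = ip (s i) (s i) + ip (s j) (s j) + 2 * ip (s i) (s j)"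
      using ip_add_diff(1)[OF sX(1,2,3)] ip_add_diff(2)[OF sX(1,2,1)] ip_add_diff(2)[OF sX(1,2,2)]
        sym[OF sX(2,1)] by linarith
    have "J ?h = ip (s i + s j) (s i + s j) / 4 - (l (s i) + l (s j))"
      using sX mem(4)[OF sX(3)] by (simp add: J_def ip_scale linear_form_scale[OF assms(2)] linear_form_add[OF assms(2)] del: scaleR_add_right) argo
    then have "\<parallel>s i - s j\<parallel>\<^sup>2 = 2 * J (s i) + 2 * J (s j) - 4 * J ?h"
      using 1 2 unfolding J_def by argo
    moreover have "m \<le> J ?h" by (rule m[OF mem(4)[OF sX(3)]])
    moreover have "2 / real (Suc i) = 2 * (1 / real (Suc i))" "2 / real (Suc j) = 2 * (1 / real (Suc j))"
      by simp_all
    ultimately show ?thesis using s(2)[of i] s(2)[of j] by argo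
  qed
  have "\<exists>M. \<forall>i\<ge>M. \<forall>j\<ge>M. \<parallel>s i - s j\<parallel> < e" if "e > 0" for e
  proof -
    obtain M where M: "4 / e\<^sup>2 < real M" using reals_Archimedean2 by blast
    have "\<parallel>s i - s j\<parallel> < e" if "i \<ge> M" "j \<ge> M" for i j
    proof -
      have Mp: "real M > 0" using M \<open>e > 0\<close> by (meson divide_pos_pos less_trans zero_less_numeral zero_less_power)
      have "2 / real (Suc i) \<le> 2 / real M" "2 / real (Suc j) \<le> 2 / real M"
        using that Mp by (auto intro!: divide_left_mono mult_pos_pos)
      then have "\<parallel>s i - s j\<parallel>\<^sup>2 \<le> 4 / real M" using par[of i j] by simp
      also have "\<dots> < e\<^sup>2" using M Mp \<open>e > 0\<close> by (simp add: field_simps)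
      finally show ?thesis using \<open>e > 0\<close> by (meson less_eq_real_def power_less_imp_less_base)
    qed
    then show ?thesis by blast
  qed
  then obtain r where r: "r \<in> X" "(\<lambda>n. \<parallel>s n - r\<parallel>) \<longlonglongrightarrow> 0"
    using assms(1) s(1) unfolding complete_form_def by blast
  have "(\<lambda>n. \<parallel>s n\<parallel>\<^sup>2 - 2 * l (s n)) \<longlonglongrightarrow> \<parallel>r\<parallel>\<^sup>2 - 2 * l r"
    using norm_tendsto[OF s(1) r] bounded_form_tendsto[OF assms(2) K s(1) r]
    by (intro tendsto_intros) auto
  then have lim: "(\<lambda>n. J (s n)) \<longlonglongrightarrow> J r" using s(1) r(1) by (simp add: J_def norm_sq)
  have "(\<lambda>n. m + 1 / real (Suc n)) \<longlonglongrightarrow> m + 0"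
    by (intro tendsto_intros LIMSEQ_Suc lim_1_over_n)
  then have Jr: "J r \<le> m + 0"
    by (rule LIMSEQ_le[OF lim]) (use s(2) less_imp_le in blast)
  have "ip r v = l v" if v: "v \<in> X" for v
  proof -
    \<comment> \<open>Minimality of r along the line r + t v: the increment of J is a quadratic
      polynomial in t without constant term.\<close>
    have "0 \<le> t\<^sup>2 * ip v v + 2 * t * (ip r v - l v)" for t
    proof -
      have "J r \<le> J (r + t *\<^sub>R v)" using Jr m[of "r + t *\<^sub>R v"] v r mem by simp
      moreover have "ip (r + t *\<^sub>R v) (r + t *\<^sub>R v) = ip r r + 2 * t * ip r v + t\<^sup>2 * ip v v"
        using v r(1) mem(2,4) sym[OF v r(1)] by (simp add: ip_simps power2_eq_square algebra_simps)
      moreover have "l (r + t *\<^sub>R v) = l r + t * l v"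
        using v r(1) mem(2,4) by (simp add: linear_form_scale[OF assms(2)] linear_form_add[OF assms(2)])
      ultimately show ?thesis by (simp add: J_def algebra_simps)
    qed
    then show ?thesis using quadratic_nonneg_imp_zero[of "ip v v" "ip r v - l v"] nonneg[OF v] by simp
  qed
  then show thesis using that r by blast
qed

lemma ip_null: "u \<in> X \<Longrightarrow> v \<in> X \<Longrightarrow> \<parallel>u\<parallel> = 0 \<Longrightarrow> ip u v = 0"
  using Cauchy_Schwarz[of u v] by simp

end

text \<open>Cauchy sequences and limits see only the diagonal of a form, so bounds between quadratic
  forms carry completeness over. In this way it passes from the H1 product to the energy, and from
  there to \<open>A\<close>, to \<open>D\<close> on \<open>P\<close>, and to the Schur
  complements.\<close>

lemma complete_form_equiv:
  assumes "complete_form X ip" "subspace X" "c > 0"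
    and "\<And>u. u \<in> X \<Longrightarrow> 0 \<le> ip u u"
    and low: "\<And>u. u \<in> X \<Longrightarrow> c * ip u u \<le> a u u" and up: "\<And>u. u \<in> X \<Longrightarrow> a u u \<le> C * ip u u"
  shows "complete_form X a"
  unfolding complete_form_def
proof (intro allI impI, elim conjE)
  fix s :: "nat \<Rightarrow> 'a"
  assume s: "\<forall>n. s n \<in> X" and c: "\<forall>e>0. \<exists>M. \<forall>m\<ge>M. \<forall>n\<ge>M. ipnorm a (s m - s n) < e"
  have low': "sqrt c * ipnorm ip u \<le> ipnorm a u" if "u \<in> X" for u
    using low[OF that] by (simp add: ipnorm_def flip: real_sqrt_mult)
  have up': "ipnorm a u \<le> sqrt C * ipnorm ip u" if "u \<in> X" for u
    using up[OF that] by (simp add: ipnorm_def flip: real_sqrt_mult)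
  have "\<exists>M. \<forall>m\<ge>M. \<forall>n\<ge>M. ipnorm ip (s m - s n) < e" if "e > 0" for e
  proof -
    have "sqrt c * e > 0" using that assms(3) by simp
    then obtain M where "\<forall>m\<ge>M. \<forall>n\<ge>M. ipnorm a (s m - s n) < sqrt c * e" using c by blast
    moreover have "s m - s n \<in> X" for m n using s assms(2) subspace_diff by blast
    ultimately have "\<forall>m\<ge>M. \<forall>n\<ge>M. sqrt c * ipnorm ip (s m - s n) < sqrt c * e"
      using low' by (meson le_less_trans)
    then show ?thesis using assms(3) by (auto simp: mult_less_cancel_left_pos)
  qed
  then obtain l where l: "l \<in> X" "(\<lambda>n. ipnorm ip (s n - l)) \<longlonglongrightarrow> 0"
    using assms(1) s unfolding complete_form_def by blast
  have d: "s n - l \<in> X" for n using s l assms(2) subspace_diff by blast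
  have "(\<lambda>n. ipnorm a (s n - l)) \<longlonglongrightarrow> 0"
  proof (rule Lim_null_comparison)
    have "0 \<le> ipnorm a (s n - l)" for n
      using low[OF d] assms(3) assms(4)[OF d] unfolding ipnorm_def
      by (meson mult_nonneg_nonneg less_imp_le order_trans real_sqrt_ge_zero)
    then show "\<forall>\<^sub>F n in sequentially. norm (ipnorm a (s n - l)) \<le> sqrt C * ipnorm ip (s n - l)"
      using up'[OF d] by simp
    show "(\<lambda>n. sqrt C * ipnorm ip (s n - l)) \<longlonglongrightarrow> 0" using tendsto_mult_right_zero[OF l(2)] .
  qed
  then show "\<exists>l\<in>X. (\<lambda>n. ipnorm a (s n - l)) \<longlonglongrightarrow> 0" using l(1) by blast
qed

section \<open>Saddle-point problems\<close>

lemma le_of_square_le_mult: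
  fixes n k :: real
  assumes "n\<^sup>2 \<le> k * n" "0 \<le> k"
  shows "n \<le> k"
proof (cases "n \<le> 0")
  case False
  then have "n * n \<le> k * n" "0 < n" using assms(1) by (auto simp: power2_eq_square)
  then show ?thesis by simp
qed (use assms in simp)

text \<open>Two instances occur: \<open>X\<close> is \<open>N\<close> with \<open>E\<close> zero for
  the limit system, and \<open>X\<close> is \<open>U\<close> with \<open>E\<close> equal to \<kappa>
  D for the penalised one. In \<open>stable\<close>, z is the lifting of u to \<open>W\<close>, so
  the assumption is coercivity of the Schur complement; for zero \<open>E\<close> it is the inf-sup
  condition, squared.\<close>

locale saddle = W: semi_inner W A + X: semi_inner X ip
  for W :: "'w::real_vector set" and A and X :: "'v::real_vector set" and ip +
  fixes b :: "'v \<Rightarrow> 'w \<Rightarrow> real" and E :: "'v \<Rightarrow> 'v \<Rightarrow> real" and c M K :: real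
  assumes W_complete: "complete_form W A" and X_complete: "complete_form X ip"
    and b_bilinear: "bilinear_form X W b"
    and b_bound: "u \<in> X \<Longrightarrow> w \<in> W \<Longrightarrow> \<bar>b u w\<bar> \<le> M * ipnorm ip u * ipnorm A w"
    and M_nonneg: "0 \<le> M"
    and E_bilinear: "bilinear_form X X E"
    and E_sym: "u \<in> X \<Longrightarrow> v \<in> X \<Longrightarrow> E u v = E v u"
    and E_nonneg: "u \<in> X \<Longrightarrow> 0 \<le> E u u"
    and E_bound: "u \<in> X \<Longrightarrow> E u u \<le> K * ip u u"
    and c_pos: "0 < c"
    and stable: "u \<in> X \<Longrightarrow> z \<in> W \<Longrightarrow> (\<And>w. w \<in> W \<Longrightarrow> A z w = b u w) \<Longrightarrow> c * ip u u \<le> A z z + E u u"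
begin

lemma lift_exists:
  assumes "u \<in> X"
  shows "\<exists>z\<in>W. \<forall>w\<in>W. A z w = b u w"
proof -
  have "bounded_form W A (b u)" unfolding bounded_form_def using b_bound[OF assms] by blast
  then show ?thesis
    using W.riesz[OF W_complete bilinear_form_right[OF b_bilinear assms]] by metis
qed

lemma lift_bound:
  assumes "u \<in> X" "z \<in> W" "\<And>w. w \<in> W \<Longrightarrow> A z w = b u w"
  shows "ipnorm A z \<le> M * ipnorm ip u"
proof (rule le_of_square_le_mult)
  show "(ipnorm A z)\<^sup>2 \<le> M * ipnorm ip u * ipnorm A z"
    using b_bound[OF assms(1,2)] assms(3)[OF assms(2)] W.norm_sq[OF assms(2)] by simp
  show "0 \<le> M * ipnorm ip u" using M_nonneg X.norm_nonneg[OF assms(1)] by simp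
qed

text \<open>The convenient unknown is w + z, with z the lifting of u: by the first equation it
  represents \<open>F\<close> in \<open>W\<close>, so its norm is at most \<open>kF\<close>. The
  second equation, tested with u, becomes A z z + E u u = A z (w + z) - G u, and
  \<open>stable\<close> applies to the left side.\<close>

lemma solution_bound:
  assumes w: "w \<in> W" and u: "u \<in> X"
    and eq1: "\<And>w'. w' \<in> W \<Longrightarrow> A w w' + b u w' = F w'"
    and eq2: "\<And>v. v \<in> X \<Longrightarrow> b v w - E u v = G v"
    and F: "\<And>w'. w' \<in> W \<Longrightarrow> \<bar>F w'\<bar> \<le> kF * ipnorm A w'"
    and G: "\<And>v. v \<in> X \<Longrightarrow> \<bar>G v\<bar> \<le> kG * ipnorm ip v"
    and k: "0 \<le> kF" "0 \<le> kG"
  shows "ipnorm ip u \<le> (M * kF + kG) / c"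
    and "ipnorm A w \<le> kF + M * ((M * kF + kG) / c)"
proof -
  obtain z where z: "z \<in> W" "\<And>w. w \<in> W \<Longrightarrow> A z w = b u w" using lift_exists[OF u] by blast
  note zb = lift_bound[OF u z]
  have wz: "w + z \<in> W" using w z W.mem by simp
  have "(ipnorm A (w + z))\<^sup>2 \<le> kF * ipnorm A (w + z)"
    using W.norm_sq[OF wz] W.ip_add_diff(1)[OF w z(1) wz] z(2)[OF wz] eq1[OF wz] F[OF wz] by linarith
  then have nwz: "ipnorm A (w + z) \<le> kF" using k(1) by (rule le_of_square_le_mult)
  have "A z z + E u u = A z (w + z) - G u"
    using W.ip_add_diff(2)[OF w z(1) z(1)] z(2)[OF w] eq2[OF u] by linarith
  also have "\<dots> \<le> ipnorm A z * ipnorm A (w + z) + kG * ipnorm ip u"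
    using W.Cauchy_Schwarz[OF z(1) wz] G[OF u] by linarith
  also have "\<dots> \<le> M * ipnorm ip u * kF + kG * ipnorm ip u"
    using zb nwz k M_nonneg X.norm_nonneg[OF u] W.norm_nonneg[OF wz] by (intro add_mono mult_mono) auto
  finally have "c * (ipnorm ip u)\<^sup>2 \<le> (M * kF + kG) * ipnorm ip u"
    using stable[OF u z] X.norm_sq[OF u] by (simp add: algebra_simps)
  then have "(ipnorm ip u)\<^sup>2 \<le> (M * kF + kG) / c * ipnorm ip u"
    using c_pos by (simp add: field_simps)
  then show ub: "ipnorm ip u \<le> (M * kF + kG) / c"
    by (rule le_of_square_le_mult) (use k M_nonneg c_pos in simp)
  have "ipnorm A w \<le> ipnorm A (w + z) + ipnorm A z"
    using W.norm_triangle_diff[OF wz z(1)] by simp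
  also have "\<dots> \<le> kF + M * ((M * kF + kG) / c)"
    using nwz zb mult_left_mono[OF ub M_nonneg] by linarith
  finally show "ipnorm A w \<le> kF + M * ((M * kF + kG) / c)" .
qed

text \<open>The first equation gives w in terms of u; eliminating it leaves an elliptic problem for u
  whose form is the Schur complement A (S u) (S v) + E u v, where S is the lifting of b to W.\<close>

lemma solution_exists:
  assumes F: "linear_form W F" "bounded_form W A F" and G: "linear_form X G" "bounded_form X ip G"
  obtains w u where "w \<in> W" "u \<in> X" "\<And>w'. w' \<in> W \<Longrightarrow> A w w' + b u w' = F w'"
    "\<And>v. v \<in> X \<Longrightarrow> b v w - E u v = G v"
proof -
  obtain S where S: "\<And>u. u \<in> X \<Longrightarrow> S u \<in> W" "\<And>u w. u \<in> X \<Longrightarrow> w \<in> W \<Longrightarrow> A (S u) w = b u w"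
    using lift_exists by metis
  obtain y where y: "y \<in> W" "\<And>w. w \<in> W \<Longrightarrow> A y w = F w" using W.riesz[OF W_complete F] by blast
  define a where "a u v = A (S u) (S v) + E u v" for u v
  have aS: "a u v = b u (S v) + E u v" if "u \<in> X" "v \<in> X" for u v
    using S that by (simp add: a_def)
  have asym: "a u v = a v u" if "u \<in> X" "v \<in> X" for u v
    using S that W.sym E_sym by (simp add: a_def)
  have al: "linear_form X (\<lambda>u. a u v)" if "v \<in> X" for v
  proof -
    have "linear_form X (\<lambda>u. b u (S v) + E u v)"
      using bilinear_form_left[OF b_bilinear S(1)[OF that]] bilinear_form_left[OF E_bilinear that]
      by (simp add: linear_form_def algebra_simps)
    then show ?thesis using aS[OF _ that] X.mem by (simp add: linear_form_def)
  qed
  have ar: "linear_form X (a v)" if "v \<in> X" for v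
    using al[OF that] asym[OF that] X.mem by (simp add: linear_form_def)
  have low: "c * ip u u \<le> a u u" if "u \<in> X" for u
    using stable[OF that S(1)[OF that]] S(2)[OF that] by (simp add: a_def)
  have up: "a u u \<le> (M\<^sup>2 + K) * ip u u" if "u \<in> X" for u
  proof -
    have "A (S u) (S u) = (ipnorm A (S u))\<^sup>2" using W.norm_sq S(1) that by simp
    also have "\<dots> \<le> (M * ipnorm ip u)\<^sup>2"
      using lift_bound[OF that S(1)[OF that]] S(2)[OF that] W.norm_nonneg[OF S(1)[OF that]] by (intro power_mono) auto
    also have "\<dots> = M\<^sup>2 * ip u u" using X.norm_sq[OF that] by (simp add: power_mult_distrib)
    finally show ?thesis using E_bound[OF that] by (simp add: a_def algebra_simps)
  qed
  interpret a: semi_inner X a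
  proof
    show "bilinear_form X X a" using al ar by (simp add: bilinear_form_def)
    show "0 \<le> a u u" if "u \<in> X" for u using W.nonneg[OF S(1)[OF that]] E_nonneg[OF that] by (simp add: a_def)
  qed (use asym X.subspace in auto)
  have ac: "complete_form X a"
    using complete_form_equiv[OF X_complete X.subspace c_pos, of a "M\<^sup>2 + K"] X.nonneg low up by blast
  \<comment> \<open>Substituting w = y - S u, with y the representer of \<open>F\<close>, into the
    second equation leaves a u v = b v y - G v.\<close>
  define l where "l v = b v y - G v" for v
  have "linear_form X l"
    using bilinear_form_left[OF b_bilinear y(1)] G(1) by (simp add: l_def linear_form_def algebra_simps)
  moreover have "bounded_form X a l"
  proof -
    obtain g where g: "\<And>v. v \<in> X \<Longrightarrow> \<bar>G v\<bar> \<le> g * ipnorm ip v"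
      using G(2) by (auto simp: bounded_form_def)
    have "\<bar>l v\<bar> \<le> ((M * ipnorm A y + \<bar>g\<bar>) / sqrt c) * ipnorm a v" if "v \<in> X" for v
    proof -
      have "\<bar>l v\<bar> \<le> M * ipnorm ip v * ipnorm A y + g * ipnorm ip v"
        using b_bound[OF that y(1)] g[OF that] by (simp add: l_def)
      also have "\<dots> \<le> M * ipnorm ip v * ipnorm A y + \<bar>g\<bar> * ipnorm ip v"
        using X.norm_nonneg[OF that] by (simp add: mult_right_mono)
      also have "\<dots> = (M * ipnorm A y + \<bar>g\<bar>) * ipnorm ip v" by (simp add: algebra_simps)
      also have "\<dots> \<le> (M * ipnorm A y + \<bar>g\<bar>) * (ipnorm a v / sqrt c)"
      proof (rule mult_left_mono)
        have "sqrt c * ipnorm ip v \<le> ipnorm a v"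
          using low[OF that] by (simp add: ipnorm_def flip: real_sqrt_mult)
        then show "ipnorm ip v \<le> ipnorm a v / sqrt c" using c_pos by (simp add: field_simps)
        show "0 \<le> M * ipnorm A y + \<bar>g\<bar>" using M_nonneg W.norm_nonneg[OF y(1)] by simp
      qed
      finally show ?thesis by simp
    qed
    then show ?thesis unfolding bounded_form_def by blast
  qed
  ultimately obtain u where u: "u \<in> X" "\<And>v. v \<in> X \<Longrightarrow> a u v = l v" using a.riesz[OF ac] by metis
  have "A (y - S u) w' + b u w' = F w'" if "w' \<in> W" for w'
    using W.ip_add_diff(3)[OF y(1) S(1)[OF u(1)] that] y(2)[OF that] S(2)[OF u(1) that] by linarith
  moreover have "b v (y - S u) - E u v = G v" if "v \<in> X" for v
  proof -
    have "b v (y - S u) = b v y - b v (S u)"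
      by (rule linear_form_diff[OF bilinear_form_right[OF b_bilinear that] y(1) S(1)[OF u(1)]])
    then show ?thesis using u(2)[OF that] aS[OF that u(1)] asym[OF that u(1)] E_sym[OF that u(1)]
      by (simp add: l_def)
  qed
  moreover have "y - S u \<in> W" using y S u W.mem by simp
  ultimately show thesis using that u(1) by blast
qed

end

text \<open>The map sending w to b(., w) has closed range because it is a compact perturbation of the
  identity; the closed range is the annihilator of the kernel of the transpose.\<close>

lemma (in semi_inner) closed_range_of_compact_perturbation:
  fixes k :: "'v \<Rightarrow> 'v \<Rightarrow> real"
  assumes X_complete: "complete_form X ip"
    and W: "subspace W" "W \<subseteq> X" "complete_form W ip"
    and k: "bilinear_form X X k"
    and k_bound: "\<And>u v. u \<in> X \<Longrightarrow> v \<in> X \<Longrightarrow> \<bar>k u v\<bar> \<le> M * ipnorm ip u * ipnorm ip v"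
    and k_compact: "\<And>s::nat \<Rightarrow> 'v. (\<And>n. s n \<in> W \<and> ipnorm ip (s n) \<le> 1) \<Longrightarrow>
        \<exists>r::nat \<Rightarrow> nat. strict_mono r \<and>
          (\<forall>e>0. \<exists>M. \<forall>m\<ge>M. \<forall>n\<ge>M. k (s (r m) - s (r n)) (s (r m) - s (r n)) < e)"
    and b: "\<And>u w. u \<in> X \<Longrightarrow> w \<in> W \<Longrightarrow> b u w = ip u w - k u w"
  obtains C where "0 \<le> C"
    "\<And>u. u \<in> X \<Longrightarrow> (\<And>h. h \<in> X \<Longrightarrow> (\<And>w. w \<in> W \<Longrightarrow> b h w = 0) \<Longrightarrow> ip u h = 0) \<Longrightarrow>
       \<exists>w\<in>W. ipnorm ip w \<le> C * ipnorm ip u \<and> (\<forall>v\<in>X. b v w = ip u v)"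
proof -
  interpret W: semi_inner W ip by (rule semi_inner_subspace[OF W(1,2)])
  have Wmem: "w \<in> X" if "w \<in> W" for w using W(2) that by blast
  have bl: "linear_form X (\<lambda>u. b u w)" if "w \<in> W" for w
  proof -
    have "linear_form X (\<lambda>u. ip u w - k u w)"
      using bilinear_form_left[OF bilinear Wmem[OF that]] bilinear_form_left[OF k Wmem[OF that]]
      by (simp add: linear_form_def algebra_simps)
    then show ?thesis using b[OF _ that] mem by (simp add: linear_form_def)
  qed
  have br: "linear_form W (b u)" if "u \<in> X" for u
  proof -
    have "linear_form W (\<lambda>w. ip u w - k u w)"
      using linear_form_mono[OF bilinear_form_right[OF bilinear that] W(2)]
        linear_form_mono[OF bilinear_form_right[OF k that] W(2)]
      by (simp add: linear_form_def algebra_simps)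
    then show ?thesis using b[OF that] W.mem by (simp add: linear_form_def)
  qed
  \<comment> \<open>The summand 1 accounts for the inner product, by Cauchy-Schwarz; the absolute
    value keeps the constant nonnegative whatever the sign of \<open>M\<close>.\<close>
  define M' where "M' = 1 + \<bar>M\<bar>"
  have b_bound: "\<bar>b u w\<bar> \<le> M' * ipnorm ip u * ipnorm ip w" if "u \<in> X" "w \<in> W" for u w
  proof -
    have w: "w \<in> X" using that(2) Wmem by blast
    have "M * ipnorm ip u * ipnorm ip w \<le> \<bar>M\<bar> * ipnorm ip u * ipnorm ip w"
      using norm_nonneg[OF that(1)] norm_nonneg[OF w] by (intro mult_right_mono) auto
    then show ?thesis using Cauchy_Schwarz[OF that(1) w] k_bound[OF that(1) w] b[OF that]
      by (simp add: M'_def algebra_simps)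
  qed
  have "\<exists>q\<in>X. \<forall>u\<in>X. ip q u = b u w" if "w \<in> W" for w
  proof -
    have "bounded_form X ip (\<lambda>u. b u w)"
      unfolding bounded_form_def
      by (rule exI[of _ "M' * ipnorm ip w"]) (use b_bound that in \<open>auto simp: algebra_simps\<close>)
    then show ?thesis using riesz[OF X_complete bl[OF that]] by metis
  qed
  \<comment> \<open>t w is the Riesz representer of b(., w) in \<open>X\<close>: the operator whose
    range has to be shown closed.\<close>
  then obtain t where t: "\<And>w. w \<in> W \<Longrightarrow> t w \<in> X" "\<And>w u. w \<in> W \<Longrightarrow> u \<in> X \<Longrightarrow> ip (t w) u = b u w"
    by metis
  define Z where "Z = {w \<in> W. \<forall>u\<in>X. b u w = 0}"
  have "bounded_form W ip (b u)" if "u \<in> X" for u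
    using b_bound[OF that] unfolding bounded_form_def by blast
  then have Z: "subspace Z" "Z \<subseteq> W" "complete_form Z ip"
    unfolding Z_def using br W.subspace_annihilator[of X b] W.complete_annihilator[OF W(3), of X b] by auto
  interpret Z: semi_inner Z ip by (rule W.semi_inner_subspace[OF Z(1,2)])
  \<comment> \<open>A lower bound for t can only hold away from its kernel \<open>Z\<close>. The
    complement is taken inside \<open>W\<close>, so that the preimages found later belong to
    \<open>W\<close>.\<close>
  define Y where "Y = {w \<in> W. \<forall>z\<in>Z. ip w z = 0}"
  have "linear_form W (\<lambda>w. ip w z)" "bounded_form W ip (\<lambda>w. ip w z)" if "z \<in> Z" for z
    using W.bounded_form_ip bilinear_form_left[OF W.bilinear] that Z(2) by auto
  then have Y: "subspace Y" "Y \<subseteq> W" "complete_form Y ip"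
    unfolding Y_def using W.subspace_annihilator[of Z "\<lambda>z w. ip w z"]
      W.complete_annihilator[OF W(3), of Z "\<lambda>z w. ip w z"] by auto
  interpret Y: semi_inner Y ip by (rule W.semi_inner_subspace[OF Y(1,2)])
  have split: "\<exists>y\<in>Y. w - y \<in> Z" if "w \<in> W" for w
  proof -
    have "linear_form Z (ip w)" "bounded_form Z ip (ip w)"
      using linear_form_mono[OF bilinear_form_right[OF W.bilinear that] Z(2)]
        W.Cauchy_Schwarz[OF that] Z(2) by (auto simp: bounded_form_def)
    then obtain z where z: "z \<in> Z" "\<And>v. v \<in> Z \<Longrightarrow> ip z v = ip w v" using Z.riesz[OF Z(3)] by metis
    have zW: "z \<in> W" using z Z(2) by blast
    have "ip (w - z) v = 0" if "v \<in> Z" for v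
      using W.ip_add_diff(3)[OF \<open>w \<in> W\<close> zW] that Z(2) z(2) by fastforce
    then have "w - z \<in> Y" using W.mem(3) that zW by (auto simp: Y_def)
    then show ?thesis using z(1) by force
  qed
  \<comment> \<open>Otherwise there are unit vectors of \<open>Y\<close> with t-images tending to 0.
    Compactness of k gives a subsequence that is Cauchy in the full norm; its limit is a unit vector
    in both \<open>Y\<close> and \<open>Z\<close>, hence orthogonal to itself.\<close>
  have "\<exists>\<gamma>>0. \<forall>w\<in>Y. \<gamma> * ipnorm ip w \<le> ipnorm ip (t w)"
  proof (rule ccontr)
    assume "\<not> ?thesis"
    then have "\<exists>w\<in>Y. ipnorm ip (t w) < 1 / real (Suc n) * ipnorm ip w" for n
      by (metis not_le of_nat_0_less_iff zero_less_Suc zero_less_divide_1_iff)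
    then obtain v where v: "\<And>n. v n \<in> Y" "\<And>n. ipnorm ip (t (v n)) < 1 / real (Suc n) * ipnorm ip (v n)"
      by metis
    have vp: "0 < ipnorm ip (v n)" for n
    proof -
      have "0 \<le> ipnorm ip (t (v n))" using norm_nonneg t(1) v(1) Y(2) by blast
      then have "0 < 1 / real (Suc n) * ipnorm ip (v n)" using v(2)[of n] by linarith
      then show ?thesis by (rule zero_less_mult_pos) simp
    qed
    define s where "s n = (1 / ipnorm ip (v n)) *\<^sub>R v n" for n
    have sY: "s n \<in> Y" for n using v Y.mem by (simp add: s_def)
    then have sW: "s n \<in> W" for n using Y(2) by blast
    have s1: "ipnorm ip (s n) = 1" for n
      using Y.norm_scale[OF v(1)] vp[of n] by (simp add: s_def)
    have sb: "\<bar>b u (s n)\<bar> \<le> 1 / real (Suc n) * ipnorm ip u" if "u \<in> X" for u n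
    proof -
      have vW: "v n \<in> W" using v Y(2) by blast
      have "\<bar>b u (v n)\<bar> \<le> ipnorm ip (t (v n)) * ipnorm ip u"
        using Cauchy_Schwarz[OF t(1)[OF vW] that] t(2)[OF vW that] by simp
      also have "\<dots> \<le> 1 / real (Suc n) * ipnorm ip (v n) * ipnorm ip u"
        using v(2)[of n] norm_nonneg[OF that] by (intro mult_right_mono) auto
      finally have *: "\<bar>b u (v n)\<bar> / ipnorm ip (v n) \<le> 1 / real (Suc n) * ipnorm ip u"
        using vp[of n] by (simp add: field_simps)
      have "b u (s n) = 1 / ipnorm ip (v n) * b u (v n)"
        unfolding s_def by (rule linear_form_scale[OF br[OF that] vW])
      then show ?thesis using * vp[of n] by (simp add: abs_mult)
    qed
    have "s n \<in> W \<and> ipnorm ip (s n) \<le> 1" for n using sW[of n] s1[of n] by simp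
    from k_compact[of s, OF this] obtain r :: "nat \<Rightarrow> nat" where r0: "strict_mono r \<and>
        (\<forall>e>0. \<exists>M. \<forall>m\<ge>M. \<forall>n\<ge>M. k (s (r m) - s (r n)) (s (r m) - s (r n)) < e)"
      by (elim exE)
    note r = conjunct1[OF r0] conjunct2[OF r0, rule_format]
    \<comment> \<open>The squared norm of a difference d is b d d + k d d. The first term is small
      because the s n almost annihilate b, and the factor 2 bounds the distance of two unit
      vectors.\<close>
    have dsq: "(ipnorm ip (s m - s n))\<^sup>2 \<le>
        (1 / real (Suc m) + 1 / real (Suc n)) * 2 + k (s m - s n) (s m - s n)" for m n
    proof -
      have d: "s m - s n \<in> W" "s m - s n \<in> X" using W.mem sW Wmem by auto
      have dn: "ipnorm ip (s m - s n) \<le> 2"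
        using W.norm_triangle_diff[OF sW sW, of m n] s1 by simp
      have "b (s m - s n) (s m - s n) = b (s m - s n) (s m) - b (s m - s n) (s n)"
        by (rule linear_form_diff[OF br[OF d(2)] sW sW])
      also have "\<dots> \<le> (1 / real (Suc m) + 1 / real (Suc n)) * ipnorm ip (s m - s n)"
        using sb[OF d(2), of m] sb[OF d(2), of n] by (simp add: algebra_simps)
      also have "\<dots> \<le> (1 / real (Suc m) + 1 / real (Suc n)) * 2"
        using dn by (intro mult_left_mono) auto
      finally show ?thesis using b[OF d(2,1)] norm_sq[OF d(2)] by linarith
    qed
    have "\<exists>M. \<forall>m\<ge>M. \<forall>n\<ge>M. ipnorm ip (s (r m) - s (r n)) < e" if "e > 0" for e
    proof -
      \<comment> \<open>By \<open>dsq\<close> the two quotients enter with the factor 2: bounds by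
        e^2/8 give e^2/2 in total, and the k-term contributes the other half.\<close>
      have e2: "e\<^sup>2 / 2 > 0" "e\<^sup>2 / 8 > 0" using that by simp_all
      obtain M1 where M1: "\<And>m n. m \<ge> M1 \<Longrightarrow> n \<ge> M1 \<Longrightarrow>
          k (s (r m) - s (r n)) (s (r m) - s (r n)) < e\<^sup>2 / 2" using r(2)[OF e2(1)] by blast
      obtain M2 where M2: "M2 > 0" "inverse (real M2) < e\<^sup>2 / 8"
        using ex_inverse_of_nat_less[OF e2(2)] by blast
      have "ipnorm ip (s (r m) - s (r n)) < e" if mn: "m \<ge> max M1 M2" "n \<ge> max M1 M2" for m n
      proof -
        have small: "1 / real (Suc (r j)) < e\<^sup>2 / 8" if "j \<ge> M2" for j
        proof -
          have "M2 \<le> r j" using seq_suble[OF r(1), of j] that by linarith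
          then have "1 / real (Suc (r j)) \<le> 1 / real M2" using M2(1) by (intro divide_left_mono) auto
          then show ?thesis using M2(2) by (simp add: inverse_eq_divide)
        qed
        have "(ipnorm ip (s (r m) - s (r n)))\<^sup>2 < e\<^sup>2"
          using dsq[of "r m" "r n"] M1[of m n] small[of m] small[of n] mn by simp
        then show ?thesis using \<open>e > 0\<close> by (meson less_eq_real_def power_less_imp_less_base)
      qed
      then show ?thesis by blast
    qed
    then obtain l where l: "l \<in> Y" "(\<lambda>n. ipnorm ip (s (r n) - l)) \<longlonglongrightarrow> 0"
      using Y(3)[unfolded complete_form_def, rule_format, of "\<lambda>n. s (r n)"] sY by blast
    have lW: "l \<in> W" using l Y(2) by blast
    have "(\<lambda>n. ipnorm ip (s (r n))) \<longlonglongrightarrow> ipnorm ip l" by (rule Y.norm_tendsto[OF sY l])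
    then have l1: "ipnorm ip l = 1" by (simp add: s1 LIMSEQ_const_iff)
    have "b u l = 0" if "u \<in> X" for u
    proof -
      have "(\<lambda>n. b u (s (r n))) \<longlonglongrightarrow> b u l"
        using W.bounded_form_tendsto[OF br[OF that] b_bound[OF that] sW lW l(2)] .
      moreover have "(\<lambda>n. b u (s n)) \<longlonglongrightarrow> 0"
      proof (rule Lim_null_comparison)
        show "\<forall>\<^sub>F n in sequentially. norm (b u (s n)) \<le> 1 / real (Suc n) * ipnorm ip u"
          using sb[OF that] by simp
        show "(\<lambda>n. 1 / real (Suc n) * ipnorm ip u) \<longlonglongrightarrow> 0"
          by (intro tendsto_mult_left_zero LIMSEQ_Suc lim_1_over_n)
      qed
      then have "(\<lambda>n. b u (s (r n))) \<longlonglongrightarrow> 0"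
        using LIMSEQ_subseq_LIMSEQ[OF _ r(1)] unfolding o_def by blast
      ultimately show ?thesis using LIMSEQ_unique by blast
    qed
    then have "l \<in> Z" using lW by (auto simp: Z_def)
    then have "ip l l = 0" using l(1) by (auto simp: Y_def)
    then show False using l1 by (simp add: ipnorm_def)
  qed
  then obtain \<gamma> where \<gamma>: "0 < \<gamma>" "\<And>w. w \<in> Y \<Longrightarrow> \<gamma> * ipnorm ip w \<le> ipnorm ip (t w)" by blast
  \<comment> \<open>Normal equations: instead of solving t w = u directly, look for w in
    \<open>Y\<close> with t w - u orthogonal to the image of \<open>Y\<close>. By the lower bound, a
    is an equivalent inner product on \<open>Y\<close>, so Riesz applies.\<close>
  define a where "a v w = ip (t v) (t w)" for v w
  have ab: "a v w = b (t w) v" if "v \<in> W" "w \<in> W" for v w using t that by (simp add: a_def)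
  have asym: "a v w = a w v" if "v \<in> W" "w \<in> W" for v w using t that sym by (simp add: a_def)
  have al: "linear_form W (\<lambda>v. a v w)" if "w \<in> W" for w
    using br[OF t(1)[OF that]] ab[OF _ that] W.mem by (simp add: linear_form_def)
  have ar: "linear_form W (a w)" if "w \<in> W" for w
    using al[OF that] asym[OF that] W.mem by (simp add: linear_form_def)
  have YX: "w \<in> X" "w \<in> W" if "w \<in> Y" for w using that Y(2) Wmem by auto
  have tup: "ipnorm ip (t w) \<le> M' * ipnorm ip w" if "w \<in> W" for w
  proof (rule le_of_square_le_mult)
    show "(ipnorm ip (t w))\<^sup>2 \<le> M' * ipnorm ip w * ipnorm ip (t w)"
      using b_bound[OF t(1)[OF that] that] t(2)[OF that t(1)[OF that]] norm_sq[OF t(1)[OF that]]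
      by (simp add: algebra_simps)
    show "0 \<le> M' * ipnorm ip w" using W.norm_nonneg[OF that] by (simp add: M'_def)
  qed
  have alow: "\<gamma>\<^sup>2 * ip w w \<le> a w w" if "w \<in> Y" for w
    using power_mono[OF \<gamma>(2)[OF that], of 2] \<gamma>(1) Y.norm_nonneg[OF that]
      Y.norm_sq[OF that] norm_sq[OF t(1)[OF YX(2)[OF that]]]
    by (simp add: a_def power_mult_distrib)
  have aup: "a w w \<le> M'\<^sup>2 * ip w w" if "w \<in> Y" for w
    using power_mono[OF tup[OF YX(2)[OF that]], of 2] norm_nonneg[OF t(1)[OF YX(2)[OF that]]]
      Y.norm_sq[OF that] norm_sq[OF t(1)[OF YX(2)[OF that]]]
    by (simp add: a_def power_mult_distrib)
  interpret a: semi_inner Y a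
  proof
    show "bilinear_form Y Y a"
      using al ar linear_form_mono[OF _ Y(2)] YX unfolding bilinear_form_def by blast
    show "0 \<le> a w w" if "w \<in> Y" for w using nonneg t(1) YX(2) that by (simp add: a_def)
  qed (use asym YX Y(1) in auto)
  have "\<gamma>\<^sup>2 > 0" using \<gamma>(1) by simp
  then have ac: "complete_form Y a"
    using complete_form_equiv[OF Y(3) Y(1), of "\<gamma>\<^sup>2" a "M'\<^sup>2"] Y.nonneg alow aup by blast
  show thesis
  proof (rule that[of "1 / \<gamma>"])
    show "0 \<le> 1 / \<gamma>" using \<gamma>(1) by simp
    fix u assume u: "u \<in> X" and orth: "\<And>h. h \<in> X \<Longrightarrow> (\<And>w. w \<in> W \<Longrightarrow> b h w = 0) \<Longrightarrow> ip u h = 0"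
    have "linear_form Y (b u)" using linear_form_mono[OF br[OF u] Y(2)] .
    moreover have "bounded_form Y a (b u)"
      unfolding bounded_form_def
    proof (intro exI ballI)
      fix w assume w: "w \<in> Y"
      have "ipnorm a w = ipnorm ip (t w)" by (simp add: ipnorm_def a_def)
      then show "\<bar>b u w\<bar> \<le> ipnorm ip u * ipnorm a w"
        using Cauchy_Schwarz[OF t(1)[OF YX(2)[OF w]] u] t(2)[OF YX(2)[OF w] u] by (simp add: mult.commute)
    qed
    ultimately obtain w where w: "w \<in> Y" "\<And>v. v \<in> Y \<Longrightarrow> a w v = b u v" using a.riesz[OF ac] by metis
    have wW: "w \<in> W" using w YX by blast
    \<comment> \<open>The residual q annihilates \<open>W\<close> through b, so it lies in the
      kernel of the transpose and u is orthogonal to it by assumption. Since ip (t w) q = b q w = 0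
      as well, q is orthogonal to itself.\<close>
    define q where "q = t w - u"
    have q: "q \<in> X" using t(1)[OF wW] u mem by (simp add: q_def)
    have bq: "b q v = b (t w) v - b u v" if "v \<in> W" for v
      unfolding q_def by (rule linear_form_diff[OF bl[OF that] t(1)[OF wW] u])
    have "b q v = 0" if v: "v \<in> W" for v
    proof -
      obtain y where y: "y \<in> Y" "v - y \<in> Z" using split[OF v] by blast
      have "b q y = 0" using bq[OF YX(2)[OF y(1)]] w(2)[OF y(1)] ab[OF YX(2)[OF y(1)] wW]
          asym[OF wW YX(2)[OF y(1)]] by simp
      moreover have "b q (v - y) = b q v - b q y"
        by (rule linear_form_diff[OF br[OF q] v YX(2)[OF y(1)]])
      moreover have "b q (v - y) = 0" using y(2) q by (auto simp: Z_def)
      ultimately show ?thesis by simp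
    qed
    then have "ip u q = 0" "ip (t w) q = 0" using orth[OF q] t(2)[OF wW q] wW by auto
    then have "ip q q = 0" using ip_add_diff(3)[OF t(1)[OF wW] u q] by (simp add: q_def)
    then have q0: "ipnorm ip q = 0" by (simp add: ipnorm_def)
    have eq: "b v w = ip u v" if "v \<in> X" for v
      using ip_null[OF q that q0] ip_add_diff(3)[OF t(1)[OF wW] u that] t(2)[OF wW that]
      by (simp add: q_def)
    have "ipnorm ip (t w) \<le> ipnorm ip u"
      using norm_triangle[OF q u] q0 by (simp add: q_def)
    then have "\<gamma> * ipnorm ip w \<le> ipnorm ip u" using \<gamma>(2)[OF w(1)] by linarith
    then have "ipnorm ip w \<le> 1 / \<gamma> * ipnorm ip u" using \<gamma>(1) by (simp add: field_simps)
    then show "\<exists>w\<in>W. ipnorm ip w \<le> 1 / \<gamma> * ipnorm ip u \<and> (\<forall>v\<in>X. b v w = ip u v)"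
      using wW eq by blast
  qed
qed

section \<open>The penalised saddle-point problem and its limit\<close>

text \<open>The setting without function spaces. In the application k is 2 \<omega>^2 times the mass
  form. \<open>N_orth\<close> states that \<open>N\<close> lies in the orthogonal complement of H,
  \<open>P\<close> is the complement of \<open>N\<close> in \<open>U\<close>, and
  \<open>A_low\<close>, \<open>A_up\<close> make \<open>A\<close> equivalent to the inner product on
  \<open>W\<close>. Compactness of k takes the form in which a compact embedding delivers it: along
  a subsequence, the quadratic form of differences becomes small.\<close>

locale inversion = U: semi_inner U ip
  for U :: "'v::real_vector set" and ip :: "'v \<Rightarrow> 'v \<Rightarrow> real" +
  fixes W :: "'v set" and A B k D :: "'v \<Rightarrow> 'v \<Rightarrow> real" and \<alpha> \<delta> Mk KD :: real
  assumes U_complete: "complete_form U ip"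
    and W_subspace: "subspace W" and W_sub: "W \<subseteq> U" and W_complete: "complete_form W ip"
    and A_bilinear: "bilinear_form W W A"
    and A_sym: "w \<in> W \<Longrightarrow> z \<in> W \<Longrightarrow> A w z = A z w"
    and \<alpha>_pos: "0 < \<alpha>" and A_low: "w \<in> W \<Longrightarrow> \<alpha> * ip w w \<le> A w w"
    and A_up: "w \<in> W \<Longrightarrow> A w w \<le> ip w w"
    and k_bilinear: "bilinear_form U U k"
    and k_bound: "u \<in> U \<Longrightarrow> v \<in> U \<Longrightarrow> \<bar>k u v\<bar> \<le> Mk * ipnorm ip u * ipnorm ip v"
    and k_compact: "\<And>s::nat \<Rightarrow> 'v. (\<And>n. s n \<in> W \<and> ipnorm ip (s n) \<le> 1) \<Longrightarrow>
        \<exists>r::nat \<Rightarrow> nat. strict_mono r \<and>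
          (\<forall>e>0. \<exists>M. \<forall>m\<ge>M. \<forall>n\<ge>M. k (s (r m) - s (r n)) (s (r m) - s (r n)) < e)"
    and B_eq: "u \<in> U \<Longrightarrow> w \<in> W \<Longrightarrow> B u w = ip u w - k u w"
    and D_bilinear: "bilinear_form U U D"
    and D_sym: "u \<in> U \<Longrightarrow> v \<in> U \<Longrightarrow> D u v = D v u"
    and D_nonneg: "u \<in> U \<Longrightarrow> 0 \<le> D u u"
    and D_bound: "u \<in> U \<Longrightarrow> v \<in> U \<Longrightarrow> \<bar>D u v\<bar> \<le> KD * ipnorm ip u * ipnorm ip v"
  fixes N P :: "'v set"
  defines "N \<equiv> {u \<in> U. \<forall>v\<in>U. D u v = 0}" and "P \<equiv> {u \<in> U. \<forall>v\<in>N. ip u v = 0}"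
  assumes N_orth: "u \<in> N \<Longrightarrow> h \<in> U \<Longrightarrow> (\<And>w. w \<in> W \<Longrightarrow> B h w = 0) \<Longrightarrow> ip u h = 0"
    and \<delta>_pos: "0 < \<delta>" and D_coercive: "v \<in> P \<Longrightarrow> \<delta> * ip v v \<le> D v v"
begin

section \<open>The orthogonal splitting of \<open>U\<close> and elementary bounds for
  \<open>A\<close> and \<open>B\<close>\<close>

lemma N_sub: "u \<in> N \<Longrightarrow> u \<in> U" and P_sub: "u \<in> P \<Longrightarrow> u \<in> U" and W_mem: "w \<in> W \<Longrightarrow> w \<in> U"
  using W_sub by (auto simp: N_def P_def)

lemma DN: "u \<in> N \<Longrightarrow> v \<in> U \<Longrightarrow> D u v = 0"
  by (simp add: N_def)

lemma PN: "u \<in> P \<Longrightarrow> v \<in> N \<Longrightarrow> ip u v = 0"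
  by (simp add: P_def)

lemma N_closed: "subspace N" "complete_form N ip"
proof -
  have l: "linear_form U (\<lambda>u. D u v)" if "v \<in> U" for v
    using bilinear_form_left[OF D_bilinear that] .
  have b: "bounded_form U ip (\<lambda>u. D u v)" if v: "v \<in> U" for v
    unfolding bounded_form_def
    by (rule exI[of _ "KD * ipnorm ip v"]) (use D_bound v in \<open>auto simp: algebra_simps\<close>)
  show "subspace N" unfolding N_def using U.subspace_annihilator[of U "\<lambda>v u. D u v"] l by blast
  show "complete_form N ip" unfolding N_def
    using U.complete_annihilator[OF U_complete, of U "\<lambda>v u. D u v"] l b by blast
qed

lemma P_closed: "subspace P" "complete_form P ip"
proof -
  have l: "linear_form U (\<lambda>u. ip u v)" if "v \<in> N" for v
    using bilinear_form_left[OF U.bilinear N_sub[OF that]] .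
  have b: "bounded_form U ip (\<lambda>u. ip u v)" if "v \<in> N" for v
    using U.bounded_form_ip[OF N_sub[OF that]] .
  show "subspace P" unfolding P_def using U.subspace_annihilator[of N "\<lambda>v u. ip u v"] l by blast
  show "complete_form P ip" unfolding P_def
    using U.complete_annihilator[OF U_complete, of N "\<lambda>v u. ip u v"] l b by blast
qed

sublocale N: semi_inner N ip
  by (rule U.semi_inner_subspace[OF N_closed(1)]) (auto simp: N_def)

sublocale P: semi_inner P ip
  by (rule U.semi_inner_subspace[OF P_closed(1)]) (auto simp: P_def)

sublocale W: semi_inner W ip
  by (rule U.semi_inner_subspace[OF W_subspace W_sub])

sublocale WA: semi_inner W A
proof
  show "0 \<le> A u u" if "u \<in> W" for u
    using A_low[OF that] W.nonneg[OF that] \<alpha>_pos by (meson mult_nonneg_nonneg less_imp_le order_trans)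
qed (use W_subspace A_bilinear A_sym in auto)

text \<open>u1 is the orthogonal projection of u to \<open>N\<close>, obtained as the Riesz
  representer within \<open>N\<close> of \<open>ip u\<close>; the splitting thus rests on
  completeness of \<open>N\<close>.\<close>

lemma split:
  assumes "u \<in> U"
  obtains u0 u1 where "u0 \<in> P" "u1 \<in> N" "u = u0 + u1"
proof -
  have "linear_form N (ip u)"
    by (rule linear_form_mono[OF bilinear_form_right[OF U.bilinear assms]]) (auto simp: N_def)
  moreover have "bounded_form N ip (ip u)"
    unfolding bounded_form_def using U.Cauchy_Schwarz[OF assms N_sub] by blast
  ultimately obtain u1 where u1: "u1 \<in> N" "\<And>v. v \<in> N \<Longrightarrow> ip u1 v = ip u v"
    using N.riesz[OF N_closed(2)] by metis
  have "ip (u - u1) v = 0" if "v \<in> N" for v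
    using U.ip_add_diff(3)[OF assms N_sub[OF u1(1)] N_sub[OF that]] u1(2)[OF that] by simp
  then have "u - u1 \<in> P" using U.mem(3)[OF assms N_sub[OF u1(1)]] by (simp add: P_def)
  then show thesis using that[of "u - u1" u1] u1(1) by simp
qed

lemma split_norm:
  assumes "u0 \<in> P" "u1 \<in> N"
  shows "ip (u0 + u1) (u0 + u1) = ip u0 u0 + ip u1 u1"
  using U.ip_add_diff(1,2)[OF P_sub[OF assms(1)] N_sub[OF assms(2)]] U.mem(2)[OF P_sub[OF assms(1)] N_sub[OF assms(2)]]
    PN[OF assms] U.sym[OF P_sub[OF assms(1)] N_sub[OF assms(2)]] P_sub[OF assms(1)] N_sub[OF assms(2)]
  by simp

lemma A_complete: "complete_form W A"
  using complete_form_equiv[OF W_complete W_subspace \<alpha>_pos, of A 1] W.nonneg A_low A_up by simp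

lemma A_norm_low: "w \<in> W \<Longrightarrow> sqrt \<alpha> * ipnorm ip w \<le> ipnorm A w"
  using A_low by (simp add: ipnorm_def flip: real_sqrt_mult)

lemma A_norm_up: "w \<in> W \<Longrightarrow> ipnorm A w \<le> ipnorm ip w"
  using A_up by (simp add: ipnorm_def)

definition MB :: real where "MB = (1 + \<bar>Mk\<bar>)"

lemma MB_nonneg: "0 \<le> MB" by (simp add: MB_def)

lemma B_bound: "u \<in> U \<Longrightarrow> w \<in> W \<Longrightarrow> \<bar>B u w\<bar> \<le> MB * ipnorm ip u * ipnorm ip w"
proof -
  assume u: "u \<in> U" and w: "w \<in> W"
  have "Mk * ipnorm ip u * ipnorm ip w \<le> \<bar>Mk\<bar> * ipnorm ip u * ipnorm ip w"
    using U.norm_nonneg[OF u] W.norm_nonneg[OF w] by (intro mult_right_mono) auto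
  then show ?thesis
    using U.Cauchy_Schwarz[OF u W_mem[OF w]] k_bound[OF u W_mem[OF w]] B_eq[OF u w]
    by (simp add: MB_def algebra_simps)
qed

lemma norm_le_A: "w \<in> W \<Longrightarrow> ipnorm ip w \<le> ipnorm A w / sqrt \<alpha>"
  using A_norm_low \<alpha>_pos by (simp add: field_simps)

lemma B_bound_A:
  assumes "u \<in> U" "w \<in> W"
  shows "\<bar>B u w\<bar> \<le> MB / sqrt \<alpha> * ipnorm ip u * ipnorm A w"
proof -
  have "\<bar>B u w\<bar> \<le> MB * ipnorm ip u * ipnorm ip w" by (rule B_bound[OF assms])
  also have "\<dots> \<le> MB * ipnorm ip u * (ipnorm A w / sqrt \<alpha>)"
    using norm_le_A[OF assms(2)] MB_nonneg U.norm_nonneg[OF assms(1)] by (intro mult_left_mono) auto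
  finally show ?thesis by simp
qed

lemma B_bilinear: "bilinear_form U W B"
  unfolding bilinear_form_def
proof (intro conjI ballI)
  fix u assume u: "u \<in> U"
  have "linear_form W (\<lambda>w. ip u w - k u w)"
    using linear_form_mono[OF bilinear_form_right[OF U.bilinear u] W_sub]
      linear_form_mono[OF bilinear_form_right[OF k_bilinear u] W_sub]
    by (simp add: linear_form_def algebra_simps)
  then show "linear_form W (B u)" using B_eq[OF u] W.mem by (simp add: linear_form_def)
next
  fix w assume w: "w \<in> W"
  have "linear_form U (\<lambda>u. ip u w - k u w)"
    using bilinear_form_left[OF U.bilinear W_mem[OF w]] bilinear_form_left[OF k_bilinear W_mem[OF w]]
    by (simp add: linear_form_def algebra_simps)
  then show "linear_form U (\<lambda>u. B u w)" using B_eq[OF _ w] U.mem by (simp add: linear_form_def)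
qed

lemma B_left: "u \<in> U \<Longrightarrow> v \<in> U \<Longrightarrow> w \<in> W \<Longrightarrow> B (u + v) w = B u w + B v w"
    "u \<in> U \<Longrightarrow> v \<in> U \<Longrightarrow> w \<in> W \<Longrightarrow> B (u - v) w = B u w - B v w"
  and B_right: "u \<in> U \<Longrightarrow> w \<in> W \<Longrightarrow> z \<in> W \<Longrightarrow> B u (w - z) = B u w - B u z"
  using linear_form_add[OF bilinear_form_left[OF B_bilinear]] linear_form_diff[OF bilinear_form_left[OF B_bilinear]]
    linear_form_diff[OF bilinear_form_right[OF B_bilinear]] by auto

lemma D_left: "u \<in> U \<Longrightarrow> v \<in> U \<Longrightarrow> w \<in> U \<Longrightarrow> D (u + v) w = D u w + D v w"
    "u \<in> U \<Longrightarrow> v \<in> U \<Longrightarrow> w \<in> U \<Longrightarrow> D (u - v) w = D u w - D v w"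
  and D_right: "u \<in> U \<Longrightarrow> v \<in> U \<Longrightarrow> w \<in> U \<Longrightarrow> D u (v + w) = D u v + D u w"
  using linear_form_add[OF bilinear_form_left[OF D_bilinear]] linear_form_diff[OF bilinear_form_left[OF D_bilinear]]
    linear_form_add[OF bilinear_form_right[OF D_bilinear]] by auto

text \<open>The A-norm of the lifting z is the dual norm of B(u, .), so this is the inf-sup
  condition for \<open>B\<close> on \<open>N\<close> and \<open>W\<close>. By \<open>N_orth\<close>
  the functional \<open>ip u\<close> equals B(., w) for some w in \<open>W\<close> with norm at most
  C times that of u, and then ip u u = B u w = A z w.\<close>

lemma inf_sup:
  obtains C where "0 \<le> C" "\<And>u z. u \<in> N \<Longrightarrow> z \<in> W \<Longrightarrow> (\<And>w. w \<in> W \<Longrightarrow> A z w = B u w) \<Longrightarrow>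
      ipnorm ip u \<le> C * ipnorm A z"
proof -
  obtain C where C: "0 \<le> C"
    "\<And>u. u \<in> U \<Longrightarrow> (\<And>h. h \<in> U \<Longrightarrow> (\<And>w. w \<in> W \<Longrightarrow> B h w = 0) \<Longrightarrow> ip u h = 0) \<Longrightarrow>
       \<exists>w\<in>W. ipnorm ip w \<le> C * ipnorm ip u \<and> (\<forall>v\<in>U. B v w = ip u v)"
    using U.closed_range_of_compact_perturbation[OF U_complete W_subspace W_sub W_complete k_bilinear k_bound k_compact B_eq]
    by blast
  have "ipnorm ip u \<le> C * ipnorm A z"
    if u: "u \<in> N" and z: "z \<in> W" and eq: "\<And>w. w \<in> W \<Longrightarrow> A z w = B u w" for u z
  proof -
    obtain w where w: "w \<in> W" "ipnorm ip w \<le> C * ipnorm ip u" "\<forall>v\<in>U. B v w = ip u v"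
      using C(2)[OF N_sub[OF u]] N_orth[OF u] by blast
    have "(ipnorm ip u)\<^sup>2 = A z w" using w eq[OF w(1)] N_sub[OF u] by (simp add: U.norm_sq)
    also have "\<dots> \<le> ipnorm A z * ipnorm A w" using WA.Cauchy_Schwarz[OF z w(1)] by simp
    also have "\<dots> \<le> ipnorm A z * (C * ipnorm ip u)"
      using w(2) A_norm_up[OF w(1)] WA.norm_nonneg[OF z] by (intro mult_left_mono) auto
    finally have "(ipnorm ip u)\<^sup>2 \<le> (C * ipnorm A z) * ipnorm ip u" by (simp add: algebra_simps)
    then show ?thesis
      by (rule le_of_square_le_mult) (use C(1) WA.norm_nonneg[OF z] in simp)
  qed
  then show thesis using that C(1) by blast
qed

lemma mixed_saddle:
  obtains c where "saddle W A N ip B (\<lambda>_ _. 0) c (MB / sqrt \<alpha>) 0"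
proof -
  obtain C where C: "0 \<le> C" "\<And>u z. u \<in> N \<Longrightarrow> z \<in> W \<Longrightarrow> (\<And>w. w \<in> W \<Longrightarrow> A z w = B u w) \<Longrightarrow>
      ipnorm ip u \<le> C * ipnorm A z" by (rule inf_sup) blast
  \<comment> \<open>Squaring the inf-sup estimate gives the factor C^2; the added 1 keeps the
    quotient meaningful when \<open>C = 0\<close>.\<close>
  have "saddle W A N ip B (\<lambda>_ _. 0) (1 / (C\<^sup>2 + 1)) (MB / sqrt \<alpha>) 0"
  proof
    show "bilinear_form N W B" by (rule bilinear_form_mono[OF B_bilinear]) (auto simp: N_def)
    show "bilinear_form N N (\<lambda>_ _. 0)" by (simp add: bilinear_form_def linear_form_def)
    have pos: "0 < C\<^sup>2 + 1" by (simp add: add_nonneg_pos)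
    then show "0 < 1 / (C\<^sup>2 + 1)" by simp
    fix u z assume u: "u \<in> N" and z: "z \<in> W" and eq: "\<And>w. w \<in> W \<Longrightarrow> A z w = B u w"
    have "(ipnorm ip u)\<^sup>2 \<le> (C * ipnorm A z)\<^sup>2"
      by (rule power_mono[OF C(2)[OF u z eq] N.norm_nonneg[OF u]])
    then have "ip u u \<le> C\<^sup>2 * A z z" using N.norm_sq[OF u] WA.norm_sq[OF z] by (simp add: power_mult_distrib)
    also have "\<dots> \<le> (C\<^sup>2 + 1) * A z z" using WA.nonneg[OF z] by (simp add: algebra_simps)
    finally show "1 / (C\<^sup>2 + 1) * ip u u \<le> A z z + 0" using pos by (simp add: field_simps)
  qed (use A_complete N_closed B_bound_A N_sub MB_nonneg \<alpha>_pos in auto)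
  then show thesis by (rule that)
qed

text \<open>The penalty sees only the component u0 in \<open>P\<close>, because \<open>D\<close>
  vanishes on \<open>N\<close>. The component u1 is controlled by \<open>inf_sup\<close> through its
  own lifting z1, which differs from the lifting z of u by at most a multiple of the norm of
  u0.\<close>

lemma stationary_saddle:
  assumes \<kappa>: "0 < \<kappa>"
  obtains c K where "saddle W A U ip B (\<lambda>u v. \<kappa> * D u v) c (MB / sqrt \<alpha>) K"
proof -
  obtain C where C: "0 \<le> C" "\<And>u z. u \<in> N \<Longrightarrow> z \<in> W \<Longrightarrow> (\<And>w. w \<in> W \<Longrightarrow> A z w = B u w) \<Longrightarrow>
      ipnorm ip u \<le> C * ipnorm A z" by (rule inf_sup) blast
  obtain c' where c': "saddle W A N ip B (\<lambda>_ _. 0) c' (MB / sqrt \<alpha>) 0" by (rule mixed_saddle)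
  define M' where "M' = MB / sqrt \<alpha>"
  have M': "0 \<le> M'" using MB_nonneg \<alpha>_pos by (simp add: M'_def)
  \<comment> \<open>C and 1 + C M' are the coefficients in the bound of u by z and u0. The factors 2
    come from (x + y)^2 \<le> 2 x^2 + 2 y^2, and division by \<kappa> \<delta> trades ip u0 u0 for
    the penalty \<kappa> D u u.\<close>
  define Q where "Q = 2 * C\<^sup>2 + 2 * (1 + C * M')\<^sup>2 / (\<kappa> * \<delta>)"
  have "0 < 1 + C * M'" using C(1) M' by (intro add_pos_nonneg) auto
  then have c1: "0 < (1 + C * M')\<^sup>2" by simp
  have Q: "2 * C\<^sup>2 \<le> Q" "2 * (1 + C * M')\<^sup>2 / (\<kappa> * \<delta>) \<le> Q" "0 < Q"
    using c1 \<kappa> \<delta>_pos by (auto simp: Q_def add_nonneg_pos)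
  have "saddle W A U ip B (\<lambda>u v. \<kappa> * D u v) (1 / Q) (MB / sqrt \<alpha>) (\<kappa> * KD)"
  proof
    show "bilinear_form U U (\<lambda>u v. \<kappa> * D u v)"
      using D_bilinear by (auto simp: bilinear_form_def linear_form_def algebra_simps)
    show "\<kappa> * D u u \<le> \<kappa> * KD * ip u u" if "u \<in> U" for u
      using D_bound[OF that that] \<kappa> U.norm_sq[OF that] by (simp add: power2_eq_square mult.assoc)
    show "0 < 1 / Q" using Q(3) by simp
    fix u z assume u: "u \<in> U" and z: "z \<in> W" and eq: "\<And>w. w \<in> W \<Longrightarrow> A z w = B u w"
    obtain u0 u1 where s: "u0 \<in> P" "u1 \<in> N" "u = u0 + u1" using split[OF u] .
    have sU: "u0 \<in> U" "u1 \<in> U" using s P_sub N_sub by auto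
    have "linear_form W (B u1)" "bounded_form W A (B u1)"
      using bilinear_form_right[OF B_bilinear sU(2)] B_bound_A[OF sU(2)] unfolding bounded_form_def by blast+
    then obtain z1 where z1: "z1 \<in> W" "\<And>w. w \<in> W \<Longrightarrow> A z1 w = B u1 w"
      using WA.riesz[OF A_complete] by metis
    have zz: "z - z1 \<in> W" using z z1 W.mem(3) by blast
    have eq0: "A (z - z1) w = B u0 w" if "w \<in> W" for w
      using WA.ip_add_diff(3)[OF z z1(1) that] eq[OF that] z1(2)[OF that] B_left(1)[OF sU that] s(3) by simp
    have "(ipnorm A (z - z1))\<^sup>2 \<le> (M' * ipnorm ip u0) * ipnorm A (z - z1)"
      using eq0[OF zz] B_bound_A[OF sU(1) zz] WA.norm_sq[OF zz] by (simp add: M'_def)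
    then have n0: "ipnorm A (z - z1) \<le> M' * ipnorm ip u0"
      by (rule le_of_square_le_mult) (use M' U.norm_nonneg[OF sU(1)] in simp)
    have "ipnorm A z1 \<le> ipnorm A z + ipnorm A (z - z1)"
      using WA.norm_triangle_diff[OF z zz] by simp
    then have "ipnorm A z1 \<le> ipnorm A z + M' * ipnorm ip u0" using n0 by linarith
    then have "C * ipnorm A z1 \<le> C * (ipnorm A z + M' * ipnorm ip u0)" using C(1) by (rule mult_left_mono)
    then have n1: "ipnorm ip u1 \<le> C * (ipnorm A z + M' * ipnorm ip u0)"
      using C(2)[OF s(2) z1] by linarith
    have "ipnorm ip u \<le> C * ipnorm A z + (1 + C * M') * ipnorm ip u0"
      using U.norm_triangle[OF sU] n1 s(3) by (simp add: algebra_simps)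
    then have "(ipnorm ip u)\<^sup>2 \<le> (C * ipnorm A z + (1 + C * M') * ipnorm ip u0)\<^sup>2"
      using U.norm_nonneg[OF u] by (rule power_mono)
    also have "\<dots> \<le> 2 * (C * ipnorm A z)\<^sup>2 + 2 * ((1 + C * M') * ipnorm ip u0)\<^sup>2"
      using sum_squares_bound[of "C * ipnorm A z" "(1 + C * M') * ipnorm ip u0"] by (simp add: power2_sum)
    also have "\<dots> = 2 * C\<^sup>2 * A z z + 2 * (1 + C * M')\<^sup>2 * ip u0 u0"
      by (simp add: power_mult_distrib WA.norm_sq[OF z] U.norm_sq[OF sU(1)])
    also have "\<dots> \<le> Q * A z z + Q * (\<kappa> * D u u)"
    proof (rule add_mono)
      show "2 * C\<^sup>2 * A z z \<le> Q * A z z" by (rule mult_right_mono[OF Q(1) WA.nonneg[OF z]])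
      have "D u u = D u0 u0"
        using D_left(1)[OF sU u] D_right[OF sU(1) sU] DN[OF s(2) u] DN[OF s(2) sU(1)] D_sym[OF sU] s(3) by simp
      then have low: "\<delta> * ip u0 u0 \<le> D u u" using D_coercive[OF s(1)] by simp
      have "2 * (1 + C * M')\<^sup>2 * ip u0 u0 = 2 * (1 + C * M')\<^sup>2 / (\<kappa> * \<delta>) * (\<kappa> * (\<delta> * ip u0 u0))"
        using \<kappa> \<delta>_pos by simp
      also have "\<dots> \<le> Q * (\<kappa> * (\<delta> * ip u0 u0))"
        using Q(2) \<kappa> \<delta>_pos U.nonneg[OF sU(1)] by (intro mult_right_mono) auto
      also have "\<dots> \<le> Q * (\<kappa> * D u u)" using low \<kappa> Q(3) by (intro mult_left_mono) auto
      finally show "2 * (1 + C * M')\<^sup>2 * ip u0 u0 \<le> Q * (\<kappa> * D u u)" .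
    qed
    finally have "ip u u \<le> Q * (A z z + \<kappa> * D u u)" using U.norm_sq[OF u] by (simp add: algebra_simps)
    then show "1 / Q * ip u u \<le> A z z + \<kappa> * D u u" using Q(3) by (simp add: field_simps)
  qed (use A_complete U_complete B_bilinear B_bound_A MB_nonneg \<alpha>_pos \<kappa> D_sym D_nonneg in auto)
  then show thesis by (rule that)
qed

section \<open>Solvability and a priori bounds for the limit, penalised and misfit problems\<close>

lemma bounded_form_A: "bounded_form W ip F \<Longrightarrow> bounded_form W A F"
proof -
  assume "bounded_form W ip F"
  then obtain K where K: "\<And>w. w \<in> W \<Longrightarrow> \<bar>F w\<bar> \<le> K * ipnorm ip w" by (auto simp: bounded_form_def)
  have "\<bar>F w\<bar> \<le> \<bar>K\<bar> / sqrt \<alpha> * ipnorm A w" if w: "w \<in> W" for w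
  proof -
    have "\<bar>F w\<bar> \<le> \<bar>K\<bar> * ipnorm ip w"
      using K[OF w] W.norm_nonneg[OF w] by (meson abs_ge_self mult_right_mono order_trans)
    also have "\<dots> \<le> \<bar>K\<bar> * (ipnorm A w / sqrt \<alpha>)" by (rule mult_left_mono[OF norm_le_A[OF w]]) simp
    finally show ?thesis by simp
  qed
  then show ?thesis unfolding bounded_form_def by blast
qed

lemma mixed_exists:
  assumes "linear_form W F" "bounded_form W ip F" "linear_form N G" "bounded_form N ip G"
  obtains w u where "w \<in> W" "u \<in> N" "\<And>w'. w' \<in> W \<Longrightarrow> A w w' + B u w' = F w'" "\<And>v. v \<in> N \<Longrightarrow> B v w = G v"
proof -
  obtain c where "saddle W A N ip B (\<lambda>_ _. 0) c (MB / sqrt \<alpha>) 0" by (rule mixed_saddle)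
  then interpret s: saddle W A N ip B "\<lambda>_ _. 0" c "MB / sqrt \<alpha>" 0 .
  from s.solution_exists[OF assms(1) bounded_form_A[OF assms(2)] assms(3,4)] show thesis
    using that by (metis diff_zero)
qed

text \<open>Stability of the limit system as an estimate of an arbitrary pair by its residuals.
  Applied to a difference of solutions it gives uniqueness, to a solution the Hadamard bound, and to
  the error of the expansion the rate.\<close>

lemma mixed_bound:
  obtains K where "0 \<le> K"
    "\<forall>w\<in>W. \<forall>u\<in>N. \<forall>kF\<ge>0. \<forall>kG\<ge>0. (\<forall>z\<in>W. \<bar>A w z + B u z\<bar> \<le> kF * ipnorm ip z) \<longrightarrow>
      (\<forall>v\<in>N. \<bar>B v w\<bar> \<le> kG * ipnorm ip v) \<longrightarrow> ipnorm ip w + ipnorm ip u \<le> K * (kF + kG)"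
proof -
  obtain c where "saddle W A N ip B (\<lambda>_ _. 0) c (MB / sqrt \<alpha>) 0" by (rule mixed_saddle)
  then interpret s: saddle W A N ip B "\<lambda>_ _. 0" c "MB / sqrt \<alpha>" 0 .
  \<comment> \<open>The price of changing from the A-norm to the norm of \<open>ip\<close> on
    \<open>W\<close>; it is paid once for the residual and once for w.\<close>
  define a where "a = 1 / sqrt \<alpha>"
  define M' where "M' = MB / sqrt \<alpha>"
  have a: "0 \<le> a" and M': "0 \<le> M'" using \<alpha>_pos MB_nonneg by (auto simp: a_def M'_def)
  define p where "p = (M' * a + 1) / c"
  have p: "0 \<le> p" using a M' s.c_pos by (simp add: p_def)
  show thesis
  proof (rule that)
    show "0 \<le> a * (a + M' * p) + p" using a M' p by simp
    show "\<forall>w\<in>W. \<forall>u\<in>N. \<forall>kF\<ge>0. \<forall>kG\<ge>0. (\<forall>z\<in>W. \<bar>A w z + B u z\<bar> \<le> kF * ipnorm ip z) \<longrightarrow>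
      (\<forall>v\<in>N. \<bar>B v w\<bar> \<le> kG * ipnorm ip v) \<longrightarrow>
      ipnorm ip w + ipnorm ip u \<le> (a * (a + M' * p) + p) * (kF + kG)"
    proof (intro ballI allI impI)
      fix w u kF kG
      assume w: "w \<in> W" and u: "u \<in> N" and k: "0 \<le> kF" "0 \<le> kG"
        and F: "\<forall>z\<in>W. \<bar>A w z + B u z\<bar> \<le> kF * ipnorm ip z"
        and G: "\<forall>v\<in>N. \<bar>B v w\<bar> \<le> kG * ipnorm ip v"
      have FA: "\<bar>A w z + B u z\<bar> \<le> (kF * a) * ipnorm A z" if "z \<in> W" for z
        using bspec[OF F that] mult_left_mono[OF norm_le_A[OF that] k(1)] by (simp add: a_def)
      have GN: "\<bar>B v w - 0\<bar> \<le> kG * ipnorm ip v" if "v \<in> N" for v using G that by simp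
      have kFa: "0 \<le> kF * a" using k a by simp
      note b = s.solution_bound[OF w u refl refl FA GN kFa k(2), folded M'_def]
      have "(M' * (kF * a) + kG) / c \<le> p * (kF + kG)"
      proof -
        have "M' * (kF * a) + kG \<le> (M' * a + 1) * (kF + kG)"
          using k a M' by (simp add: algebra_simps)
        then show ?thesis using s.c_pos by (simp add: p_def divide_right_mono)
      qed
      note q = this
      have ub: "ipnorm ip u \<le> p * (kF + kG)" using b(1) q by linarith
      have "ipnorm A w \<le> kF * a + M' * (p * (kF + kG))"
        using b(2) mult_left_mono[OF q M'] by linarith
      also have "\<dots> \<le> (a + M' * p) * (kF + kG)" using k a by (simp add: algebra_simps)
      finally have "a * ipnorm A w \<le> a * ((a + M' * p) * (kF + kG))" using a by (rule mult_left_mono)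
      then have "ipnorm ip w \<le> a * (a + M' * p) * (kF + kG)"
        using norm_le_A[OF w] by (simp add: a_def mult.assoc)
      then show "ipnorm ip w + ipnorm ip u \<le> (a * (a + M' * p) + p) * (kF + kG)"
        using ub by (simp add: algebra_simps)
    qed
  qed
qed

lemma stationary_exists:
  assumes "0 < \<kappa>" "linear_form W F" "bounded_form W ip F" "linear_form U G" "bounded_form U ip G"
  obtains w u where "w \<in> W" "u \<in> U" "\<And>w'. w' \<in> W \<Longrightarrow> A w w' + B u w' = F w'"
    "\<And>v. v \<in> U \<Longrightarrow> B v w - \<kappa> * D u v = G v"
proof -
  obtain c K where "saddle W A U ip B (\<lambda>u v. \<kappa> * D u v) c (MB / sqrt \<alpha>) K"
    by (rule stationary_saddle[OF assms(1)])
  then interpret s: saddle W A U ip B "\<lambda>u v. \<kappa> * D u v" c "MB / sqrt \<alpha>" K .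
  from s.solution_exists[OF assms(2) bounded_form_A[OF assms(3)] assms(4,5)] show thesis
    using that by metis
qed

lemma stationary_unique:
  assumes "0 < \<kappa>" "w \<in> W" "u \<in> U" "\<And>w'. w' \<in> W \<Longrightarrow> A w w' + B u w' = 0"
    "\<And>v. v \<in> U \<Longrightarrow> B v w - \<kappa> * D u v = 0"
  shows "ipnorm ip w = 0" "ipnorm ip u = 0"
proof -
  obtain c K where "saddle W A U ip B (\<lambda>u v. \<kappa> * D u v) c (MB / sqrt \<alpha>) K"
    by (rule stationary_saddle[OF assms(1)])
  then interpret s: saddle W A U ip B "\<lambda>u v. \<kappa> * D u v" c "MB / sqrt \<alpha>" K .
  have b: "ipnorm ip u \<le> 0" "ipnorm A w \<le> 0"
    using s.solution_bound[OF assms(2,3,4,5), of 0 0] by simp_all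
  then show "ipnorm ip u = 0" using U.norm_nonneg[OF assms(3)] by simp
  have "ipnorm ip w \<le> 0"
    using A_norm_low[OF assms(2)] b(2) \<alpha>_pos by (meson mult_le_0_iff order_trans real_sqrt_gt_zero not_le)
  then show "ipnorm ip w = 0" using W.norm_nonneg[OF assms(2)] by simp
qed

text \<open>On \<open>P\<close>, coercivity and boundedness make \<open>D\<close> an inner product
  equivalent to \<open>ip\<close>, so that the misfit equation is a Riesz representation with
  respect to \<open>D\<close>.\<close>

lemma misfit_semi_inner: "semi_inner P D" "complete_form P D"
proof -
  have sub: "P \<subseteq> U" by (auto simp: P_def)
  show "semi_inner P D"
    by unfold_locales (use P_closed bilinear_form_mono[OF D_bilinear sub sub] D_sym D_nonneg P_sub in auto)
  have "D u u \<le> KD * ip u u" if "u \<in> P" for u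
    using D_bound[OF P_sub P_sub, OF that that] P.norm_sq[OF that] by (simp add: power2_eq_square mult.assoc)
  then show "complete_form P D"
    using complete_form_equiv[OF P_closed(2,1) \<delta>_pos, of D KD] P.nonneg D_coercive by blast
qed

lemma misfit_exists:
  assumes "linear_form P e" "bounded_form P ip e"
  obtains u where "u \<in> P" "\<And>v. v \<in> P \<Longrightarrow> D u v = e v"
proof -
  interpret PD: semi_inner P D by (rule misfit_semi_inner)
  obtain K where K: "\<And>v. v \<in> P \<Longrightarrow> \<bar>e v\<bar> \<le> K * ipnorm ip v" using assms(2) by (auto simp: bounded_form_def)
  have "\<bar>e v\<bar> \<le> \<bar>K\<bar> / sqrt \<delta> * ipnorm D v" if v: "v \<in> P" for v
  proof -
    have "sqrt \<delta> * ipnorm ip v \<le> ipnorm D v" using D_coercive[OF v] by (simp add: ipnorm_def flip: real_sqrt_mult)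
    then have n: "ipnorm ip v \<le> ipnorm D v / sqrt \<delta>" using \<delta>_pos by (simp add: field_simps)
    have "\<bar>e v\<bar> \<le> \<bar>K\<bar> * ipnorm ip v"
      using K[OF v] P.norm_nonneg[OF v] by (meson abs_ge_self mult_right_mono order_trans)
    also have "\<dots> \<le> \<bar>K\<bar> * (ipnorm D v / sqrt \<delta>)" by (rule mult_left_mono[OF n]) simp
    finally show ?thesis by simp
  qed
  then have "bounded_form P D e" unfolding bounded_form_def by blast
  then show thesis using PD.riesz[OF misfit_semi_inner(2) assms(1)] that by metis
qed

lemma misfit_bound:
  assumes "u \<in> P" "\<And>v. v \<in> P \<Longrightarrow> D u v = e v" "\<And>v. v \<in> P \<Longrightarrow> \<bar>e v\<bar> \<le> c * ipnorm ip v" "0 \<le> c"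
  shows "ipnorm ip u \<le> 1 / \<delta> * c"
proof (rule le_of_square_le_mult)
  have "\<delta> * (ipnorm ip u)\<^sup>2 \<le> c * ipnorm ip u"
    using D_coercive[OF assms(1)] assms(2)[OF assms(1)] assms(3)[OF assms(1)] P.norm_sq[OF assms(1)] by simp
  then show "(ipnorm ip u)\<^sup>2 \<le> 1 / \<delta> * c * ipnorm ip u" using \<delta>_pos by (simp add: field_simps)
  show "0 \<le> 1 / \<delta> * c" using \<delta>_pos assms(4) by simp
qed

text \<open>Testing the difference of the two systems with itself controls its component in P by 1/\<kappa>,
  since w0 is annihilated by N; the stability of the limit system on N then transfers the rate to
  the other components. The energy identity alone would only give the rate 1/2 for w.\<close>

lemma expansion:
  assumes um: "um \<in> P"
    and w0: "w0 \<in> W" and u10: "u10 \<in> N" and eq1: "\<And>w'. w' \<in> W \<Longrightarrow> A w0 w' + B u10 w' = f w' - B um w'"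
    and eq2: "\<And>v. v \<in> N \<Longrightarrow> B v w0 = 0"
  obtains K where "\<forall>\<kappa>>0. \<forall>w\<in>W. \<forall>u0\<in>P. \<forall>u1\<in>N. (\<forall>z\<in>W. A w z + B (u0 + u1) z = f z) \<longrightarrow>
      (\<forall>v\<in>U. B v w - \<kappa> * D (u0 + u1) v = - \<kappa> * D um v) \<longrightarrow>
      ipnorm ip (w - w0) + ipnorm ip ((u0 + u1) - (um + u10)) \<le> K / \<kappa>"
proof -
  obtain K where K: "0 \<le> K"
    "\<forall>w\<in>W. \<forall>u\<in>N. \<forall>kF\<ge>0. \<forall>kG\<ge>0. (\<forall>z\<in>W. \<bar>A w z + B u z\<bar> \<le> kF * ipnorm ip z) \<longrightarrow>
      (\<forall>v\<in>N. \<bar>B v w\<bar> \<le> kG * ipnorm ip v) \<longrightarrow> ipnorm ip w + ipnorm ip u \<le> K * (kF + kG)"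
    by (rule mixed_bound)
  \<comment> \<open>With e0 the error in \<open>P\<close>, the energy identity will give \<kappa>
    \<delta> ||e0||^2 \<le> MB ||w0|| ||e0||, so R/\<kappa> bounds the norm of e0.\<close>
  define R where "R = MB * ipnorm ip w0 / \<delta>"
  have R: "0 \<le> R" using MB_nonneg W.norm_nonneg[OF w0] \<delta>_pos by (simp add: R_def)
  show thesis
  proof (rule that)
    show "\<forall>\<kappa>>0. \<forall>w\<in>W. \<forall>u0\<in>P. \<forall>u1\<in>N. (\<forall>z\<in>W. A w z + B (u0 + u1) z = f z) \<longrightarrow>
      (\<forall>v\<in>U. B v w - \<kappa> * D (u0 + u1) v = - \<kappa> * D um v) \<longrightarrow>
      ipnorm ip (w - w0) + ipnorm ip ((u0 + u1) - (um + u10)) \<le> (K * MB + 1) * R / \<kappa>"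
    proof (intro ballI allI impI)
      fix \<kappa> :: real and w u0 u1
      assume \<kappa>: "0 < \<kappa>" and w: "w \<in> W" and u0: "u0 \<in> P" and u1: "u1 \<in> N"
        and s1: "\<forall>z\<in>W. A w z + B (u0 + u1) z = f z"
        and s2: "\<forall>v\<in>U. B v w - \<kappa> * D (u0 + u1) v = - \<kappa> * D um v"
      define ew e0 e1 where "ew = w - w0" and "e0 = u0 - um" and "e1 = u1 - u10"
      have ew: "ew \<in> W" using w w0 W.mem(3) by (simp add: ew_def)
      have e0: "e0 \<in> P" "e0 \<in> U" using u0 um P.mem(3) P_sub by (auto simp: e0_def)
      have e1: "e1 \<in> N" "e1 \<in> U" using u1 u10 N.mem(3) N_sub by (auto simp: e1_def)
      note inU = P_sub[OF u0] P_sub[OF um] N_sub[OF u1] N_sub[OF u10]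
      have d1: "A ew w' + B e1 w' = - B e0 w'" if "w' \<in> W" for w'
        using WA.ip_add_diff(3)[OF w w0 that] B_left(1)[OF inU(1,3) that] B_left(2)[OF inU(1,2) that]
          B_left(2)[OF inU(3,4) that] bspec[OF s1 that] eq1[OF that] by (simp add: ew_def e0_def e1_def)
      \<comment> \<open>\<open>D\<close> does not see the component in \<open>N\<close>, so the
        second penalised equation reads B v w = \<kappa> D e0 v. Subtracting w0 from w leaves B v w0
        as residual.\<close>
      have d2: "B v ew = \<kappa> * D e0 v - B v w0" if "v \<in> U" for v
      proof -
        have "D (u0 + u1) v = D u0 v" using D_left(1)[OF inU(1,3) that] DN[OF u1 that] by simp
        then have "B v w = \<kappa> * (D u0 v - D um v)" using bspec[OF s2 that] by (simp add: right_diff_distrib)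
        then have "B v w = \<kappa> * D e0 v" using D_left(2)[OF inU(1,2) that] by (simp add: e0_def)
        then show ?thesis using B_right[OF that w w0] by (simp add: ew_def)
      qed
      \<comment> \<open>Both terms of \<open>d2\<close> vanish at e1: \<open>D\<close> because e1 is
        in \<open>N\<close>, and B e1 w0 by the second limit equation. Hence e1 drops out of the
        energy identity.\<close>
      have "B e1 ew = 0" using d2[OF e1(2)] eq2[OF e1(1)] DN[OF e1(1) e0(2)] D_sym[OF e0(2) e1(2)] by simp
      then have "A ew ew + \<kappa> * D e0 e0 = B e0 w0" using d1[OF ew] d2[OF e0(2)] by linarith
      then have "\<kappa> * D e0 e0 \<le> MB * ipnorm ip e0 * ipnorm ip w0"
        using WA.nonneg[OF ew] B_bound[OF e0(2) w0] by linarith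
      moreover have "\<kappa> * (\<delta> * (ipnorm ip e0)\<^sup>2) \<le> \<kappa> * D e0 e0"
        using D_coercive[OF e0(1)] P.norm_sq[OF e0(1)] \<kappa> by simp
      ultimately have "\<kappa> * (\<delta> * (ipnorm ip e0)\<^sup>2) \<le> MB * ipnorm ip e0 * ipnorm ip w0" by (rule order_trans[rotated])
      then have "(ipnorm ip e0)\<^sup>2 \<le> R / \<kappa> * ipnorm ip e0"
        using \<kappa> \<delta>_pos by (simp add: R_def field_simps)
      then have n0: "ipnorm ip e0 \<le> R / \<kappa>"
        by (rule le_of_square_le_mult) (use R \<kappa> in simp)
      have "B v ew = 0" if "v \<in> N" for v
        using d2[OF N_sub[OF that]] eq2[OF that] DN[OF that e0(2)] D_sym[OF e0(2) N_sub[OF that]] by simp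
      moreover have "\<bar>A ew z + B e1 z\<bar> \<le> MB * ipnorm ip e0 * ipnorm ip z" if "z \<in> W" for z
        using d1[OF that] B_bound[OF e0(2) that] by simp
      \<comment> \<open>(ew, e1) solves the limit system with right-hand sides -B e0 and 0, so it is
        as small as e0.\<close>
      ultimately have "ipnorm ip ew + ipnorm ip e1 \<le> K * (MB * ipnorm ip e0 + 0)"
        using K(2)[rule_format, OF ew e1(1), of "MB * ipnorm ip e0" 0] MB_nonneg P.norm_nonneg[OF e0(1)] by simp
      moreover have "ipnorm ip (e0 + e1) \<le> ipnorm ip e0 + ipnorm ip e1" by (rule U.norm_triangle[OF e0(2) e1(2)])
      ultimately have "ipnorm ip ew + ipnorm ip (e0 + e1) \<le> (K * MB + 1) * ipnorm ip e0"
        by (simp add: algebra_simps)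
      also have "\<dots> \<le> (K * MB + 1) * (R / \<kappa>)" using n0 K(1) MB_nonneg by (intro mult_left_mono) auto
      finally have "ipnorm ip ew + ipnorm ip (e0 + e1) \<le> (K * MB + 1) * R / \<kappa>" by simp
      moreover have "u0 + u1 - (um + u10) = e0 + e1" by (simp add: e0_def e1_def algebra_simps)
      ultimately show "ipnorm ip (w - w0) + ipnorm ip ((u0 + u1) - (um + u10)) \<le> (K * MB + 1) * R / \<kappa>"
        by (simp add: ew_def)
    qed
  qed
qed

end

section \<open>The space L2\<close>

text \<open>Makes fields vectors under pointwise operations, so that the abstract results apply to
  sets of functions directly.\<close>

instantiation "fun" :: (type, real_vector) real_vector
begin
definition "scaleR_fun a f = (\<lambda>x. a *\<^sub>R f x)"
instance
  by standard (auto simp: scaleR_fun_def fun_eq_iff scaleR_add_right scaleR_add_left)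
end

lemma scaleR_fun_apply [simp]: "(a *\<^sub>R f) x = a *\<^sub>R f x"
  by (simp add: scaleR_fun_def)

lemma field_ops: "fadd u v = u + v" "fdiff u v = u - v" "(\<lambda>x. a *\<^sub>R u x + b *\<^sub>R v x) = a *\<^sub>R u + b *\<^sub>R v"
  by (auto simp: fadd_def fdiff_def fun_eq_iff)

lemma linear_on_fields_iff: "linear_on_fields X l \<longleftrightarrow> linear_form X l"
  by (simp add: linear_on_fields_def linear_form_def field_ops)

definition l2ip :: "'a measure \<Rightarrow> ('a \<Rightarrow> 'b::euclidean_space) \<Rightarrow> ('a \<Rightarrow> 'b) \<Rightarrow> real" where
  "l2ip M f g = (LINT x|M. f x \<bullet> g x)"

lemma L2_norm_ipnorm: "L2_norm M f = ipnorm (l2ip M) f"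
  by (simp add: L2_norm_def ipnorm_def l2ip_def power2_norm_eq_inner)

lemma L2_measurable: "f \<in> L2 M \<Longrightarrow> f \<in> borel_measurable M"
  by (simp add: L2_def)

lemma L2_integrable: "f \<in> L2 M \<Longrightarrow> integrable M (\<lambda>x. (norm (f x))\<^sup>2)"
  by (simp add: L2_def)

lemma L2_bound:
  assumes "g \<in> L2 M" "f \<in> borel_measurable M" "AE x in M. norm (f x) \<le> c * norm (g x)"
  shows "f \<in> L2 M"
proof -
  have [measurable]: "f \<in> borel_measurable M" by fact
  have "integrable M (\<lambda>x. (norm (f x))\<^sup>2)"
  proof (rule Bochner_Integration.integrable_bound)
    show "integrable M (\<lambda>x. c\<^sup>2 * (norm (g x))\<^sup>2)" using L2_integrable[OF assms(1)] by simp
    show "AE x in M. norm ((norm (f x))\<^sup>2) \<le> norm (c\<^sup>2 * (norm (g x))\<^sup>2)"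
      using assms(3)
    proof eventually_elim
      case (elim x)
      then show ?case using power_mono[OF elim, of 2] by (simp add: power_mult_distrib)
    qed
  qed measurable
  then show ?thesis using assms by (simp add: L2_def)
qed

lemma L2_add:
  assumes "f \<in> L2 M" "g \<in> L2 M"
  shows "(\<lambda>x. f x + g x) \<in> L2 M"
proof -
  have [measurable]: "f \<in> borel_measurable M" "g \<in> borel_measurable M" using assms by (auto simp: L2_def)
  have "integrable M (\<lambda>x. (norm (f x + g x))\<^sup>2)"
  proof (rule Bochner_Integration.integrable_bound)
    show "integrable M (\<lambda>x. 2 * (norm (f x))\<^sup>2 + 2 * (norm (g x))\<^sup>2)"
      using assms by (auto simp: L2_def)
    have "(norm (f x + g x))\<^sup>2 \<le> 2 * (norm (f x))\<^sup>2 + 2 * (norm (g x))\<^sup>2" for x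
    proof -
      have "(norm (f x + g x))\<^sup>2 \<le> (norm (f x) + norm (g x))\<^sup>2"
        by (intro power_mono norm_triangle_ineq) auto
      also have "\<dots> \<le> 2 * (norm (f x))\<^sup>2 + 2 * (norm (g x))\<^sup>2"
        using sum_squares_bound[of "norm (f x)" "norm (g x)"] by (simp add: power2_sum)
      finally show ?thesis .
    qed
    then show "AE x in M. norm ((norm (f x + g x))\<^sup>2) \<le> norm (2 * (norm (f x))\<^sup>2 + 2 * (norm (g x))\<^sup>2)"
      by (auto intro!: AE_I2 order_trans[OF _ abs_ge_self])
  qed measurable
  then show ?thesis by (simp add: L2_def)
qed

lemma L2_scale: "f \<in> L2 M \<Longrightarrow> (\<lambda>x. a *\<^sub>R f x) \<in> L2 M"
  by (rule L2_bound[where c = "\<bar>a\<bar>"]) (auto simp: L2_def)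

lemma L2_subspace: "subspace (L2 M)"
  unfolding subspace_def
proof (intro conjI ballI allI)
  show "0 \<in> L2 M" by (simp add: L2_def zero_fun_def)
  show "x + y \<in> L2 M" if "x \<in> L2 M" "y \<in> L2 M" for x y
    using L2_add[OF that] by (simp add: plus_fun_def)
  show "c *\<^sub>R x \<in> L2 M" if "x \<in> L2 M" for c x
    using L2_scale[OF that] by (simp add: scaleR_fun_def)
qed

lemma L2_inner_integrable:
  assumes "f \<in> L2 M" "g \<in> L2 M"
  shows "integrable M (\<lambda>x. f x \<bullet> g x)"
proof (rule Bochner_Integration.integrable_bound)
  show "integrable M (\<lambda>x. (norm (f x))\<^sup>2 + (norm (g x))\<^sup>2)" using assms by (auto simp: L2_def)
  show "(\<lambda>x. f x \<bullet> g x) \<in> borel_measurable M"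
    using assms by (auto simp: L2_def intro!: borel_measurable_inner)
  have "\<bar>f x \<bullet> g x\<bar> \<le> (norm (f x))\<^sup>2 + (norm (g x))\<^sup>2" for x
  proof -
    have "\<bar>f x \<bullet> g x\<bar> \<le> norm (f x) * norm (g x)" by (rule Cauchy_Schwarz_ineq2)
    also have "\<dots> \<le> 2 * norm (f x) * norm (g x)" by simp
    also have "\<dots> \<le> (norm (f x))\<^sup>2 + (norm (g x))\<^sup>2" by (rule sum_squares_bound)
    finally show ?thesis .
  qed
  then show "AE x in M. norm (f x \<bullet> g x) \<le> norm ((norm (f x))\<^sup>2 + (norm (g x))\<^sup>2)"
    by (auto intro!: AE_I2 order_trans[OF _ abs_ge_self])
qed

lemma l2ip_commute: "l2ip M f g = l2ip M g f"
  by (simp add: l2ip_def inner_commute)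

lemma l2ip_linear:
  assumes "h \<in> L2 M"
  shows "linear_form (L2 M) (\<lambda>f. l2ip M f h)"
  using assms
  by (auto simp: linear_form_def l2ip_def inner_add_left L2_inner_integrable)

lemma l2_semi_inner:
  fixes M :: "'a measure"
  shows "semi_inner (L2 M :: ('a \<Rightarrow> 'b::euclidean_space) set) (l2ip M)"
proof
  show "bilinear_form (L2 M :: ('a \<Rightarrow> 'b) set) (L2 M) (l2ip M)"
    unfolding bilinear_form_def
  proof (intro conjI ballI)
    fix f :: "'a \<Rightarrow> 'b" assume f: "f \<in> L2 M"
    have "l2ip M f = (\<lambda>g. l2ip M g f)" by (simp add: l2ip_commute fun_eq_iff)
    then show "linear_form (L2 M) (l2ip M f)" using l2ip_linear[OF f] by metis
    show "linear_form (L2 M) (\<lambda>g. l2ip M g f)" by (rule l2ip_linear[OF f])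
  qed
  show "0 \<le> l2ip M u u" for u :: "'a \<Rightarrow> 'b" by (simp add: l2ip_def)
qed (rule L2_subspace l2ip_commute)+

lemma L2_iff_nn_integral:
  assumes "f \<in> borel_measurable M"
  shows "f \<in> L2 M \<longleftrightarrow> (\<integral>\<^sup>+ x. ennreal ((norm (f x))\<^sup>2) \<partial>M) < \<infinity>"
  using assms by (auto simp: L2_def integrable_iff_bounded)

lemma L2_nn_integral:
  assumes "f \<in> L2 M"
  shows "(\<integral>\<^sup>+ x. ennreal ((norm (f x))\<^sup>2) \<partial>M) = ennreal ((L2_norm M f)\<^sup>2)"
  using assms by (simp add: L2_norm_def nn_integral_eq_integral L2_integrable)

lemma L2_norm_zero_AE:
  assumes "f \<in> L2 M" "L2_norm M f = 0"
  shows "AE x in M. f x = 0"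
proof -
  have "(LINT x|M. (norm (f x))\<^sup>2) = 0" using assms(2) by (simp add: L2_norm_def)
  then show ?thesis
    using integral_nonneg_eq_0_iff_AE[OF L2_integrable[OF assms(1)]] by simp
qed

section \<open>Riesz-Fischer completeness over an arbitrary measure\<close>

lemma ennreal_tendsto_0I:
  fixes g :: "nat \<Rightarrow> ennreal"
  assumes "\<And>e. e > 0 \<Longrightarrow> \<exists>N. \<forall>n\<ge>N. g n \<le> ennreal e"
  shows "g \<longlonglongrightarrow> 0"
proof (rule order_tendstoI)
  fix a :: ennreal assume "0 < a"
  then obtain e where e: "e > 0" "ennreal e < a"
  proof (cases a)
    case (real r)
    then show thesis using that[of "r / 2"] \<open>0 < a\<close> by (simp add: ennreal_less_iff)
  next
    case top
    then show thesis using that[of 1] by simp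
  qed
  obtain N where "\<forall>n\<ge>N. g n \<le> ennreal e" using assms e(1) by blast
  then show "\<forall>\<^sub>F n in sequentially. g n < a"
    using e(2) unfolding eventually_sequentially by (meson le_less_trans)
qed simp

text \<open>The weighted terms are bounded, so the norm of d k is at most a constant times 2^(-k/2).
  The weight allows absolute summability to be read off from squares, without the triangle
  inequality in L2.\<close>

lemma summable_of_weighted_squares:
  fixes d :: "nat \<Rightarrow> 'b::banach"
  assumes "summable (\<lambda>k. 2 ^ k * (norm (d k))\<^sup>2)"
  shows "summable d"
proof -
  obtain S where S: "\<And>k. 2 ^ k * (norm (d k))\<^sup>2 \<le> S"
    using summable_imp_Bseq[OF assms] by (force simp: Bseq_def)
  have "norm (d k) \<le> sqrt S * sqrt (1/2) ^ k" for k
  proof (rule power2_le_imp_le)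
    have "(norm (d k))\<^sup>2 \<le> S * (1/2) ^ k" using S[of k] by (simp add: field_simps power_one_over)
    moreover have "0 \<le> S" using S[of 0] by (meson order_trans zero_le_mult_iff zero_le_power zero_le_numeral zero_le_power2)
    moreover have "(sqrt (1/2) ^ k)\<^sup>2 = ((sqrt (1/2))\<^sup>2) ^ k"
      by (simp only: power_mult[symmetric] mult.commute)
    ultimately show "(norm (d k))\<^sup>2 \<le> (sqrt S * sqrt (1/2) ^ k)\<^sup>2"
      by (simp add: power_mult_distrib)
    show "0 \<le> sqrt S * sqrt (1/2) ^ k" using \<open>0 \<le> S\<close> by simp
  qed
  moreover have "summable (\<lambda>k. sqrt S * sqrt (1/2) ^ k)"
    by (intro summable_mult summable_geometric) (simp add: real_sqrt_divide)
  ultimately show ?thesis by (rule summable_comparison_test'[rotated, where N = 0])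
qed

text \<open>Phrased with nonnegative integrals of measurable functions because traces are defined
  through such integrals; it serves both L2 of the domain and the surface measure.\<close>

lemma riesz_fischer:
  fixes f :: "nat \<Rightarrow> 'a \<Rightarrow> 'b::euclidean_space"
  assumes f: "\<And>n. f n \<in> borel_measurable M"
    and cauchy: "\<And>e. e > 0 \<Longrightarrow>
      \<exists>N. \<forall>m\<ge>N. \<forall>n\<ge>N. (\<integral>\<^sup>+ x. ennreal ((norm (f m x - f n x))\<^sup>2) \<partial>M) \<le> ennreal e"
  obtains g where "g \<in> borel_measurable M"
    "(\<lambda>n. \<integral>\<^sup>+ x. ennreal ((norm (f n x - g x))\<^sup>2) \<partial>M) \<longlonglongrightarrow> 0"
proof -
  note [measurable] = f
  \<comment> \<open>The rate 1/4^k leaves the summable 1/2^k after multiplication by the weight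
    2^k.\<close>
  have "\<exists>N. \<forall>m\<ge>N. \<forall>n\<ge>N. (\<integral>\<^sup>+ x. ennreal ((norm (f m x - f n x))\<^sup>2) \<partial>M) \<le> ennreal ((1/4) ^ k)" for k :: nat
    using cauchy[of "(1/4) ^ k"] by simp
  then obtain N where N: "\<And>k m n. m \<ge> N k \<Longrightarrow> n \<ge> N k \<Longrightarrow>
      (\<integral>\<^sup>+ x. ennreal ((norm (f m x - f n x))\<^sup>2) \<partial>M) \<le> ennreal ((1/4) ^ k)" by metis
  \<comment> \<open>Summing all earlier thresholds gives a nondecreasing choice of indices with r k
    at least N k and at least k, without a recursive definition.\<close>
  define r where "r k = (\<Sum>i\<le>k. N i) + k" for k
  have r_ge: "N k \<le> r k" "k \<le> r k" "r k \<le> r (Suc k)" for k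
    by (auto simp: r_def intro: trans_le_add1 member_le_sum)
  define d where "d k x = f (r (Suc k)) x - f (r k) x" for k x
  have [measurable]: "d k \<in> borel_measurable M" for k unfolding d_def by measurable
  have "(\<integral>\<^sup>+ x. (\<Sum>k. ennreal (2 ^ k * (norm (d k x))\<^sup>2)) \<partial>M)
      = (\<Sum>k. \<integral>\<^sup>+ x. ennreal (2 ^ k * (norm (d k x))\<^sup>2) \<partial>M)"
    by (rule nn_integral_suminf) measurable
  also have "\<dots> \<le> (\<Sum>k. ennreal ((1/2) ^ k))"
  proof (rule suminf_le)
    fix k
    have "(\<integral>\<^sup>+ x. ennreal (2 ^ k * (norm (d k x))\<^sup>2) \<partial>M)
        = ennreal (2 ^ k) * (\<integral>\<^sup>+ x. ennreal ((norm (d k x))\<^sup>2) \<partial>M)"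
      by (subst nn_integral_cmult[symmetric]) (auto simp: ennreal_mult)
    also have "\<dots> \<le> ennreal (2 ^ k) * ennreal ((1/4) ^ k)"
      unfolding d_def using r_ge[of k] by (intro mult_left_mono N) auto
    also have "\<dots> = ennreal ((1/2) ^ k)"
      by (simp add: ennreal_mult[symmetric] power_mult_distrib[symmetric])
    finally show "(\<integral>\<^sup>+ x. ennreal (2 ^ k * (norm (d k x))\<^sup>2) \<partial>M) \<le> ennreal ((1/2) ^ k)" .
  qed auto
  also have "\<dots> < \<infinity>"
    by (subst suminf_ennreal2) (auto intro: summable_geometric)
  finally have "(\<integral>\<^sup>+ x. (\<Sum>k. ennreal (2 ^ k * (norm (d k x))\<^sup>2)) \<partial>M) \<noteq> \<infinity>" by simp
  then have "AE x in M. (\<Sum>k. ennreal (2 ^ k * (norm (d k x))\<^sup>2)) \<noteq> \<infinity>"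
    by (intro nn_integral_PInf_AE) measurable
  then have conv: "AE x in M. (\<lambda>k. f (r k) x) \<longlonglongrightarrow> lim (\<lambda>k. f (r k) x)"
  proof eventually_elim
    case (elim x)
    then have "summable (\<lambda>k. 2 ^ k * (norm (d k x))\<^sup>2)"
      by (intro summable_suminf_not_top) auto
    then have "summable (\<lambda>k. d k x)" by (rule summable_of_weighted_squares)
    then have "convergent (\<lambda>n. \<Sum>k<n. d k x)" by (simp add: summable_iff_convergent)
    moreover have "(\<Sum>k<n. d k x) = f (r n) x - f (r 0) x" for n
      unfolding d_def by (rule sum_lessThan_telescope)
    ultimately have "convergent (\<lambda>n. f (r n) x - f (r 0) x)" by simp
    then have "convergent (\<lambda>n. f (r n) x)" by (simp add: convergent_diff_const_right_iff)
    then show ?case by (simp add: convergent_LIMSEQ_iff)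
  qed
  define g where "g x = lim (\<lambda>k. f (r k) x)" for x
  have g[measurable]: "g \<in> borel_measurable M" unfolding g_def by measurable
  have "(\<lambda>n. \<integral>\<^sup>+ x. ennreal ((norm (f n x - g x))\<^sup>2) \<partial>M) \<longlonglongrightarrow> 0"
  proof (rule ennreal_tendsto_0I)
    fix e :: real assume "e > 0"
    then obtain L where L: "\<And>m n. m \<ge> L \<Longrightarrow> n \<ge> L \<Longrightarrow>
        (\<integral>\<^sup>+ x. ennreal ((norm (f m x - f n x))\<^sup>2) \<partial>M) \<le> ennreal e" using cauchy by blast
    have "(\<integral>\<^sup>+ x. ennreal ((norm (f n x - g x))\<^sup>2) \<partial>M) \<le> ennreal e" if n: "n \<ge> L" for n
    proof -
      \<comment> \<open>Fatou along the subsequence: g is the pointwise limit of f (r k), and these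
        are eventually within e of f n.\<close>
      have "(\<integral>\<^sup>+ x. ennreal ((norm (f n x - g x))\<^sup>2) \<partial>M)
          = (\<integral>\<^sup>+ x. liminf (\<lambda>k. ennreal ((norm (f n x - f (r k) x))\<^sup>2)) \<partial>M)"
      proof (rule nn_integral_cong_AE, use conv in eventually_elim)
        case (elim x)
        then have "(\<lambda>k. ennreal ((norm (f n x - f (r k) x))\<^sup>2)) \<longlonglongrightarrow> ennreal ((norm (f n x - g x))\<^sup>2)"
          unfolding g_def by (intro tendsto_intros)
        then show ?case by (rule lim_imp_Liminf[OF sequentially_bot, symmetric])
      qed
      also have "\<dots> \<le> liminf (\<lambda>k. \<integral>\<^sup>+ x. ennreal ((norm (f n x - f (r k) x))\<^sup>2) \<partial>M)"
        by (rule nn_integral_liminf) measurable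
      also have "\<dots> \<le> ennreal e"
      proof (rule Liminf_le)
        show "\<forall>\<^sub>F k in sequentially. (\<integral>\<^sup>+ x. ennreal ((norm (f n x - f (r k) x))\<^sup>2) \<partial>M) \<le> ennreal e"
          unfolding eventually_sequentially using L[OF n] r_ge(2) by (meson order_trans)
      qed simp
      finally show ?thesis .
    qed
    then show "\<exists>N. \<forall>n\<ge>N. (\<integral>\<^sup>+ x. ennreal ((norm (f n x - g x))\<^sup>2) \<partial>M) \<le> ennreal e" by blast
  qed
  then show thesis using that g by blast
qed

lemma L2_complete: "complete_form (L2 M :: ('a \<Rightarrow> 'b::euclidean_space) set) (l2ip M)"
  unfolding complete_form_def
proof (intro allI impI, elim conjE)
  interpret semi_inner "L2 M :: ('a \<Rightarrow> 'b) set" "l2ip M" by (rule l2_semi_inner)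
  fix s :: "nat \<Rightarrow> 'a \<Rightarrow> 'b"
  assume s: "\<forall>n. s n \<in> L2 M"
    and c: "\<forall>e>0. \<exists>L. \<forall>m\<ge>L. \<forall>n\<ge>L. ipnorm (l2ip M) (s m - s n) < e"
  have sd: "s m - s n \<in> L2 M" for m n by (rule mem(3)) (use s in auto)
  have nn: "(\<integral>\<^sup>+ x. ennreal ((norm (s m x - s n x))\<^sup>2) \<partial>M) = ennreal ((ipnorm (l2ip M) (s m - s n))\<^sup>2)" for m n
    using L2_nn_integral[OF sd] by (simp add: L2_norm_ipnorm)
  have "\<exists>L. \<forall>m\<ge>L. \<forall>n\<ge>L. (\<integral>\<^sup>+ x. ennreal ((norm (s m x - s n x))\<^sup>2) \<partial>M) \<le> ennreal e" if e: "e > 0" for e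
  proof -
    obtain L where L: "\<forall>m\<ge>L. \<forall>n\<ge>L. ipnorm (l2ip M) (s m - s n) < sqrt e" using c e by fastforce
    have "(ipnorm (l2ip M) (s m - s n))\<^sup>2 \<le> e" if "m \<ge> L" "n \<ge> L" for m n
      using power_mono[of "ipnorm (l2ip M) (s m - s n)" "sqrt e" 2] L that e norm_nonneg[OF sd]
      by (simp add: less_imp_le)
    then show ?thesis unfolding nn by (intro exI[of _ L]) (auto intro: ennreal_leI)
  qed
  then obtain g where g: "g \<in> borel_measurable M"
      "(\<lambda>n. \<integral>\<^sup>+ x. ennreal ((norm (s n x - g x))\<^sup>2) \<partial>M) \<longlonglongrightarrow> 0"
    using riesz_fischer[of s M] s L2_measurable by blast
  \<comment> \<open>One index at finite distance suffices: g = s n - (s n - g) is then a difference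
    of elements of L2.\<close>
  have "\<forall>\<^sub>F n in sequentially. (\<integral>\<^sup>+ x. ennreal ((norm (s n x - g x))\<^sup>2) \<partial>M) < 1"
    using order_tendstoD(2)[OF g(2), of 1] by simp
  then obtain n where n: "(\<integral>\<^sup>+ x. ennreal ((norm (s n x - g x))\<^sup>2) \<partial>M) < 1"
    using eventually_happens'[OF sequentially_bot] by blast
  have "(\<lambda>x. s n x - g x) \<in> borel_measurable M"
    using s by (intro borel_measurable_diff L2_measurable g(1)) auto
  moreover have "(\<integral>\<^sup>+ x. ennreal ((norm (s n x - g x))\<^sup>2) \<partial>M) < \<infinity>"
    by (rule order_less_le_trans[OF n]) simp
  ultimately have "s n - g \<in> L2 M" by (simp add: L2_iff_nn_integral fun_diff_def)
  then have gL: "g \<in> L2 M" using s mem(3)[of "s n" "s n - g"] by simp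
  then have sg: "s n - g \<in> L2 M" for n by (intro mem(3)) (use s in auto)
  have "(\<integral>\<^sup>+ x. ennreal ((norm (s n x - g x))\<^sup>2) \<partial>M) = ennreal ((ipnorm (l2ip M) (s n - g))\<^sup>2)" for n
    using L2_nn_integral[OF sg] by (simp add: L2_norm_ipnorm)
  then have "(\<lambda>n. ennreal ((ipnorm (l2ip M) (s n - g))\<^sup>2)) \<longlonglongrightarrow> ennreal 0" using g(2) by simp
  then have "(\<lambda>n. (ipnorm (l2ip M) (s n - g))\<^sup>2) \<longlonglongrightarrow> 0" by (subst (asm) tendsto_ennreal_iff) auto
  then have "(\<lambda>n. sqrt ((ipnorm (l2ip M) (s n - g))\<^sup>2)) \<longlonglongrightarrow> sqrt 0" by (rule tendsto_real_sqrt)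
  then have "(\<lambda>n. ipnorm (l2ip M) (s n - g)) \<longlonglongrightarrow> 0"
    using norm_nonneg[OF sg] by simp
  then show "\<exists>l\<in>L2 M. (\<lambda>n. ipnorm (l2ip M) (s n - l)) \<longlonglongrightarrow> 0" using gL by blast
qed

section \<open>Smooth bump functions and the fundamental lemma\<close>

lemma partial_eq: "(f has_derivative f') (at x) \<Longrightarrow> partial j f x = f' (axis j 1)"
  unfolding partial_def using frechet_derivative_at[of f f' x] by simp

lemma smooth_differentiable: "smooth f \<Longrightarrow> f differentiable (at x)"
  by (erule smooth.cases) auto

lemma smooth_partial: "smooth f \<Longrightarrow> smooth (partial j f)"
  by (erule smooth.cases) auto

lemma smooth_continuous: "smooth f \<Longrightarrow> continuous_on S f"
  by (meson continuous_at_imp_continuous_on differentiable_imp_continuous_within smooth_differentiable)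

lemma smooth_const: "smooth (\<lambda>_. c)"
proof (coinduction arbitrary: c rule: smooth.coinduct)
  case smooth
  have "partial j (\<lambda>_. c) = (\<lambda>_. 0)" for j :: 'a
    by (rule ext) (auto intro: partial_eq[THEN trans] has_derivative_const)
  then show ?case by auto
qed

text \<open>Products are not closed under partial derivatives, but finite sums of products are, by
  the Leibniz rule. Lists of pairs of factors therefore provide the invariant for the coinduction
  that follows.\<close>

lemma partial_sum_list_mult:
  fixes L :: "((real^'s::finite \<Rightarrow> real) \<times> (real^'s \<Rightarrow> real)) list"
  assumes "\<forall>(f, g)\<in>set L. smooth f \<and> smooth g"
  shows "(\<lambda>x. \<Sum>(f, g)\<leftarrow>L. f x * g x) differentiable (at x)"
    and "partial j (\<lambda>x. \<Sum>(f, g)\<leftarrow>L. f x * g x) x =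
      (\<Sum>(f, g)\<leftarrow>concat (map (\<lambda>(f, g). [(partial j f, g), (f, partial j g)]) L). f x * g x)"
proof -
  have "((\<lambda>x. \<Sum>(f, g)\<leftarrow>L. f x * g x) has_derivative
      (\<lambda>h. \<Sum>(f, g)\<leftarrow>L. f x * frechet_derivative g (at x) h + frechet_derivative f (at x) h * g x)) (at x)"
    using assms
  proof (induction L)
    case (Cons p L)
    obtain f g where p: "p = (f, g)" by (cases p)
    have "(f has_derivative frechet_derivative f (at x)) (at x)"
      "(g has_derivative frechet_derivative g (at x)) (at x)"
      using Cons.prems p smooth_differentiable frechet_derivative_works by auto
    from has_derivative_add[OF has_derivative_mult[OF this] Cons.IH] Cons.prems show ?case
      by (simp add: p)
  qed simp
  note D = this
  then show "(\<lambda>x. \<Sum>(f, g)\<leftarrow>L. f x * g x) differentiable (at x)" by (auto simp: differentiable_def)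
  have "partial j (\<lambda>x. \<Sum>(f, g)\<leftarrow>L. f x * g x) x
      = (\<Sum>(f, g)\<leftarrow>L. f x * partial j g x + partial j f x * g x)"
    using partial_eq[OF D] by (simp add: partial_def)
  also have "\<dots> = (\<Sum>(f, g)\<leftarrow>concat (map (\<lambda>(f, g). [(partial j f, g), (f, partial j g)]) L). f x * g x)"
    by (induction L) (auto simp: algebra_simps)
  finally show "partial j (\<lambda>x. \<Sum>(f, g)\<leftarrow>L. f x * g x) x = \<dots>" .
qed

lemma smooth_sum_list_mult:
  fixes L :: "((real^'s::finite \<Rightarrow> real) \<times> (real^'s \<Rightarrow> real)) list"
  assumes "\<forall>(f, g)\<in>set L. smooth f \<and> smooth g"
  shows "smooth (\<lambda>x. \<Sum>(f, g)\<leftarrow>L. f x * g x)"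
  using assms
proof (coinduction arbitrary: L rule: smooth.coinduct)
  case (smooth L)
  let ?L = "\<lambda>j. concat (map (\<lambda>(f, g). [(partial j f, g), (f, partial j g)]) L)"
  have "partial j (\<lambda>x. \<Sum>(f, g)\<leftarrow>L. f x * g x) = (\<lambda>x. \<Sum>(f, g)\<leftarrow>?L j. f x * g x)" for j
    using partial_sum_list_mult(2)[OF smooth] by (rule ext)
  moreover have "\<forall>(f, g)\<in>set (?L j). smooth f \<and> smooth g" for j
    using smooth smooth_partial by fastforce
  ultimately show ?case using partial_sum_list_mult(1)[OF smooth] by blast
qed

lemma smooth_mult: "smooth f \<Longrightarrow> smooth g \<Longrightarrow> smooth (\<lambda>x. f x * g x)"
  using smooth_sum_list_mult[of "[(f, g)]"] by simp

lemma smooth_linear: "smooth f \<Longrightarrow> smooth g \<Longrightarrow> smooth (\<lambda>x. a * f x + b * g x)"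
  using smooth_sum_list_mult[of "[(\<lambda>_. a, f), (\<lambda>_. b, g)]"] smooth_const by auto

lemma smooth_prod: "finite I \<Longrightarrow> (\<And>i. i \<in> I \<Longrightarrow> smooth (f i)) \<Longrightarrow> smooth (\<lambda>x. \<Prod>i\<in>I. f i x)"
  by (induction I rule: finite_induct) (auto intro: smooth_const smooth_mult)

text \<open>The functions p(1/t) exp(-c/t) on the positive half-line are closed under differentiation.\<close>

definition flat :: "real \<Rightarrow> real poly \<Rightarrow> real \<Rightarrow> real" where
  "flat c p t = (if t > 0 then poly p (inverse t) * exp (- c * inverse t) else 0)"

lemma poly_exp_tendsto_0:
  assumes "c > (0::real)"
  shows "((\<lambda>y. poly p y * exp (- c * y)) \<longlongrightarrow> 0) at_top"
proof -
  have "((\<lambda>y. y ^ k * exp (- c * y)) \<longlongrightarrow> 0) at_top" for k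
  proof -
    have "filterlim (\<lambda>y. c * y) at_top at_top"
      using assms by (rule filterlim_tendsto_pos_mult_at_top[OF tendsto_const _ filterlim_ident])
    then have "((\<lambda>y. (c * y) ^ k / exp (c * y)) \<longlongrightarrow> 0) at_top"
      by (rule filterlim_compose[OF tendsto_power_div_exp_0])
    then have "((\<lambda>y. inverse (c ^ k) * ((c * y) ^ k / exp (c * y))) \<longlongrightarrow> 0) at_top"
      by (rule tendsto_mult_right_zero)
    then show ?thesis using assms by (simp add: power_mult_distrib exp_minus field_simps)
  qed
  then have "((\<lambda>y. \<Sum>k\<le>degree p. coeff p k * (y ^ k * exp (- c * y))) \<longlongrightarrow> 0) at_top"
    by (intro tendsto_null_sum tendsto_mult_right_zero)
  then show ?thesis by (simp add: poly_altdef sum_distrib_right mult.assoc)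
qed

lemma flat_tendsto_0:
  assumes "c > 0"
  shows "((\<lambda>t. flat c p t) \<longlongrightarrow> 0) (at 0)"
proof -
  have "((\<lambda>t. flat c p t) \<longlongrightarrow> 0) (at_right 0)"
  proof (rule Lim_transform_eventually)
    show "((\<lambda>t. poly p (inverse t) * exp (- c * inverse t)) \<longlongrightarrow> 0) (at_right 0)"
      by (rule filterlim_compose[OF poly_exp_tendsto_0[OF assms] filterlim_inverse_at_top_right])
    show "\<forall>\<^sub>F t in at_right 0. poly p (inverse t) * exp (- c * inverse t) = flat c p t"
      by (auto simp: flat_def eventually_at_filter)
  qed
  moreover have "((\<lambda>t. flat c p t) \<longlongrightarrow> 0) (at_left 0)"
    by (rule Lim_transform_eventually[OF tendsto_const]) (auto simp: flat_def eventually_at_filter)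
  ultimately show ?thesis by (simp add: filterlim_split_at)
qed

text \<open>With y = 1/t, whose derivative is -y^2, differentiating p(y) exp(-c y) in t gives y^2 (c
  p(y) - p'(y)) exp(-c y); \<open>[:0, 0, 1:]\<close> is the factor y^2.\<close>

definition flat_deriv :: "real \<Rightarrow> real poly \<Rightarrow> real poly" where
  "flat_deriv c p = [:0, 0, 1:] * (smult c p - pderiv p)"

lemma flat_has_derivative:
  assumes "c > 0"
  shows "(flat c p has_field_derivative flat c (flat_deriv c p) t) (at t)"
proof (cases t "0::real" rule: linorder_cases)
  case less
  have "((\<lambda>t. 0) has_field_derivative 0) (at t)" by simp
  then have "(flat c p has_field_derivative 0) (at t)"
    by (rule has_field_derivative_transform_within_open[where S = "{..<0}"]) (use less in \<open>auto simp: flat_def\<close>)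
  then show ?thesis using less by (simp add: flat_def)
next
  case equal
  \<comment> \<open>The difference quotient at 0 is flat c p h divided by h, which is the flat
    function of the polynomial y p(y), that is \<open>pCons 0 p\<close>.\<close>
  have "((\<lambda>h. flat c (pCons 0 p) h) \<longlongrightarrow> 0) (at 0)" by (rule flat_tendsto_0[OF assms])
  moreover have "flat c (pCons 0 p) h = (flat c p h - flat c p 0) / (h - 0)" for h
    by (simp add: flat_def divide_inverse)
  ultimately show ?thesis using equal by (simp add: has_field_derivative_iff flat_def)
next
  case greater
  have "((\<lambda>t. poly p (inverse t) * exp (- c * inverse t)) has_field_derivative
      poly (flat_deriv c p) (inverse t) * exp (- c * inverse t)) (at t)"
    using greater
    by (auto intro!: derivative_eq_intros poly_DERIV[THEN DERIV_chain2]
        simp: flat_deriv_def algebra_simps power2_eq_square)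
  then have "(flat c p has_field_derivative poly (flat_deriv c p) (inverse t) * exp (- c * inverse t)) (at t)"
    by (rule has_field_derivative_transform_within_open[where S = "{0<..}"]) (use greater in \<open>auto simp: flat_def\<close>)
  then show ?thesis using greater by (simp add: flat_def)
qed

lemma smooth_flat:
  fixes i :: "'s::finite"
  assumes "c > 0"
  shows "smooth (\<lambda>x::real^'s. flat c p (s * (x $ i) + r))"
proof (coinduction arbitrary: p rule: smooth.coinduct)
  case smooth
  have D: "((\<lambda>x::real^'s. flat c p (s * (x $ i) + r)) has_derivative
      (\<lambda>h. s * (h $ i) * flat c (flat_deriv c p) (s * (x $ i) + r))) (at x)" for x
    by (rule DERIV_compose_FDERIV[OF flat_has_derivative[OF assms]])
      (auto intro!: derivative_eq_intros bounded_linear_imp_has_derivative bounded_linear_vec_nth)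
  have "partial j (\<lambda>x::real^'s. flat c p (s * (x $ i) + r)) =
      (\<lambda>x. flat c (smult (s * (if i = j then 1 else 0)) (flat_deriv c p)) (s * (x $ i) + r))" for j
    by (rule ext, subst partial_eq[OF D]) (auto simp: axis_def flat_def)
  moreover have "(\<lambda>x::real^'s. flat c p (s * (x $ i) + r)) differentiable (at x)" for x
    using D differentiable_def by blast
  ultimately show ?case by blast
qed

text \<open>Two one-sided factors per coordinate make the product positive exactly on the open box.
  The parameter c stays free because exp(-c/t) tends to 1 as c tends to 0, so the bumps approximate
  the indicator of the box.\<close>

definition bump :: "real \<Rightarrow> real^'s::finite \<Rightarrow> real^'s \<Rightarrow> real^'s \<Rightarrow> real" where
  "bump c a b x = (\<Prod>i\<in>UNIV. flat c 1 (x $ i - a $ i) * flat c 1 (b $ i - x $ i))"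

lemma bump_smooth:
  assumes "c > 0"
  shows "smooth (bump c a b)"
proof -
  have "smooth (\<lambda>x. flat c 1 (x $ i - a $ i) * flat c 1 (b $ i - x $ i))" for i
    using smooth_mult[OF smooth_flat[OF assms, of 1 1 i "- a $ i"] smooth_flat[OF assms, of 1 "-1" i "b $ i"]]
    by simp
  then show ?thesis unfolding bump_def[abs_def] by (intro smooth_prod) auto
qed

lemma flat_one_bounds: "c > 0 \<Longrightarrow> 0 \<le> flat c 1 t" "c > 0 \<Longrightarrow> flat c 1 t \<le> 1"
  by (auto simp: flat_def)

lemma bump_bounds: "c > 0 \<Longrightarrow> 0 \<le> bump c a b x" "c > 0 \<Longrightarrow> bump c a b x \<le> 1"
  unfolding bump_def
  by (auto intro!: prod_nonneg prod_le_1 mult_nonneg_nonneg mult_le_one flat_one_bounds)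

lemma mem_box_vec: "x \<in> box a b \<longleftrightarrow> (\<forall>i. a $ i < x $ i \<and> x $ i < b $ i)" for a :: "real^'s::finite"
  by (simp add: mem_box_cart)

lemma bump_outside: "x \<notin> box a b \<Longrightarrow> bump c a b x = 0"
  unfolding bump_def mem_box_vec by (auto simp: flat_def intro!: prod_zero)

lemma bump_tendsto: "(\<lambda>n. bump (1 / real (Suc n)) a b x) \<longlonglongrightarrow> indicator (box a b) x"
proof (cases "x \<in> box a b")
  case True
  have fl: "(\<lambda>n. flat (1 / real (Suc n)) 1 t) \<longlonglongrightarrow> 1" if "t > 0" for t
  proof -
    have "(\<lambda>n. exp (- (1 / real (Suc n)) * inverse t)) \<longlonglongrightarrow> exp (- 0 * inverse t)"
      by (intro tendsto_intros LIMSEQ_Suc lim_1_over_n)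
    then show ?thesis using that by (simp add: flat_def)
  qed
  have "(\<lambda>n. bump (1 / real (Suc n)) a b x) \<longlonglongrightarrow> (\<Prod>i::'a\<in>UNIV. 1 * 1)"
    unfolding bump_def using True by (intro tendsto_prod tendsto_mult fl) (auto simp: mem_box_vec)
  then show ?thesis using True by simp
qed (simp add: bump_outside)

lemma bump_test_function:
  assumes "c > 0" "cbox a b \<subseteq> \<Omega>"
  shows "bump c a b \<in> test_functions \<Omega>"
proof -
  have "{x. bump c a b x \<noteq> 0} \<subseteq> cbox a b" using bump_outside box_subset_cbox by blast
  then have "closure {x. bump c a b x \<noteq> 0} \<subseteq> cbox a b" "bounded {x. bump c a b x \<noteq> 0}"
    by (auto intro: closure_minimal closed_cbox bounded_subset[OF bounded_cbox] del: subsetI)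
  then show ?thesis
    using assms bump_smooth by (auto simp: test_functions_def)
qed

text \<open>Open boxes are an intersection-stable generator of the Borel sets, so vanishing
  integrals spread from boxes to all Borel sets; the complement step is where \<open>total\<close>
  enters.\<close>

lemma AE_zero_of_box_integrals:
  fixes h :: "'n::euclidean_space \<Rightarrow> real"
  assumes h: "integrable lebesgue h" and total: "integral\<^sup>L lebesgue h = 0"
    and box: "\<And>c d. (LINT x|lebesgue. indicator (box c d) x * h x) = 0"
  shows "AE x in lebesgue. h x = 0"
proof -
  \<comment> \<open>The induction runs over Borel sets for \<open>lborel\<close>, so h is first
    replaced by a Borel function that agrees with it almost everywhere.\<close>
  obtain g where g: "g \<in> borel_measurable lborel" "AE x in lborel. h x = g x"
    using completion_ex_borel_measurable_real[of h lborel] h by (auto intro: borel_measurable_integrable)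
  have hg: "AE x in lebesgue. h x = g x" using g(2) by (rule AE_completion)
  have gi: "integrable lborel g"
  proof -
    have "integrable lebesgue g"
      using h hg g(1) by (subst integrable_cong_AE[of _ _ h]) (auto intro: borel_measurable_integrable measurable_completion)
    then show ?thesis using integrable_completion[OF g(1)] by simp
  qed
  have tr: "(LINT x:A|lborel. g x) = (LINT x|lebesgue. indicator A x * h x)" if "A \<in> sets borel" for A
  proof -
    have "(LINT x:A|lborel. g x) = (LINT x|lebesgue. indicator A x * g x)"
      unfolding set_lebesgue_integral_def using that g(1) by (subst integral_completion) auto
    also have "\<dots> = (LINT x|lebesgue. indicator A x * h x)"
      using hg that borel_measurable_integrable[OF h] measurable_completion[OF g(1)]
      by (intro integral_cong_AE) (auto intro!: borel_measurable_times borel_measurable_indicator)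
    finally show ?thesis .
  qed
  have si: "set_integrable lborel A g" if "A \<in> sets borel" for A
    unfolding set_integrable_def using that gi by (intro integrable_mult_indicator) auto
  have UN: "(LINT x:UNIV|lborel. g x) = 0" using tr[of UNIV] total by simp
  let ?G = "range (\<lambda>(a, b). box a b :: 'n set)"
  have sets: "sets borel = sigma_sets UNIV ?G" by (subst borel_eq_box) simp
  have "(LINT x:A|lborel. g x) = 0" if "A \<in> sigma_sets UNIV ?G" for A
  proof (rule sigma_sets_induct_disjoint[OF _ _ that])
    show "Int_stable ?G" by (auto simp: Int_stable_def box_Int_box)
    show "(LINT x:B|lborel. g x) = 0" if B: "B \<in> ?G" for B
    proof -
      obtain c d where "B = box c d" using B by auto
      then show ?thesis using tr[of B] box by simp
    qed
    show "(LINT x:UNIV - B|lborel. g x) = 0" if B: "B \<in> sigma_sets UNIV ?G" "(LINT x:B|lborel. g x) = 0" for B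
    proof -
      have "B \<in> sets borel" using B(1) unfolding sets .
      then have Bs: "B \<in> sets borel" "UNIV - B \<in> sets borel" by auto
      have "(LINT x:B \<union> (UNIV - B)|lborel. g x) = (LINT x:B|lborel. g x) + (LINT x:UNIV - B|lborel. g x)"
        by (rule set_integral_Un) (use si Bs in auto)
      then show ?thesis using UN B(2) by simp
    qed
    show "(LINT x:(\<Union>i. B i)|lborel. g x) = 0"
      if B: "disjoint_family B" "range B \<subseteq> sigma_sets UNIV ?G" "\<And>i::nat. (LINT x:B i|lborel. g x) = 0" for B
    proof -
      have Bs: "B i \<in> sets borel" for i using B(2) unfolding sets by blast
      then have "(LINT x:(\<Union>i. B i)|lborel. g x) = (\<Sum>i. (LINT x:B i|lborel. g x))"
        using B(1) by (intro lebesgue_integral_countable_add si) (auto simp: disjoint_family_on_def)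
      then show ?thesis using B(3) by simp
    qed
  qed (auto simp: set_lebesgue_integral_def)
  then have "AE x in lborel. g x = 0"
    using sigma_finite_measure.density_zero[OF lborel.sigma_finite_measure_axioms gi] unfolding sets_lborel sets by blast
  from AE_completion[OF this] hg show ?thesis by eventually_elim simp
qed

text \<open>Bumps take values in [0, 1], so dominated convergence turns the hypothesis into
  vanishing integrals of g over boxes whose closure lies in \<Omega>. The global criterion is then
  applied to g cut off to one such box, and countably many of these boxes cover \<Omega>.\<close>

lemma fundamental_lemma:
  fixes \<Omega> :: "(real^'s::finite) set" and g :: "real^'s \<Rightarrow> real"
  assumes \<Omega>: "open \<Omega>" and g: "integrable (lebesgue_on \<Omega>) g"
    and zero: "\<And>\<phi>. \<phi> \<in> test_functions \<Omega> \<Longrightarrow> (LINT x|lebesgue_on \<Omega>. g x * \<phi> x) = 0"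
  shows "AE x in lebesgue_on \<Omega>. g x = 0"
proof -
  have \<Omega>L: "\<Omega> \<in> sets lebesgue" using \<Omega> by (simp add: borel_open)
  have ig: "integrable lebesgue (\<lambda>x. indicator \<Omega> x * g x)"
    using g \<Omega>L by (simp add: integrable_restrict_space)
  have res: "(LINT x|lebesgue_on \<Omega>. f x) = (LINT x|lebesgue. indicator \<Omega> x * f x)" for f :: "real^'s \<Rightarrow> real"
    using \<Omega>L by (simp add: integral_restrict_space)
  have box0: "(LINT x|lebesgue. indicator (box a b) x * (indicator \<Omega> x * g x)) = 0" if ab: "cbox a b \<subseteq> \<Omega>" for a b
  proof -
    have "(\<lambda>n. LINT x|lebesgue. (indicator \<Omega> x * g x) * bump (1 / real (Suc n)) a b x)
        \<longlonglongrightarrow> (LINT x|lebesgue. (indicator \<Omega> x * g x) * indicator (box a b) x)"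
    proof (rule integral_dominated_convergence[where w = "\<lambda>x. norm (indicator \<Omega> x * g x)"])
      have bm: "bump (1 / real (Suc n)) a b \<in> borel_measurable lebesgue" for n
        using bump_smooth[of "1 / real (Suc n)" a b] smooth_continuous
        by (intro measurable_completion) (auto intro: borel_measurable_continuous_onI)
      show "(\<lambda>x. indicator \<Omega> x * g x * bump (1 / real (Suc n)) a b x) \<in> borel_measurable lebesgue" for n
        using ig bm by (intro borel_measurable_times[of "\<lambda>x. indicator \<Omega> x * g x"]) (auto intro: borel_measurable_integrable)
      show "(\<lambda>x. indicator \<Omega> x * g x * indicator (box a b) x) \<in> borel_measurable lebesgue"
        using ig by (intro borel_measurable_times[of "\<lambda>x. indicator \<Omega> x * g x"])
          (auto intro: borel_measurable_integrable borel_measurable_indicator)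
      show "integrable lebesgue (\<lambda>x. norm (indicator \<Omega> x * g x))" using ig by (rule integrable_norm)
      show "AE x in lebesgue. (\<lambda>n. indicator \<Omega> x * g x * bump (1 / real (Suc n)) a b x)
          \<longlonglongrightarrow> indicator \<Omega> x * g x * indicator (box a b) x"
        by (intro AE_I2 tendsto_mult_left bump_tendsto)
      show "AE x in lebesgue. norm (indicator \<Omega> x * g x * bump (1 / real (Suc n)) a b x)
          \<le> norm (indicator \<Omega> x * g x)" for n
        using bump_bounds[of "1 / real (Suc n)" a b]
        by (intro AE_I2) (simp add: abs_mult mult_left_le)
    qed
    moreover have "(LINT x|lebesgue. (indicator \<Omega> x * g x) * bump (1 / real (Suc n)) a b x) = 0" for n
      using zero[OF bump_test_function[OF _ ab, of "1 / real (Suc n)"]] res[of "\<lambda>x. g x * bump (1 / real (Suc n)) a b x"]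
      by (simp add: mult.assoc)
    ultimately have "(LINT x|lebesgue. (indicator \<Omega> x * g x) * indicator (box a b) x) = 0"
      by (simp add: LIMSEQ_const_iff)
    then show ?thesis by (simp add: mult.commute)
  qed
  have loc: "AE x in lebesgue. x \<in> box a b \<longrightarrow> g x = 0" if ab: "cbox a b \<subseteq> \<Omega>" for a b
  proof -
    let ?h = "\<lambda>x. indicator (box a b) x * (indicator \<Omega> x * g x)"
    have "AE x in lebesgue. ?h x = 0"
    proof (rule AE_zero_of_box_integrals)
      show "integrable lebesgue ?h"
        using integrable_mult_indicator[OF _ ig, of "box a b"] by simp
      show "integral\<^sup>L lebesgue ?h = 0" by (rule box0[OF ab])
      show "(LINT x|lebesgue. indicator (box c d) x * ?h x) = 0" for c d
      proof -
        obtain e f where ef: "box c d \<inter> box a b = box e f" using box_Int_box by blast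
        have eq: "indicator (box c d) x * ?h x = indicator (box e f) x * (indicator \<Omega> x * g x)" for x
          using ef[symmetric] by (simp add: indicator_inter_arith)
        show ?thesis
        \<comment> \<open>An empty open box says nothing about \<open>cbox e f\<close>, which may be
          a nonempty degenerate box outside \<Omega>; only a nonempty open box has it as
          closure.\<close>
        proof (cases "box e f = {}")
          case True
          then show ?thesis unfolding eq by simp
        next
          case False
          have "cbox e f = closure (box e f)" using closure_box[OF False] by simp
          also have "\<dots> \<subseteq> closure (box a b)" using ef by (intro closure_mono) blast
          also have "\<dots> \<subseteq> cbox a b" by (simp add: closure_minimal box_subset_cbox closed_cbox)
          finally show ?thesis unfolding eq using ab by (intro box0) blast
        qed
      qed
    qed
    then show ?thesis
    proof eventually_elim
      case (elim x)
      have "x \<in> \<Omega>" if "x \<in> box a b" using that ab box_subset_cbox by blast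
      then show ?case using elim by auto
    qed
  qed
  define F where "F = {box a b |a b. cbox a b \<subseteq> \<Omega>}"
  \<comment> \<open>Lindelof's theorem reduces the cover to countably many boxes, so that the
    exceptional null sets have a null union.\<close>
  obtain F' where F': "F' \<subseteq> F" "countable F'" "\<Union>F' = \<Union>F"
    using Lindelof[of F] open_box unfolding F_def by blast
  have "\<Omega> \<subseteq> \<Union>F"
  proof
    fix x assume "x \<in> \<Omega>"
    then obtain a b where "cbox a b \<subseteq> \<Omega>" "x \<in> box a b" using open_contains_cbox[OF \<Omega>] by metis
    then show "x \<in> \<Union>F" by (auto simp: F_def)
  qed
  moreover have "AE x in lebesgue. \<forall>B\<in>F'. x \<in> B \<longrightarrow> g x = 0"
  proof (rule AE_ball_countable'[OF _ F'(2)])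
    fix B assume "B \<in> F'"
    then obtain a b where "B = box a b" "cbox a b \<subseteq> \<Omega>" using F'(1) by (auto simp: F_def)
    then show "AE x in lebesgue. x \<in> B \<longrightarrow> g x = 0" using loc by simp
  qed
  ultimately have "AE x in lebesgue. x \<in> \<Omega> \<longrightarrow> g x = 0"
    using F'(3) by (auto elim!: eventually_mono)
  then show ?thesis using \<Omega>L by (simp add: AE_restrict_space_iff)
qed

section \<open>The space H1\<close>

lemma vec_nth_borel_measurable:
  fixes f :: "'a \<Rightarrow> 'b::euclidean_space ^ 's::finite"
  assumes "f \<in> borel_measurable M"
  shows "(\<lambda>x. f x $ i) \<in> borel_measurable M"
  by (rule borel_measurable_continuous_on[OF _ assms]) (intro continuous_intros)

lemma L2_vec_nth:
  fixes f :: "'a \<Rightarrow> 'b::euclidean_space ^ 's::finite"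
  assumes "f \<in> L2 M"
  shows "(\<lambda>x. f x $ i) \<in> L2 M"
  by (rule L2_bound[OF assms vec_nth_borel_measurable[OF L2_measurable[OF assms]], where c = 1])
    (simp add: Finite_Cartesian_Product.norm_nth_le)

lemma L2_norm_sq: "(L2_norm M f)\<^sup>2 = l2ip M f f"
  by (simp add: L2_norm_def l2ip_def power2_norm_eq_inner)

lemma l2ip_nonneg [simp]: "0 \<le> l2ip M f f"
  by (simp add: l2ip_def)

lemma L2_combination: "f \<in> L2 N \<Longrightarrow> g \<in> L2 N \<Longrightarrow> a *\<^sub>R f + b *\<^sub>R g \<in> L2 N"
  by (intro subspace_add subspace_scale L2_subspace)

lemma l2ip_combination:
  "f \<in> L2 N \<Longrightarrow> g \<in> L2 N \<Longrightarrow> h \<in> L2 N \<Longrightarrow> l2ip N (a *\<^sub>R f + b *\<^sub>R g) h = a * l2ip N f h + b * l2ip N g h"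
  using l2ip_linear[of h N] unfolding linear_form_def by blast

lemma l2ip_cong_AE:
  assumes "f \<in> L2 M" "g \<in> L2 M" "h \<in> L2 M" "AE x in M. f x = g x"
  shows "l2ip M f h = l2ip M g h"
  unfolding l2ip_def
  by (rule integral_cong_AE)
    (use assms in \<open>auto intro!: borel_measurable_inner dest: L2_measurable\<close>)

text \<open>e stands for the passage to an entry of a vector or matrix. Weak gradients are defined
  entrywise against test functions, and this lets the defining identity pass to the limit.\<close>

lemma l2ip_component_tendsto:
  fixes f :: "nat \<Rightarrow> 'a \<Rightarrow> 'b::euclidean_space" and e :: "'b \<Rightarrow> real"
  assumes f: "\<And>n. f n \<in> L2 M" "F \<in> L2 M" "(\<lambda>n. ipnorm (l2ip M) (f n - F)) \<longlonglongrightarrow> 0"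
    and h: "h \<in> L2 M"
    and e: "\<And>x. norm (e x) \<le> norm x" "\<And>x y. e (x - y) = e x - e y" "continuous_on UNIV e"
  shows "(\<lambda>n. l2ip M (\<lambda>x. e (f n x)) h) \<longlonglongrightarrow> l2ip M (\<lambda>x. e (F x)) h"
proof -
  interpret L: semi_inner "L2 M :: ('a \<Rightarrow> 'b) set" "l2ip M" by (rule l2_semi_inner)
  interpret R: semi_inner "L2 M :: ('a \<Rightarrow> real) set" "l2ip M" by (rule l2_semi_inner)
  have eL: "(\<lambda>x. e (k x)) \<in> L2 M" if "k \<in> L2 M" for k
    by (rule L2_bound[OF that, where c = 1])
      (use that e in \<open>auto intro: borel_measurable_continuous_on L2_measurable\<close>)
  have en: "ipnorm (l2ip M) (\<lambda>x. e (k x)) \<le> ipnorm (l2ip M) k" if "k \<in> L2 M" for k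
    unfolding L2_norm_ipnorm[symmetric] L2_norm_def
    using L2_integrable[OF eL[OF that]] L2_integrable[OF that] power_mono[OF e(1) norm_ge_zero, where n = 2]
    by (intro real_sqrt_le_mono integral_mono) auto
  have eq: "(\<lambda>x. e (f n x)) - (\<lambda>x. e (F x)) = (\<lambda>x. e ((f n - F) x))" for n
    using e(2) by (simp add: fun_eq_iff)
  have "(\<lambda>n. ipnorm (l2ip M) ((\<lambda>x. e (f n x)) - (\<lambda>x. e (F x)))) \<longlonglongrightarrow> 0"
  proof (rule Lim_null_comparison[OF _ f(3)])
    have d: "f n - F \<in> L2 M" for n using f L.mem by simp
    have "\<bar>ipnorm (l2ip M) (\<lambda>x. e ((f n - F) x))\<bar> \<le> ipnorm (l2ip M) (f n - F)" for n
      using en[OF d] R.norm_nonneg[OF eL[OF d]] by simp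
    then show "\<forall>\<^sub>F n in sequentially. norm (ipnorm (l2ip M) ((\<lambda>x. e (f n x)) - (\<lambda>x. e (F x)))) \<le> ipnorm (l2ip M) (f n - F)"
      unfolding eq by simp
  qed
  then show ?thesis
    by (intro R.bounded_form_tendsto[OF l2ip_linear[OF h], of "ipnorm (l2ip M) h"])
      (use R.Cauchy_Schwarz[OF _ h] eL f in \<open>auto simp: mult.commute\<close>)
qed

section \<open>Weak gradients and completeness of H1 on a bounded open set\<close>

locale bounded_open =
  fixes \<Omega> :: "(real^'s::finite) set"
  assumes open_\<Omega>: "open \<Omega>" and bounded_\<Omega>: "bounded \<Omega>"
begin

abbreviation M where "M \<equiv> lebesgue_on \<Omega>"

lemma lmeasurable_\<Omega>: "\<Omega> \<in> lmeasurable"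
  using open_\<Omega> bounded_\<Omega> by (simp add: lmeasurable_open)

lemma finite_measure_M: "finite_measure M"
  by (rule finite_measure_lebesgue_on[OF lmeasurable_\<Omega>])

lemma bounded_L2:
  fixes f :: "real^'s \<Rightarrow> 'b::euclidean_space"
  assumes "f \<in> borel_measurable M" "\<And>x. x \<in> \<Omega> \<Longrightarrow> norm (f x) \<le> c"
  shows "f \<in> L2 M"
proof -
  interpret finite_measure M by (rule finite_measure_M)
  have "(\<lambda>_. 1::real) \<in> L2 M" by (simp add: L2_def)
  then show ?thesis by (rule L2_bound[where c = c]) (use assms in \<open>auto intro!: AE_I2\<close>)
qed

lemma continuous_L2:
  fixes f :: "real^'s \<Rightarrow> 'b::euclidean_space"
  assumes "continuous_on UNIV f"
  shows "f \<in> L2 M"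
proof -
  have "compact (f ` closure \<Omega>)"
    using assms bounded_\<Omega> by (intro compact_continuous_image) (auto intro: continuous_on_subset)
  then obtain c where "\<forall>y\<in>f ` closure \<Omega>. norm y \<le> c"
    using compact_imp_bounded bounded_iff by metis
  then have "\<And>x. x \<in> \<Omega> \<Longrightarrow> norm (f x) \<le> c" using closure_subset by blast
  moreover have "f \<in> borel_measurable M"
    using borel_measurable_continuous_onI[OF assms]
    by (intro measurable_restrict_space1 measurable_completion) simp
  ultimately show ?thesis by (intro bounded_L2)
qed

lemma smooth_L2: "smooth \<phi> \<Longrightarrow> \<phi> \<in> L2 M"
  by (intro continuous_L2 smooth_continuous)

lemma test_smooth: "\<phi> \<in> test_functions \<Omega> \<Longrightarrow> smooth \<phi>"
  by (simp add: test_functions_def)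

lemma L2_integrable_mult:
  fixes f g :: "real^'s \<Rightarrow> real"
  shows "f \<in> L2 M \<Longrightarrow> g \<in> L2 M \<Longrightarrow> integrable M (\<lambda>x. f x * g x)"
  using L2_inner_integrable[of f M g] by simp

lemma has_weak_gradient_l2ip:
  "has_weak_gradient \<Omega> v G \<longleftrightarrow> (\<forall>\<phi>\<in>test_functions \<Omega>. \<forall>i j.
     l2ip M (\<lambda>x. v x $ i) (partial j \<phi>) = - l2ip M (\<lambda>x. G x $ i $ j) \<phi>)"
  by (simp add: has_weak_gradient_def l2ip_def)

lemma weak_gradient_linear:
  assumes "v \<in> L2 M" "G \<in> L2 M" "has_weak_gradient \<Omega> v G" "w \<in> L2 M" "F \<in> L2 M" "has_weak_gradient \<Omega> w F"
  shows "has_weak_gradient \<Omega> (a *\<^sub>R v + b *\<^sub>R w) (a *\<^sub>R G + b *\<^sub>R F)"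
  unfolding has_weak_gradient_l2ip
proof (intro ballI allI)
  fix \<phi> i j assume \<phi>: "\<phi> \<in> test_functions \<Omega>"
  have s: "\<phi> \<in> L2 M" "partial j \<phi> \<in> L2 M" using \<phi> test_smooth smooth_partial smooth_L2 by auto
  have lin: "l2ip M (a *\<^sub>R f + b *\<^sub>R g) h = a * l2ip M f h + b * l2ip M g h"
    if "f \<in> L2 M" "g \<in> L2 M" "h \<in> L2 M" for f g h :: "real^'s \<Rightarrow> real"
    using l2ip_linear[OF that(3)] that unfolding linear_form_def by blast
  have 1: "(\<lambda>x. (a *\<^sub>R v + b *\<^sub>R w) x $ i) = a *\<^sub>R (\<lambda>x. v x $ i) + b *\<^sub>R (\<lambda>x. w x $ i)"
    "(\<lambda>x. (a *\<^sub>R G + b *\<^sub>R F) x $ i $ j) = a *\<^sub>R (\<lambda>x. G x $ i $ j) + b *\<^sub>R (\<lambda>x. F x $ i $ j)"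
    by (auto simp: fun_eq_iff)
  show "l2ip M (\<lambda>x. (a *\<^sub>R v + b *\<^sub>R w) x $ i) (partial j \<phi>) = - l2ip M (\<lambda>x. (a *\<^sub>R G + b *\<^sub>R F) x $ i $ j) \<phi>"
    unfolding 1 using assms \<phi> s
    by (simp add: lin L2_vec_nth has_weak_gradient_l2ip)
qed

text \<open>This makes the arbitrary choice in \<open>weak_grad\<close> harmless: any two candidates
  agree almost everywhere, so \<open>weak_grad\<close> is linear up to null sets, as
  \<open>H1_combination\<close> records.\<close>

lemma weak_gradient_unique:
  assumes "F \<in> L2 M" "G \<in> L2 M" "has_weak_gradient \<Omega> v F" "has_weak_gradient \<Omega> v G"
  shows "AE x in M. F x = G x"
proof -
  interpret finite_measure M by (rule finite_measure_M)
  have one: "(\<lambda>_. 1::real) \<in> L2 M" by (simp add: L2_def)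
  have "AE x in M. F x $ i $ j - G x $ i $ j = 0" for i j
  proof (rule fundamental_lemma[OF open_\<Omega>])
    have c: "(\<lambda>x. F x $ i $ j) \<in> L2 M" "(\<lambda>x. G x $ i $ j) \<in> L2 M" by (intro L2_vec_nth assms)+
    then show "integrable M (\<lambda>x. F x $ i $ j - G x $ i $ j)"
      using L2_integrable_mult[OF _ one] by (intro Bochner_Integration.integrable_diff) auto
    fix \<phi> assume \<phi>: "\<phi> \<in> test_functions \<Omega>"
    then have s: "\<phi> \<in> L2 M" using test_smooth smooth_L2 by auto
    have "(LINT x|M. v x $ i * partial j \<phi> x) = - (LINT x|M. F x $ i $ j * \<phi> x)"
      "(LINT x|M. v x $ i * partial j \<phi> x) = - (LINT x|M. G x $ i $ j * \<phi> x)"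
      using assms(3,4) \<phi> unfolding has_weak_gradient_def by blast+
    then have "(LINT x|M. F x $ i $ j * \<phi> x) = (LINT x|M. G x $ i $ j * \<phi> x)" by simp
    then show "(LINT x|M. (F x $ i $ j - G x $ i $ j) * \<phi> x) = 0"
      using L2_integrable_mult[OF c(1) s] L2_integrable_mult[OF c(2) s] by (simp add: left_diff_distrib)
  qed
  then have "AE x in M. \<forall>i\<in>UNIV. \<forall>j\<in>UNIV. F x $ i $ j - G x $ i $ j = 0"
    by (intro AE_ball_countable') auto
  then show ?thesis by eventually_elim (simp add: vec_eq_iff)
qed

lemma weak_grad:
  assumes "v \<in> H1 \<Omega>"
  shows "weak_grad \<Omega> v \<in> L2 M" "has_weak_gradient \<Omega> v (weak_grad \<Omega> v)"
proof -
  have "\<exists>G. G \<in> L2 M \<and> has_weak_gradient \<Omega> v G" using assms by (auto simp: H1_def)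
  from someI_ex[OF this] show "weak_grad \<Omega> v \<in> L2 M" "has_weak_gradient \<Omega> v (weak_grad \<Omega> v)"
    by (auto simp: weak_grad_def)
qed

lemma H1_L2: "v \<in> H1 \<Omega> \<Longrightarrow> v \<in> L2 M"
  by (simp add: H1_def)

lemma H1_combination:
  assumes "u \<in> H1 \<Omega>" "v \<in> H1 \<Omega>"
  shows "a *\<^sub>R u + b *\<^sub>R v \<in> H1 \<Omega>"
    and "AE x in M. weak_grad \<Omega> (a *\<^sub>R u + b *\<^sub>R v) x = a *\<^sub>R weak_grad \<Omega> u x + b *\<^sub>R weak_grad \<Omega> v x"
proof -
  have G: "a *\<^sub>R weak_grad \<Omega> u + b *\<^sub>R weak_grad \<Omega> v \<in> L2 M"
    using weak_grad assms by (intro L2_combination) auto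
  have D: "has_weak_gradient \<Omega> (a *\<^sub>R u + b *\<^sub>R v) (a *\<^sub>R weak_grad \<Omega> u + b *\<^sub>R weak_grad \<Omega> v)"
    using weak_grad assms H1_L2 by (intro weak_gradient_linear) auto
  show H: "a *\<^sub>R u + b *\<^sub>R v \<in> H1 \<Omega>"
    unfolding H1_def using G D L2_combination[OF assms[THEN H1_L2]] by blast
  show "AE x in M. weak_grad \<Omega> (a *\<^sub>R u + b *\<^sub>R v) x = a *\<^sub>R weak_grad \<Omega> u x + b *\<^sub>R weak_grad \<Omega> v x"
    using weak_gradient_unique[OF weak_grad(1)[OF H] G weak_grad(2)[OF H] D] by simp
qed

lemma subspace_H1: "subspace (H1 \<Omega>)"
proof -
  have "(0 :: 's field) \<in> H1 \<Omega>"
  proof -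
    have "has_weak_gradient \<Omega> 0 0" by (simp add: has_weak_gradient_def)
    then show ?thesis by (auto simp: H1_def intro!: bexI[of _ 0] subspace_0[OF L2_subspace])
  qed
  moreover have "u + v \<in> H1 \<Omega>" if "u \<in> H1 \<Omega>" "v \<in> H1 \<Omega>" for u v
    using H1_combination(1)[OF that, of 1 1] by simp
  moreover have "c *\<^sub>R u \<in> H1 \<Omega>" if "u \<in> H1 \<Omega>" for c u
    using H1_combination(1)[OF that that, of c 0] by simp
  ultimately show ?thesis by (simp add: subspace_def)
qed

definition h1ip :: "'s field \<Rightarrow> 's field \<Rightarrow> real" where
  "h1ip u v = l2ip M u v + l2ip M (weak_grad \<Omega> u) (weak_grad \<Omega> v)"

lemma H1_norm_ipnorm: "H1_norm \<Omega> v = ipnorm h1ip v"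
  by (simp add: H1_norm_def ipnorm_def h1ip_def L2_norm_sq)

lemma h1ip_commute: "h1ip u v = h1ip v u"
  by (simp add: h1ip_def l2ip_commute)

lemma l2ip_weak_grad_combination:
  assumes "u \<in> H1 \<Omega>" "v \<in> H1 \<Omega>" "h \<in> L2 M"
  shows "l2ip M (weak_grad \<Omega> (a *\<^sub>R u + b *\<^sub>R v)) h = a * l2ip M (weak_grad \<Omega> u) h + b * l2ip M (weak_grad \<Omega> v) h"
proof -
  have "l2ip M (weak_grad \<Omega> (a *\<^sub>R u + b *\<^sub>R v)) h = l2ip M (a *\<^sub>R weak_grad \<Omega> u + b *\<^sub>R weak_grad \<Omega> v) h"
    using H1_combination(2)[OF assms(1,2), of a b]
    by (intro l2ip_cong_AE weak_grad(1) L2_combination H1_combination(1) assms) auto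
  then show ?thesis using l2ip_combination[OF weak_grad(1) weak_grad(1)] assms by simp
qed

lemma h1_semi_inner: "semi_inner (H1 \<Omega>) h1ip"
proof
  show "subspace (H1 \<Omega>)" by (rule subspace_H1)
  have l: "linear_form (H1 \<Omega>) (\<lambda>u. h1ip u v)" if "v \<in> H1 \<Omega>" for v
    unfolding linear_form_def h1ip_def
    using l2ip_weak_grad_combination[OF _ _ weak_grad(1)[OF that]] l2ip_combination[OF _ _ H1_L2[OF that]] H1_L2
    by (simp add: algebra_simps)
  moreover have "linear_form (H1 \<Omega>) (h1ip v)" if "v \<in> H1 \<Omega>" for v
  proof -
    have "h1ip v = (\<lambda>u. h1ip u v)" by (simp add: fun_eq_iff h1ip_commute)
    then show ?thesis using l[OF that] by metis
  qed
  ultimately show "bilinear_form (H1 \<Omega>) (H1 \<Omega>) h1ip" by (simp add: bilinear_form_def)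
  show "0 \<le> h1ip u u" for u by (simp add: h1ip_def l2ip_def)
qed (rule h1ip_commute)

sublocale h1: semi_inner "H1 \<Omega>" h1ip by (rule h1_semi_inner)

lemma h1_norm_bounds:
  "ipnorm (l2ip M) u \<le> ipnorm h1ip u" "ipnorm (l2ip M) (weak_grad \<Omega> u) \<le> ipnorm h1ip u"
  "ipnorm h1ip u \<le> ipnorm (l2ip M) u + ipnorm (l2ip M) (weak_grad \<Omega> u)"
  by (auto simp: ipnorm_def h1ip_def sqrt_add_le_add_sqrt)

text \<open>Gradients of differences are differences of gradients only almost everywhere, hence the
  comparison of norms. G is left open to serve both for members of a Cauchy sequence and for its
  limit.\<close>

lemma l2norm_weak_grad_diff:
  assumes "u \<in> H1 \<Omega>" "v \<in> H1 \<Omega>" "G \<in> L2 M" "AE x in M. weak_grad \<Omega> v x = G x"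
  shows "ipnorm (l2ip M) (weak_grad \<Omega> (u - v)) = ipnorm (l2ip M) (weak_grad \<Omega> u - G)"
proof -
  have w: "u - v \<in> H1 \<Omega>" using assms subspace_H1 subspace_diff by blast
  have "AE x in M. weak_grad \<Omega> (u - v) x = weak_grad \<Omega> u x - weak_grad \<Omega> v x"
    using H1_combination(2)[OF assms(1,2), of 1 "-1"] by simp
  with assms(4) have "AE x in M. (norm (weak_grad \<Omega> (u - v) x))\<^sup>2 = (norm ((weak_grad \<Omega> u - G) x))\<^sup>2"
    by eventually_elim simp
  moreover have d: "weak_grad \<Omega> u - G \<in> L2 M"
    using weak_grad(1)[OF assms(1)] assms(3) by (rule subspace_diff[OF L2_subspace])
  ultimately have "(LINT x|M. (norm (weak_grad \<Omega> (u - v) x))\<^sup>2) = (LINT x|M. (norm ((weak_grad \<Omega> u - G) x))\<^sup>2)"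
    by (intro integral_cong_AE borel_measurable_integrable L2_integrable d weak_grad(1)[OF w])
  then show ?thesis by (simp add: L2_norm_ipnorm[symmetric] L2_norm_def)
qed

text \<open>Fields and their gradients converge separately in L2. Test functions and their
  derivatives are fixed elements of L2, so the limit of the gradients is a weak gradient of the
  limit.\<close>

lemma H1_complete: "complete_form (H1 \<Omega>) h1ip"
  unfolding complete_form_def
proof (intro allI impI, elim conjE)
  fix s :: "nat \<Rightarrow> 's field"
  assume s: "\<forall>n. s n \<in> H1 \<Omega>" and c: "\<forall>e>0. \<exists>L. \<forall>m\<ge>L. \<forall>n\<ge>L. ipnorm h1ip (s m - s n) < e"
  let ?g = "\<lambda>n. weak_grad \<Omega> (s n)"
  have gL: "?g n \<in> L2 M" for n using weak_grad(1) s by blast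
  have gd: "ipnorm (l2ip M) (?g m - ?g n) \<le> ipnorm h1ip (s m - s n)" for m n
    using l2norm_weak_grad_diff[of "s m" "s n" "?g n"] s gL h1_norm_bounds(2)[of "s m - s n"] by simp
  have "\<forall>e>0. \<exists>L. \<forall>m\<ge>L. \<forall>n\<ge>L. ipnorm (l2ip M) (s m - s n) < e"
    "\<forall>e>0. \<exists>L. \<forall>m\<ge>L. \<forall>n\<ge>L. ipnorm (l2ip M) (?g m - ?g n) < e"
    using c h1_norm_bounds(1) gd by (meson le_less_trans)+
  then obtain v G where v: "v \<in> L2 M" "(\<lambda>n. ipnorm (l2ip M) (s n - v)) \<longlonglongrightarrow> 0"
    and G: "G \<in> L2 M" "(\<lambda>n. ipnorm (l2ip M) (?g n - G)) \<longlonglongrightarrow> 0"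
    using L2_complete[where M = M, unfolded complete_form_def, rule_format, of s]
      L2_complete[where M = M, unfolded complete_form_def, rule_format, of ?g] s H1_L2 gL by blast
  have "has_weak_gradient \<Omega> v G"
    unfolding has_weak_gradient_l2ip
  proof (intro ballI allI)
    fix \<phi> i j assume \<phi>: "\<phi> \<in> test_functions \<Omega>"
    have sm: "\<phi> \<in> L2 M" "partial j \<phi> \<in> L2 M" using \<phi> test_smooth smooth_partial smooth_L2 by auto
    have "(\<lambda>n. l2ip M (\<lambda>x. s n x $ i) (partial j \<phi>)) \<longlonglongrightarrow> l2ip M (\<lambda>x. v x $ i) (partial j \<phi>)"
      by (rule l2ip_component_tendsto[OF _ v(1,2) sm(2)])
        (use s H1_L2 in \<open>auto intro!: continuous_intros component_le_norm_cart\<close>)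
    moreover have "(\<lambda>n. l2ip M (\<lambda>x. ?g n x $ i $ j) \<phi>) \<longlonglongrightarrow> l2ip M (\<lambda>x. G x $ i $ j) \<phi>"
      by (rule l2ip_component_tendsto[OF gL G(1,2) sm(1)])
        (auto intro!: continuous_intros order_trans[OF Finite_Cartesian_Product.norm_nth_le Finite_Cartesian_Product.norm_nth_le] simp del: real_norm_def)
    then have "(\<lambda>n. - l2ip M (\<lambda>x. ?g n x $ i $ j) \<phi>) \<longlonglongrightarrow> - l2ip M (\<lambda>x. G x $ i $ j) \<phi>"
      by (rule tendsto_minus)
    moreover have "l2ip M (\<lambda>x. s n x $ i) (partial j \<phi>) = - l2ip M (\<lambda>x. ?g n x $ i $ j) \<phi>" for n
      using weak_grad(2)[of "s n"] s \<phi> by (simp add: has_weak_gradient_l2ip)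
    ultimately show "l2ip M (\<lambda>x. v x $ i) (partial j \<phi>) = - l2ip M (\<lambda>x. G x $ i $ j) \<phi>"
      by (simp add: LIMSEQ_unique)
  qed
  then have vH: "v \<in> H1 \<Omega>" and vG: "AE x in M. weak_grad \<Omega> v x = G x"
    using v(1) G(1) weak_gradient_unique weak_grad unfolding H1_def by blast+
  have "(\<lambda>n. ipnorm h1ip (s n - v)) \<longlonglongrightarrow> 0"
  proof (rule Lim_null_comparison)
    show "(\<lambda>n. ipnorm (l2ip M) (s n - v) + ipnorm (l2ip M) (?g n - G)) \<longlonglongrightarrow> 0"
      using tendsto_add[OF v(2) G(2)] by simp
    show "\<forall>\<^sub>F n in sequentially. norm (ipnorm h1ip (s n - v)) \<le> ipnorm (l2ip M) (s n - v) + ipnorm (l2ip M) (?g n - G)"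
      using h1_norm_bounds(3)[of "s _ - v"] l2norm_weak_grad_diff[OF _ vH G(1) vG] s
        h1.norm_nonneg[OF h1.mem(3)] vH by (intro always_eventually allI) (simp add: abs_le_iff)
  qed
  then show "\<exists>l\<in>H1 \<Omega>. (\<lambda>n. ipnorm h1ip (s n - l)) \<longlonglongrightarrow> 0" using vH by blast
qed

end

section \<open>Traces\<close>

definition surface_sq :: "(real^'s::finite) set \<Rightarrow> 's field \<Rightarrow> ennreal" where
  "surface_sq \<Omega> f = (\<integral>\<^sup>+ x. ennreal ((norm (f x))\<^sup>2) \<partial>surface_measure \<Omega>)"

text \<open>\<open>measure_of\<close> fixes the sigma-algebra independently of the set function, so
  measurability for the Hausdorff measure is Borel measurability.\<close>

lemma surface_measurable:
  fixes \<Omega> :: "(real^'s::finite) set"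
  assumes "f \<in> borel \<rightarrow>\<^sub>M N"
  shows "f \<in> surface_measure \<Omega> \<rightarrow>\<^sub>M N"
proof -
  have "sets (hausdorff_measure d) = sets (borel :: (real^'s) measure)" for d
    using sets.sigma_sets_eq[of "borel :: (real^'s) measure"] by (simp add: hausdorff_measure_def)
  then have "f \<in> hausdorff_measure d \<rightarrow>\<^sub>M N" for d
    using assms measurable_cong_sets by blast
  then show ?thesis unfolding surface_measure_def by (rule measurable_restrict_space1)
qed

lemma continuous_components:
  fixes f :: "'a::topological_space \<Rightarrow> real^'s::finite"
  assumes "\<And>i. continuous_on S (\<lambda>x. f x $ i)"
  shows "continuous_on S f"
proof -
  have "continuous_on S (\<lambda>x. \<chi> i. f x $ i)" by (intro continuous_on_vec_lambda assms)
  then show ?thesis by simp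
qed

lemma smooth_fields_measurable:
  assumes "\<phi> \<in> smooth_fields \<Omega>"
  shows "\<phi> \<in> borel_measurable (surface_measure \<Omega>)"
  using assms by (intro surface_measurable borel_measurable_continuous_onI continuous_components smooth_continuous)
    (auto simp: smooth_fields_def)

lemma surface_sq_combination:
  assumes "f \<in> borel_measurable (surface_measure \<Omega>)" "g \<in> borel_measurable (surface_measure \<Omega>)"
  shows "surface_sq \<Omega> (a *\<^sub>R f + b *\<^sub>R g) \<le> ennreal (2 * a\<^sup>2) * surface_sq \<Omega> f + ennreal (2 * b\<^sup>2) * surface_sq \<Omega> g"
proof -
  note [measurable] = assms
  have "(norm (a *\<^sub>R f x + b *\<^sub>R g x))\<^sup>2 \<le> 2 * a\<^sup>2 * (norm (f x))\<^sup>2 + 2 * b\<^sup>2 * (norm (g x))\<^sup>2" for x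
  proof -
    have "(norm (a *\<^sub>R f x + b *\<^sub>R g x))\<^sup>2 \<le> (\<bar>a\<bar> * norm (f x) + \<bar>b\<bar> * norm (g x))\<^sup>2"
      by (rule power_mono) (use norm_triangle_ineq[of "a *\<^sub>R f x" "b *\<^sub>R g x"] in auto)
    also have "\<dots> \<le> 2 * (\<bar>a\<bar> * norm (f x))\<^sup>2 + 2 * (\<bar>b\<bar> * norm (g x))\<^sup>2"
      using sum_squares_bound[of "\<bar>a\<bar> * norm (f x)" "\<bar>b\<bar> * norm (g x)"] by (simp add: power2_sum)
    finally show ?thesis by (simp add: power_mult_distrib)
  qed
  then have "surface_sq \<Omega> (a *\<^sub>R f + b *\<^sub>R g)
      \<le> (\<integral>\<^sup>+ x. ennreal (2 * a\<^sup>2) * ennreal ((norm (f x))\<^sup>2) + ennreal (2 * b\<^sup>2) * ennreal ((norm (g x))\<^sup>2) \<partial>surface_measure \<Omega>)"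
    unfolding surface_sq_def
    by (intro nn_integral_mono) (simp add: ennreal_mult[symmetric] ennreal_plus[symmetric] del: ennreal_plus)
  also have "\<dots> = ennreal (2 * a\<^sup>2) * surface_sq \<Omega> f + ennreal (2 * b\<^sup>2) * surface_sq \<Omega> g"
    unfolding surface_sq_def by (subst nn_integral_add) (auto simp: nn_integral_cmult)
  finally show ?thesis .
qed

lemma has_trace_iff:
  "has_trace \<Omega> v g \<longleftrightarrow> g \<in> borel_measurable (surface_measure \<Omega>) \<and>
     (\<exists>\<phi>::nat \<Rightarrow> _. (\<forall>n. \<phi> n \<in> smooth_fields \<Omega>) \<and>
        (\<lambda>n. H1_norm \<Omega> (\<phi> n - v)) \<longlonglongrightarrow> 0 \<and> (\<lambda>n. surface_sq \<Omega> (\<phi> n - g)) \<longlonglongrightarrow> 0)"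
  by (simp add: has_trace_def surface_sq_def field_ops)

lemma ennreal_tendsto_0_bound:
  fixes f g h :: "nat \<Rightarrow> ennreal"
  assumes "\<And>n. h n \<le> ennreal a * f n + ennreal b * g n" "f \<longlonglongrightarrow> 0" "g \<longlonglongrightarrow> 0"
  shows "h \<longlonglongrightarrow> 0"
proof -
  have "(\<lambda>n. ennreal a * f n + ennreal b * g n) \<longlonglongrightarrow> ennreal a * 0 + ennreal b * 0"
    using assms by (intro tendsto_add ennreal_tendsto_cmult) auto
  then show ?thesis
    using assms(1) by (intro tendsto_sandwich[of "\<lambda>_. 0" h sequentially "\<lambda>n. ennreal a * f n + ennreal b * g n"]) auto
qed

section \<open>Fields with vanishing trace: linearity and closedness\<close>

context bounded_open
begin

lemma smooth_fields_H1: "\<phi> \<in> smooth_fields \<Omega> \<Longrightarrow> \<phi> \<in> H1 \<Omega>"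
  by (simp add: smooth_fields_def)

lemma smooth_fields_combination:
  "\<phi> \<in> smooth_fields \<Omega> \<Longrightarrow> \<psi> \<in> smooth_fields \<Omega> \<Longrightarrow> a *\<^sub>R \<phi> + b *\<^sub>R \<psi> \<in> smooth_fields \<Omega>"
  using H1_combination(1) by (auto simp: smooth_fields_def smooth_linear)

lemma has_trace_combination:
  assumes "u \<in> H1 \<Omega>" "v \<in> H1 \<Omega>" "has_trace \<Omega> u g" "has_trace \<Omega> v h"
  shows "has_trace \<Omega> (a *\<^sub>R u + b *\<^sub>R v) (a *\<^sub>R g + b *\<^sub>R h)"
proof -
  obtain \<phi> where \<phi>: "\<And>n. \<phi> n \<in> smooth_fields \<Omega>" "(\<lambda>n. H1_norm \<Omega> (\<phi> n - u)) \<longlonglongrightarrow> 0"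
      "(\<lambda>n. surface_sq \<Omega> (\<phi> n - g)) \<longlonglongrightarrow> 0"
    using assms(3) unfolding has_trace_iff by blast
  obtain \<psi> where \<psi>: "\<And>n. \<psi> n \<in> smooth_fields \<Omega>" "(\<lambda>n. H1_norm \<Omega> (\<psi> n - v)) \<longlonglongrightarrow> 0"
      "(\<lambda>n. surface_sq \<Omega> (\<psi> n - h)) \<longlonglongrightarrow> 0"
    using assms(4) unfolding has_trace_iff by blast
  have m: "g \<in> borel_measurable (surface_measure \<Omega>)" "h \<in> borel_measurable (surface_measure \<Omega>)"
    using assms(3,4) by (auto simp: has_trace_def)
  have eq: "a *\<^sub>R \<phi> n + b *\<^sub>R \<psi> n - (a *\<^sub>R u + b *\<^sub>R v) = a *\<^sub>R (\<phi> n - u) + b *\<^sub>R (\<psi> n - v)" for n u v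
    by (simp add: scaleR_diff_right)
  have meas: "\<phi> n - g \<in> borel_measurable (surface_measure \<Omega>)" "\<psi> n - h \<in> borel_measurable (surface_measure \<Omega>)" for n
    using smooth_fields_measurable[OF \<phi>(1)] smooth_fields_measurable[OF \<psi>(1)] m
    by (simp_all add: fun_diff_def)
  have "(\<lambda>n. H1_norm \<Omega> (a *\<^sub>R \<phi> n + b *\<^sub>R \<psi> n - (a *\<^sub>R u + b *\<^sub>R v))) \<longlonglongrightarrow> 0"
  proof (rule Lim_null_comparison)
    have "(\<lambda>n. \<bar>a\<bar> * H1_norm \<Omega> (\<phi> n - u) + \<bar>b\<bar> * H1_norm \<Omega> (\<psi> n - v)) \<longlonglongrightarrow> \<bar>a\<bar> * 0 + \<bar>b\<bar> * 0"
      by (intro tendsto_intros \<phi> \<psi>)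
    then show "(\<lambda>n. \<bar>a\<bar> * H1_norm \<Omega> (\<phi> n - u) + \<bar>b\<bar> * H1_norm \<Omega> (\<psi> n - v)) \<longlonglongrightarrow> 0" by simp
    have "norm (H1_norm \<Omega> (a *\<^sub>R (\<phi> n - u) + b *\<^sub>R (\<psi> n - v)))
        \<le> \<bar>a\<bar> * H1_norm \<Omega> (\<phi> n - u) + \<bar>b\<bar> * H1_norm \<Omega> (\<psi> n - v)" for n
    proof -
      have d: "\<phi> n - u \<in> H1 \<Omega>" "\<psi> n - v \<in> H1 \<Omega>"
        using \<phi>(1)[of n] \<psi>(1)[of n] smooth_fields_H1 assms h1.mem(3) by auto
      then show ?thesis
        using h1.norm_triangle[OF h1.mem(4)[OF d(1), of a] h1.mem(4)[OF d(2), of b]]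
          h1.norm_scale[OF d(1)] h1.norm_scale[OF d(2)]
          h1.norm_nonneg[OF h1.mem(2)[OF h1.mem(4)[OF d(1), of a] h1.mem(4)[OF d(2), of b]]]
        by (simp add: H1_norm_ipnorm)
    qed
    then show "\<forall>\<^sub>F n in sequentially. norm (H1_norm \<Omega> (a *\<^sub>R \<phi> n + b *\<^sub>R \<psi> n - (a *\<^sub>R u + b *\<^sub>R v)))
        \<le> \<bar>a\<bar> * H1_norm \<Omega> (\<phi> n - u) + \<bar>b\<bar> * H1_norm \<Omega> (\<psi> n - v)"
      unfolding eq by simp
  qed
  moreover have "(\<lambda>n. surface_sq \<Omega> (a *\<^sub>R \<phi> n + b *\<^sub>R \<psi> n - (a *\<^sub>R g + b *\<^sub>R h))) \<longlonglongrightarrow> 0"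
    unfolding eq by (rule ennreal_tendsto_0_bound[OF surface_sq_combination[OF meas] \<phi>(3) \<psi>(3)])
  moreover have "a *\<^sub>R g + b *\<^sub>R h \<in> borel_measurable (surface_measure \<Omega>)"
    using m by (simp add: plus_fun_def scaleR_fun_def)
  moreover have "a *\<^sub>R \<phi> n + b *\<^sub>R \<psi> n \<in> smooth_fields \<Omega>" for n
    by (rule smooth_fields_combination[OF \<phi>(1) \<psi>(1)])
  ultimately show ?thesis unfolding has_trace_iff
    by (intro conjI exI[of _ "\<lambda>n. a *\<^sub>R \<phi> n + b *\<^sub>R \<psi> n"]) auto
qed

lemma H1_zero_on_subset: "H1_zero_on \<Omega> S \<subseteq> H1 \<Omega>"
  by (auto simp: H1_zero_on_def)

lemma subspace_H1_zero_on: "subspace (H1_zero_on \<Omega> S)"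
proof -
  have comb: "a *\<^sub>R u + b *\<^sub>R v \<in> H1_zero_on \<Omega> S" if uv: "u \<in> H1_zero_on \<Omega> S" "v \<in> H1_zero_on \<Omega> S" for a b u v
  proof -
    have H: "u \<in> H1 \<Omega>" "v \<in> H1 \<Omega>" using uv H1_zero_on_subset by auto
    obtain g h where g: "has_trace \<Omega> u g" "AE x in surface_measure \<Omega>. x \<in> S \<longrightarrow> g x = 0"
      and h: "has_trace \<Omega> v h" "AE x in surface_measure \<Omega>. x \<in> S \<longrightarrow> h x = 0"
      using uv unfolding H1_zero_on_def vanishes_on_def by blast
    have "AE x in surface_measure \<Omega>. x \<in> S \<longrightarrow> (a *\<^sub>R g + b *\<^sub>R h) x = 0"
      using g(2) h(2) by eventually_elim simp
    then show ?thesis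
      using has_trace_combination[OF H g(1) h(1)] H1_combination(1)[OF H]
      unfolding H1_zero_on_def vanishes_on_def by blast
  qed
  have "has_trace \<Omega> 0 0"
  proof -
    have "(0 :: 's field) \<in> smooth_fields \<Omega>"
      using h1.mem(1) smooth_const[of 0] by (simp add: smooth_fields_def)
    moreover have "surface_sq \<Omega> 0 = 0" by (simp add: surface_sq_def)
    moreover have "(0 :: 's field) \<in> borel_measurable (surface_measure \<Omega>)" by (simp add: zero_fun_def)
    ultimately show ?thesis unfolding has_trace_iff
      using h1.norm_zero by (intro conjI exI[of _ "\<lambda>_. 0"]) (auto simp: H1_norm_ipnorm)
  qed
  then have "0 \<in> H1_zero_on \<Omega> S"
    using h1.mem(1) unfolding H1_zero_on_def vanishes_on_def by (auto intro!: exI[of _ 0])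
  moreover have "u + v \<in> H1_zero_on \<Omega> S" if "u \<in> H1_zero_on \<Omega> S" "v \<in> H1_zero_on \<Omega> S" for u v
    using comb[OF that, of 1 1] by simp
  moreover have "c *\<^sub>R u \<in> H1_zero_on \<Omega> S" if "u \<in> H1_zero_on \<Omega> S" for c u
    using comb[OF that that, of c 0] by simp
  ultimately show ?thesis by (simp add: subspace_def)
qed

text \<open>The trace inequality for differences makes the boundary values a Cauchy sequence in the
  surface L2. The sequence is given rather than chosen, because \<open>H1_zero_on_complete\<close>
  needs a limit along its own diagonal sequence.\<close>

lemma trace_exists:
  assumes tr: "trace_theorem \<Omega>" and \<phi>: "\<And>n::nat. \<phi> n \<in> smooth_fields \<Omega>"
    and v: "v \<in> H1 \<Omega>" "(\<lambda>n. H1_norm \<Omega> (\<phi> n - v)) \<longlonglongrightarrow> 0"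
  obtains g where "g \<in> borel_measurable (surface_measure \<Omega>)" "(\<lambda>n. surface_sq \<Omega> (\<phi> n - g)) \<longlonglongrightarrow> 0"
proof -
  obtain K where K: "\<And>\<phi>. \<phi> \<in> smooth_fields \<Omega> \<Longrightarrow> surface_sq \<Omega> \<phi> \<le> ennreal (K * (H1_norm \<Omega> \<phi>)\<^sup>2)"
    using tr unfolding trace_theorem_def surface_sq_def by blast
  have "\<exists>L. \<forall>m\<ge>L. \<forall>n\<ge>L. (\<integral>\<^sup>+ x. ennreal ((norm (\<phi> m x - \<phi> n x))\<^sup>2) \<partial>surface_measure \<Omega>) \<le> ennreal e"
    if e: "e > 0" for e
  proof -
    \<comment> \<open>Chosen so that (2 r)^2 = e / (|K| + 1); the denominator stays positive
      whatever the sign of \<open>K\<close>.\<close>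
    define r where "r = sqrt (e / (\<bar>K\<bar> + 1)) / 2"
    have "r > 0" using e by (simp add: r_def)
    then have "\<forall>\<^sub>F n in sequentially. H1_norm \<Omega> (\<phi> n - v) < r" using order_tendstoD(2)[OF v(2)] by blast
    then obtain L where L: "\<And>n. n \<ge> L \<Longrightarrow> H1_norm \<Omega> (\<phi> n - v) < r" by (auto simp: eventually_sequentially)
    have "(\<integral>\<^sup>+ x. ennreal ((norm (\<phi> m x - \<phi> n x))\<^sup>2) \<partial>surface_measure \<Omega>) \<le> ennreal e" if "m \<ge> L" "n \<ge> L" for m n
    proof -
      have H: "\<phi> m \<in> H1 \<Omega>" "\<phi> n \<in> H1 \<Omega>" using \<phi> smooth_fields_H1 by auto
      have "H1_norm \<Omega> (\<phi> m - \<phi> n) \<le> H1_norm \<Omega> (\<phi> m - v) + H1_norm \<Omega> (\<phi> n - v)"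
        using h1.norm_triangle_via[OF H(1) v(1) H(2)] h1.norm_minus_commute[OF v(1) H(2)]
        by (simp add: H1_norm_ipnorm)
      also have "\<dots> \<le> 2 * r" using L[OF that(1)] L[OF that(2)] by simp
      finally have "(H1_norm \<Omega> (\<phi> m - \<phi> n))\<^sup>2 \<le> (2 * r)\<^sup>2"
        using h1.norm_nonneg[OF h1.mem(3)[OF H]] by (intro power_mono) (auto simp: H1_norm_ipnorm)
      also have "\<dots> = e / (\<bar>K\<bar> + 1)" using e by (simp add: r_def)
      finally have "K * (H1_norm \<Omega> (\<phi> m - \<phi> n))\<^sup>2 \<le> (\<bar>K\<bar> + 1) * (e / (\<bar>K\<bar> + 1))"
        by (intro mult_mono) auto
      then have "K * (H1_norm \<Omega> (\<phi> m - \<phi> n))\<^sup>2 \<le> e" by simp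
      moreover have "\<phi> m - \<phi> n \<in> smooth_fields \<Omega>"
        using smooth_fields_combination[OF \<phi> \<phi>, of 1 m "-1" n] by simp
      ultimately have "surface_sq \<Omega> (\<phi> m - \<phi> n) \<le> ennreal e"
        using K order_trans ennreal_leI by blast
      then show ?thesis by (simp add: surface_sq_def)
    qed
    then show ?thesis by blast
  qed
  then obtain g where "g \<in> borel_measurable (surface_measure \<Omega>)"
      "(\<lambda>n. \<integral>\<^sup>+ x. ennreal ((norm (\<phi> n x - g x))\<^sup>2) \<partial>surface_measure \<Omega>) \<longlonglongrightarrow> 0"
    using riesz_fischer[of \<phi> "surface_measure \<Omega>"] smooth_fields_measurable[OF \<phi>] by blast
  then show thesis using that by (simp add: surface_sq_def)
qed

text \<open>Diagonal argument: for each s n pick a smooth field and a trace g n vanishing on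
  \<open>S\<close>, within 1/(n+1) of each other on the boundary, the field equally close to s n in
  H1. The smooth fields converge to the limit v and their boundary values to a trace t of v, which
  is thereby also the limit of the g n.\<close>

lemma H1_zero_on_complete:
  assumes tr: "trace_theorem \<Omega>" and S: "S \<in> sets borel"
  shows "complete_form (H1_zero_on \<Omega> S) h1ip"
  unfolding complete_form_def
proof (intro allI impI, elim conjE)
  fix s :: "nat \<Rightarrow> 's field"
  assume s: "\<forall>n. s n \<in> H1_zero_on \<Omega> S"
    and c: "\<forall>e>0. \<exists>L. \<forall>m\<ge>L. \<forall>n\<ge>L. ipnorm h1ip (s m - s n) < e"
  let ?S = "surface_measure \<Omega>"
  have sH: "s n \<in> H1 \<Omega>" for n using s H1_zero_on_subset by blast
  obtain v where v: "v \<in> H1 \<Omega>" "(\<lambda>n. ipnorm h1ip (s n - v)) \<longlonglongrightarrow> 0"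
    using H1_complete[unfolded complete_form_def, rule_format, of s] sH c by blast
  define P where "P n \<phi> g \<longleftrightarrow> \<phi> \<in> smooth_fields \<Omega> \<and> H1_norm \<Omega> (\<phi> - s n) < 1 / real (Suc n) \<and>
      g \<in> borel_measurable ?S \<and> surface_sq \<Omega> (\<phi> - g) < ennreal (1 / real (Suc n)) \<and>
      (AE x in ?S. x \<in> S \<longrightarrow> g x = 0)" for n \<phi> g
  have "\<exists>\<phi> g. P n \<phi> g" for n
  proof -
    obtain g where g: "has_trace \<Omega> (s n) g" "AE x in ?S. x \<in> S \<longrightarrow> g x = 0"
      using s unfolding H1_zero_on_def vanishes_on_def by blast
    then obtain \<phi> where \<phi>: "\<And>n. \<phi> n \<in> smooth_fields \<Omega>" "(\<lambda>k. H1_norm \<Omega> (\<phi> k - s n)) \<longlonglongrightarrow> 0"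
        "(\<lambda>k. surface_sq \<Omega> (\<phi> k - g)) \<longlonglongrightarrow> 0"
      unfolding has_trace_iff by blast
    have "\<forall>\<^sub>F k in sequentially. H1_norm \<Omega> (\<phi> k - s n) < 1 / real (Suc n)"
      "\<forall>\<^sub>F k in sequentially. surface_sq \<Omega> (\<phi> k - g) < ennreal (1 / real (Suc n))"
      using order_tendstoD(2)[OF \<phi>(2), of "1 / real (Suc n)"]
        order_tendstoD(2)[OF \<phi>(3), of "ennreal (1 / real (Suc n))"] by (auto simp: ennreal_less_zero_iff)
    then have "\<forall>\<^sub>F k in sequentially. H1_norm \<Omega> (\<phi> k - s n) < 1 / real (Suc n) \<and>
      surface_sq \<Omega> (\<phi> k - g) < ennreal (1 / real (Suc n))" by (rule eventually_conj)
    then obtain k where "H1_norm \<Omega> (\<phi> k - s n) < 1 / real (Suc n)"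
      "surface_sq \<Omega> (\<phi> k - g) < ennreal (1 / real (Suc n))"
      using eventually_happens'[OF sequentially_bot] by blast
    then show ?thesis using \<phi>(1) g unfolding has_trace_iff P_def by blast
  qed
  then obtain \<phi> g where "\<And>n. P n (\<phi> n) (g n)" by metis
  then have \<phi>: "\<And>n. \<phi> n \<in> smooth_fields \<Omega>" "\<And>n. H1_norm \<Omega> (\<phi> n - s n) < 1 / real (Suc n)"
    and g: "\<And>n. g n \<in> borel_measurable ?S" "\<And>n. surface_sq \<Omega> (\<phi> n - g n) < ennreal (1 / real (Suc n))"
      "\<And>n. AE x in ?S. x \<in> S \<longrightarrow> g n x = 0"
    unfolding P_def by blast+
  have conv: "(\<lambda>n. H1_norm \<Omega> (\<phi> n - v)) \<longlonglongrightarrow> 0"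
  proof (rule Lim_null_comparison)
    have "(\<lambda>n. 1 / real (Suc n) + ipnorm h1ip (s n - v)) \<longlonglongrightarrow> 0 + 0"
      by (intro tendsto_add v LIMSEQ_Suc lim_1_over_n)
    then show "(\<lambda>n. 1 / real (Suc n) + ipnorm h1ip (s n - v)) \<longlonglongrightarrow> 0" by simp
    have "norm (H1_norm \<Omega> (\<phi> n - v)) \<le> 1 / real (Suc n) + ipnorm h1ip (s n - v)" for n
    proof -
      have H: "\<phi> n \<in> H1 \<Omega>" using \<phi> smooth_fields_H1 by auto
      show ?thesis
        using h1.norm_triangle_via[OF H sH[of n] v(1)] \<phi>(2)[of n] h1.norm_nonneg[OF h1.mem(3)[OF H v(1)]]
        by (simp add: H1_norm_ipnorm)
    qed
    then show "\<forall>\<^sub>F n in sequentially. norm (H1_norm \<Omega> (\<phi> n - v)) \<le> 1 / real (Suc n) + ipnorm h1ip (s n - v)"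
      by simp
  qed
  obtain t where t: "t \<in> borel_measurable ?S" "(\<lambda>n. surface_sq \<Omega> (\<phi> n - t)) \<longlonglongrightarrow> 0"
    using trace_exists[OF tr \<phi>(1) v(1) conv] by blast
  have Sm: "Measurable.pred ?S (\<lambda>x. x \<in> S)"
    by (intro surface_measurable) (use S in measurable)
  \<comment> \<open>On \<open>S\<close> the field g n vanishes, so t is the difference of \<phi> n -
    g n and \<phi> n - t; off \<open>S\<close> the integrand is zero.\<close>
  have bound: "(\<integral>\<^sup>+ x. indicator S x * ennreal ((norm (t x))\<^sup>2) \<partial>?S)
      \<le> ennreal 2 * surface_sq \<Omega> (\<phi> n - t) + ennreal 2 * surface_sq \<Omega> (\<phi> n - g n)" for n
  proof -
    have [measurable]: "\<phi> n \<in> borel_measurable ?S" "t \<in> borel_measurable ?S" "g n \<in> borel_measurable ?S"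
      using smooth_fields_measurable[OF \<phi>(1)] t g by auto
    have "(\<integral>\<^sup>+ x. indicator S x * ennreal ((norm (t x))\<^sup>2) \<partial>?S)
        \<le> (\<integral>\<^sup>+ x. ennreal 2 * ennreal ((norm (\<phi> n x - t x))\<^sup>2) + ennreal 2 * ennreal ((norm (\<phi> n x - g n x))\<^sup>2) \<partial>?S)"
    proof (rule nn_integral_mono_AE, use g(3)[of n] in eventually_elim)
      case (elim x)
      show ?case
      proof (cases "x \<in> S")
        case True
        then have g0: "g n x = 0" using elim by simp
        have "(norm (t x))\<^sup>2 \<le> (norm (\<phi> n x - t x) + norm (\<phi> n x))\<^sup>2"
          using norm_triangle_ineq4[of "\<phi> n x" "\<phi> n x - t x"] by (intro power_mono) auto
        also have "\<dots> \<le> 2 * (norm (\<phi> n x - t x))\<^sup>2 + 2 * (norm (\<phi> n x - g n x))\<^sup>2"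
          using sum_squares_bound[of "norm (\<phi> n x - t x)" "norm (\<phi> n x)"] by (simp add: power2_sum g0)
        finally have "ennreal ((norm (t x))\<^sup>2)
            \<le> ennreal (2 * (norm (\<phi> n x - t x))\<^sup>2 + 2 * (norm (\<phi> n x - g n x))\<^sup>2)"
          by (rule ennreal_leI)
        also have "\<dots> = ennreal 2 * ennreal ((norm (\<phi> n x - t x))\<^sup>2) + ennreal 2 * ennreal ((norm (\<phi> n x - g n x))\<^sup>2)"
          by (simp add: ennreal_mult)
        finally show ?thesis using True by simp
      qed simp
    qed
    also have "\<dots> = ennreal 2 * surface_sq \<Omega> (\<phi> n - t) + ennreal 2 * surface_sq \<Omega> (\<phi> n - g n)"
      unfolding surface_sq_def by (subst nn_integral_add) (auto simp: nn_integral_cmult)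
    finally show ?thesis .
  qed
  have gs: "(\<lambda>n. surface_sq \<Omega> (\<phi> n - g n)) \<longlonglongrightarrow> 0"
  proof (rule tendsto_sandwich[OF _ _ tendsto_const])
    have "(\<lambda>n. ennreal (1 / real (Suc n))) \<longlonglongrightarrow> ennreal 0"
      by (intro tendsto_ennrealI LIMSEQ_Suc lim_1_over_n)
    then show "(\<lambda>n. ennreal (1 / real (Suc n))) \<longlonglongrightarrow> 0" by simp
    show "\<forall>\<^sub>F n in sequentially. surface_sq \<Omega> (\<phi> n - g n) \<le> ennreal (1 / real (Suc n))"
      using g(2) less_imp_le by (intro always_eventually) blast
  qed simp
  have "(\<lambda>n::nat. (\<integral>\<^sup>+ x. indicator S x * ennreal ((norm (t x))\<^sup>2) \<partial>?S)) \<longlonglongrightarrow> 0"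
    by (rule ennreal_tendsto_0_bound[OF bound t(2) gs])
  then have "(\<integral>\<^sup>+ x. indicator S x * ennreal ((norm (t x))\<^sup>2) \<partial>?S) = 0" by (simp add: LIMSEQ_const_iff)
  then have "AE x in ?S. indicator S x * ennreal ((norm (t x))\<^sup>2) = 0"
    using Sm t(1) by (subst (asm) nn_integral_0_iff_AE) (auto intro!: borel_measurable_times_ennreal borel_measurable_indicator')
  then have "AE x in ?S. x \<in> S \<longrightarrow> t x = 0"
    by eventually_elim (auto simp: indicator_def split: if_splits)
  then have "v \<in> H1_zero_on \<Omega> S"
    using v(1) t conv \<phi>(1) unfolding H1_zero_on_def vanishes_on_def has_trace_iff by blast
  then show "\<exists>l\<in>H1_zero_on \<Omega> S. (\<lambda>n. ipnorm h1ip (s n - l)) \<longlonglongrightarrow> 0" using v(2) by blast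
qed

end

section \<open>Elastic energy\<close>

lemma norm_vec_le_sum: "norm (x :: 'b::real_normed_vector ^ 's::finite) \<le> (\<Sum>i\<in>UNIV. norm (x $ i))"
  unfolding norm_vec_def by (rule L2_set_le_sum) auto

lemma sum_swap_pairs:
  "(\<Sum>i\<in>I. \<Sum>j\<in>J. \<Sum>k\<in>K. \<Sum>l\<in>L. g i j k l) = (\<Sum>k\<in>K. \<Sum>l\<in>L. \<Sum>i\<in>I. \<Sum>j\<in>J. g i j k l)"
proof -
  have "(\<Sum>i\<in>I. \<Sum>j\<in>J. \<Sum>k\<in>K. \<Sum>l\<in>L. g i j k l) = (\<Sum>i\<in>I. \<Sum>k\<in>K. \<Sum>l\<in>L. \<Sum>j\<in>J. g i j k l)"
    by (intro sum.cong refl) (subst sum.swap, intro sum.cong refl, rule sum.swap)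
  also have "\<dots> = (\<Sum>k\<in>K. \<Sum>l\<in>L. \<Sum>i\<in>I. \<Sum>j\<in>J. g i j k l)"
    by (subst sum.swap, intro sum.cong refl) (rule sum.swap)
  finally show ?thesis .
qed

lemma inner_contract:
  "e \<bullet> contract T f = (\<Sum>i\<in>UNIV. \<Sum>j\<in>UNIV. \<Sum>k\<in>UNIV. \<Sum>l\<in>UNIV. e $ i $ j * T $ i $ j $ k $ l * f $ k $ l)"
  by (simp add: inner_vec_def contract_def sum_distrib_left mult.assoc)

lemma contract_sym:
  assumes "tensor_symmetric T"
  shows "e \<bullet> contract T f = f \<bullet> contract T e"
proof -
  have T: "T $ i $ j $ k $ l = T $ k $ l $ i $ j" for i j k l
    using assms by (simp add: tensor_symmetric_def)
  have "f \<bullet> contract T e = (\<Sum>k\<in>UNIV. \<Sum>l\<in>UNIV. \<Sum>i\<in>UNIV. \<Sum>j\<in>UNIV. f $ i $ j * T $ i $ j $ k $ l * e $ k $ l)"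
    unfolding inner_contract by (rule sum_swap_pairs)
  also have "\<dots> = e \<bullet> contract T f"
    unfolding inner_contract by (intro sum.cong refl) (subst T, simp)
  finally show ?thesis by simp
qed

text \<open>Counting entries: n^2 of them, each a sum of n^2 products. The constant is crude, but it
  depends on the dimension alone.\<close>

lemma contract_norm:
  fixes T :: "'s::finite tensor4"
  shows "norm (contract T e) \<le> real (CARD('s)) ^ 4 * norm T * norm e"
proof -
  have T: "\<bar>T $ i $ j $ k $ l\<bar> \<le> norm T" for i j k l
    using Finite_Cartesian_Product.norm_nth_le[of "T $ i $ j $ k" l] Finite_Cartesian_Product.norm_nth_le[of "T $ i $ j" k]
      Finite_Cartesian_Product.norm_nth_le[of "T $ i" j] Finite_Cartesian_Product.norm_nth_le[of T i] by simp
  have e: "\<bar>e $ k $ l\<bar> \<le> norm e" for k l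
    using Finite_Cartesian_Product.norm_nth_le[of "e $ k" l] Finite_Cartesian_Product.norm_nth_le[of e k] by simp
  have comp: "\<bar>contract T e $ i $ j\<bar> \<le> real (CARD('s)) ^ 2 * (norm T * norm e)" for i j
  proof -
    have "\<bar>contract T e $ i $ j\<bar> \<le> (\<Sum>k\<in>UNIV. \<Sum>l\<in>UNIV. \<bar>T $ i $ j $ k $ l * e $ k $ l\<bar>)"
      unfolding contract_def by (auto intro!: order_trans[OF sum_abs] sum_mono)
    also have "\<dots> \<le> (\<Sum>k::'s\<in>UNIV. \<Sum>l::'s\<in>UNIV. norm T * norm e)"
      using T e by (intro sum_mono) (auto simp: abs_mult intro!: mult_mono)
    finally show ?thesis by (simp add: power2_eq_square mult.assoc)
  qed
  have "norm (contract T e) \<le> (\<Sum>i\<in>UNIV. norm (contract T e $ i))" by (rule norm_vec_le_sum)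
  also have "\<dots> \<le> (\<Sum>i\<in>UNIV. \<Sum>j\<in>UNIV. norm (contract T e $ i $ j))" by (intro sum_mono norm_vec_le_sum)
  also have "\<dots> \<le> (\<Sum>i::'s\<in>UNIV. \<Sum>j::'s\<in>UNIV. real (CARD('s)) ^ 2 * (norm T * norm e))"
    using comp by (intro sum_mono) simp
  also have "\<dots> = real (CARD('s)) ^ 4 * norm T * norm e"
    by (simp add: power4_eq_xxxx power2_eq_square mult.assoc)
  finally show ?thesis .
qed

lemma contract_measurable:
  fixes T :: "'a \<Rightarrow> 's::finite tensor4"
  assumes "T \<in> borel_measurable M" "F \<in> borel_measurable M"
  shows "(\<lambda>x. contract (T x) (F x)) \<in> borel_measurable M"
proof -
  have "continuous_on UNIV (\<lambda>p. contract (fst p) (snd p) :: real^'s^'s)"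
    unfolding contract_def by (intro continuous_on_vec_lambda continuous_intros)
  from borel_measurable_continuous_on[OF this borel_measurable_Pair[OF assms]] show ?thesis by simp
qed

lemma norm_transpose: "norm (transpose (A :: real^'s::finite^'s)) = norm A"
proof -
  have "transpose A \<bullet> transpose A = A \<bullet> A"
    by (simp add: inner_vec_def transpose_def) (rule sum.swap)
  then show ?thesis by (simp add: norm_eq_sqrt_inner)
qed

lemma norm_strain_le: "norm (strain \<Omega> v x) \<le> norm (weak_grad \<Omega> v x)"
  using norm_triangle_ineq[of "weak_grad \<Omega> v x" "transpose (weak_grad \<Omega> v x)"]
  by (simp add: strain_def norm_transpose)

lemma transpose_strain: "transpose (strain \<Omega> v x) = strain \<Omega> v x"
  by (simp add: strain_def transpose_def vec_eq_iff)

lemma Linf_bound: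
  assumes "f \<in> Linf M"
  obtains K where "0 \<le> K" "AE x in M. norm (f x) \<le> K"
proof -
  obtain K where "AE x in M. norm (f x) \<le> K" using assms by (auto simp: Linf_def)
  then have "AE x in M. norm (f x) \<le> \<bar>K\<bar>" by eventually_elim simp
  then show thesis using that[of "\<bar>K\<bar>"] by simp
qed

section \<open>The energy inner product: norm equivalence, coercivity of the stiffness, compactness
  of the mass form\<close>

locale elastic_body = bounded_open \<Omega> for \<Omega> :: "(real^'s::finite) set" +
  fixes C :: "real^'s \<Rightarrow> 's tensor4" and \<rho> :: "real^'s \<Rightarrow> real" and c0 \<rho>0 \<omega> :: real
  assumes regular: "regular_boundary \<Omega>"
    and elastic: "elasticity_tensor \<Omega> c0 C" and c0_pos: "0 < c0"
    and \<rho>_Linf: "\<rho> \<in> Linf (lebesgue_on \<Omega>)" and \<rho>0_pos: "0 < \<rho>0"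
    and \<rho>_low: "AE x in lebesgue_on \<Omega>. \<rho> x \<ge> \<rho>0" and \<omega>_pos: "0 < \<omega>"
begin

abbreviation "stiff \<equiv> stiffness_form \<Omega> C"
abbreviation "mass \<equiv> mass_form \<Omega> \<rho>"

definition energy :: "'s field \<Rightarrow> 's field \<Rightarrow> real" where
  "energy u v = stiff u v + \<omega>\<^sup>2 * mass u v"

lemma strain_L2:
  assumes "v \<in> H1 \<Omega>"
  shows "strain \<Omega> v \<in> L2 M"
proof (rule L2_bound[OF weak_grad(1)[OF assms], where c = 1])
  have "continuous_on UNIV (\<lambda>A :: real^'s^'s. (1/2) *\<^sub>R (A + transpose A))"
    unfolding transpose_def by (intro continuous_on_vec_lambda continuous_intros)
  from borel_measurable_continuous_on[OF this L2_measurable[OF weak_grad(1)[OF assms]]]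
  show "strain \<Omega> v \<in> borel_measurable M" by (simp add: strain_def[abs_def])
qed (simp add: norm_strain_le)

lemma strain_combination:
  assumes "u \<in> H1 \<Omega>" "v \<in> H1 \<Omega>"
  shows "AE x in M. strain \<Omega> (a *\<^sub>R u + b *\<^sub>R v) x = (a *\<^sub>R strain \<Omega> u + b *\<^sub>R strain \<Omega> v) x"
  using H1_combination(2)[OF assms, of a b]
  by eventually_elim (simp add: strain_def transpose_def vec_eq_iff algebra_simps)

lemma contract_L2:
  assumes "F \<in> L2 M"
  shows "(\<lambda>x. contract (C x) (F x)) \<in> L2 M"
proof -
  have CL: "C \<in> Linf M" using elastic by (simp add: elasticity_tensor_def)
  then obtain K where K: "0 \<le> K" "AE x in M. norm (C x) \<le> K" using Linf_bound by blast
  show ?thesis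
  proof (rule L2_bound[OF assms contract_measurable])
    show "C \<in> borel_measurable M" using CL by (simp add: Linf_def)
    show "AE x in M. norm (contract (C x) (F x)) \<le> (real (CARD('s)) ^ 4 * K) * norm (F x)"
      using K(2)
    proof eventually_elim
      case (elim x)
      have "real (CARD('s)) ^ 4 * norm (C x) * norm (F x) \<le> real (CARD('s)) ^ 4 * K * norm (F x)"
        using elim by (intro mult_right_mono mult_left_mono) auto
      then show ?case using contract_norm[of "C x" "F x"] by linarith
    qed
  qed (rule L2_measurable[OF assms])
qed

lemma stiff_l2ip: "stiff u v = l2ip M (strain \<Omega> u) (\<lambda>x. contract (C x) (strain \<Omega> v x))"
  by (simp add: stiffness_form_def l2ip_def)

lemma stiff_integrable:
  "u \<in> H1 \<Omega> \<Longrightarrow> v \<in> H1 \<Omega> \<Longrightarrow> integrable M (\<lambda>x. strain \<Omega> u x \<bullet> contract (C x) (strain \<Omega> v x))"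
  by (intro L2_inner_integrable contract_L2 strain_L2)

lemma strain_sq_integrable: "u \<in> H1 \<Omega> \<Longrightarrow> integrable M (\<lambda>x. strain \<Omega> u x \<bullet> strain \<Omega> u x)"
  by (intro L2_inner_integrable strain_L2)

lemma stiff_sym:
  assumes "u \<in> H1 \<Omega>" "v \<in> H1 \<Omega>"
  shows "stiff u v = stiff v u"
  unfolding stiffness_form_def
proof (rule integral_cong_AE)
  have "AE x in M. tensor_symmetric (C x)" using elastic by (simp add: elasticity_tensor_def)
  then show "AE x in M. strain \<Omega> u x \<bullet> contract (C x) (strain \<Omega> v x) = strain \<Omega> v x \<bullet> contract (C x) (strain \<Omega> u x)"
    by eventually_elim (rule contract_sym)
qed (use stiff_integrable assms in \<open>auto intro: borel_measurable_integrable\<close>)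

lemma stiff_low:
  assumes "u \<in> H1 \<Omega>"
  shows "c0 * l2ip M (strain \<Omega> u) (strain \<Omega> u) \<le> stiff u u"
proof -
  have "AE x in M. \<forall>e. transpose e = e \<longrightarrow> e \<bullet> contract (C x) e \<ge> c0 * (e \<bullet> e)"
    using elastic by (simp add: elasticity_tensor_def)
  then have "AE x in M. c0 * (strain \<Omega> u x \<bullet> strain \<Omega> u x) \<le> strain \<Omega> u x \<bullet> contract (C x) (strain \<Omega> u x)"
    by eventually_elim (simp add: transpose_strain)
  then have "(LINT x|M. c0 * (strain \<Omega> u x \<bullet> strain \<Omega> u x)) \<le> stiff u u"
    unfolding stiffness_form_def using stiff_integrable[OF assms assms] strain_sq_integrable[OF assms]
    by (intro integral_mono_AE) auto
  then show ?thesis by (simp add: l2ip_def)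
qed

lemma stiff_up:
  obtains K where "0 \<le> K" "\<And>u. u \<in> H1 \<Omega> \<Longrightarrow> stiff u u \<le> K * h1ip u u"
proof -
  have "C \<in> Linf M" using elastic by (simp add: elasticity_tensor_def)
  then obtain K where K: "0 \<le> K" "AE x in M. norm (C x) \<le> K" using Linf_bound by blast
  define K' where "K' = real (CARD('s)) ^ 4 * K"
  have K': "0 \<le> K'" using K(1) by (simp add: K'_def)
  have "stiff u u \<le> K' * h1ip u u" if u: "u \<in> H1 \<Omega>" for u
  proof -
    have "AE x in M. strain \<Omega> u x \<bullet> contract (C x) (strain \<Omega> u x) \<le> K' * (weak_grad \<Omega> u x \<bullet> weak_grad \<Omega> u x)"
      using K(2)
    proof eventually_elim
      case (elim x)
      let ?e = "strain \<Omega> u x"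
      have "?e \<bullet> contract (C x) ?e \<le> norm ?e * norm (contract (C x) ?e)" by (rule norm_cauchy_schwarz)
      also have "\<dots> \<le> norm ?e * (K' * norm ?e)"
      proof (rule mult_left_mono)
        have "real (CARD('s)) ^ 4 * norm (C x) * norm ?e \<le> K' * norm ?e"
          unfolding K'_def using elim by (intro mult_right_mono mult_left_mono) auto
        then show "norm (contract (C x) ?e) \<le> K' * norm ?e" using contract_norm[of "C x" ?e] by linarith
      qed simp
      also have "\<dots> = K' * (norm ?e)\<^sup>2" by (simp add: power2_eq_square)
      also have "\<dots> \<le> K' * (norm (weak_grad \<Omega> u x))\<^sup>2"
        using K' norm_strain_le by (intro mult_left_mono power_mono) auto
      finally show ?case by (simp add: power2_norm_eq_inner)
    qed
    then have "stiff u u \<le> (LINT x|M. K' * (weak_grad \<Omega> u x \<bullet> weak_grad \<Omega> u x))"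
      unfolding stiffness_form_def
      using stiff_integrable[OF u u] L2_inner_integrable[OF weak_grad(1) weak_grad(1), OF u u]
      by (intro integral_mono_AE) auto
    also have "\<dots> = K' * l2ip M (weak_grad \<Omega> u) (weak_grad \<Omega> u)" by (simp add: l2ip_def)
    also have "\<dots> \<le> K' * h1ip u u" using K' by (intro mult_left_mono) (auto simp: h1ip_def)
    finally show ?thesis .
  qed
  then show thesis using that K' by blast
qed

lemma stiff_semi_inner: "semi_inner (H1 \<Omega>) stiff"
proof
  have l: "linear_form (H1 \<Omega>) (\<lambda>u. stiff u v)" if v: "v \<in> H1 \<Omega>" for v
    unfolding linear_form_def
  proof (intro ballI allI)
    fix u w a b assume u: "u \<in> H1 \<Omega>" and w: "w \<in> H1 \<Omega>"
    have "stiff (a *\<^sub>R u + b *\<^sub>R w) v = l2ip M (a *\<^sub>R strain \<Omega> u + b *\<^sub>R strain \<Omega> w) (\<lambda>x. contract (C x) (strain \<Omega> v x))"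
      unfolding stiff_l2ip using strain_combination[OF u w, of a b]
      by (intro l2ip_cong_AE strain_L2 H1_combination(1) L2_combination contract_L2 u v w) auto
    also have "\<dots> = a * stiff u v + b * stiff w v"
      unfolding stiff_l2ip by (intro l2ip_combination strain_L2 contract_L2 u v w)
    finally show "stiff (a *\<^sub>R u + b *\<^sub>R w) v = a * stiff u v + b * stiff w v" .
  qed
  moreover have "linear_form (H1 \<Omega>) (stiff v)" if v: "v \<in> H1 \<Omega>" for v
    using l[OF v] stiff_sym[OF v] H1_combination(1) by (simp add: linear_form_def)
  ultimately show "bilinear_form (H1 \<Omega>) (H1 \<Omega>) stiff" by (simp add: bilinear_form_def)
  show "0 \<le> stiff u u" if "u \<in> H1 \<Omega>" for u
    using stiff_low[OF that] c0_pos by (meson l2ip_nonneg mult_nonneg_nonneg less_imp_le order_trans)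
qed (use subspace_H1 stiff_sym in auto)

lemma density_L2:
  assumes "v \<in> L2 M"
  shows "(\<lambda>x. \<rho> x *\<^sub>R v x) \<in> L2 M"
proof -
  obtain K where K: "0 \<le> K" "AE x in M. norm (\<rho> x) \<le> K" using Linf_bound[OF \<rho>_Linf] by blast
  have m: "\<rho> \<in> borel_measurable M" using \<rho>_Linf by (simp add: Linf_def)
  show ?thesis
    by (rule L2_bound[OF assms _, where c = K])
      (use K(2) m L2_measurable[OF assms] in \<open>auto elim!: eventually_mono intro!: mult_right_mono borel_measurable_scaleR\<close>)
qed

lemma mass_l2ip: "mass u v = l2ip M u (\<lambda>x. \<rho> x *\<^sub>R v x)"
  by (simp add: mass_form_def l2ip_def)

lemma mass_integrable: "u \<in> H1 \<Omega> \<Longrightarrow> v \<in> H1 \<Omega> \<Longrightarrow> integrable M (\<lambda>x. (\<rho> x *\<^sub>R u x) \<bullet> v x)"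
  by (intro L2_inner_integrable density_L2 H1_L2)

lemma mass_sym: "mass u v = mass v u"
  by (simp add: mass_form_def inner_commute)

lemma mass_low:
  assumes "u \<in> H1 \<Omega>"
  shows "\<rho>0 * l2ip M u u \<le> mass u u"
proof -
  have "AE x in M. \<rho>0 * (u x \<bullet> u x) \<le> (\<rho> x *\<^sub>R u x) \<bullet> u x"
    using \<rho>_low by eventually_elim (simp add: mult_right_mono)
  then have "(LINT x|M. \<rho>0 * (u x \<bullet> u x)) \<le> mass u u"
    unfolding mass_form_def using mass_integrable[OF assms assms] L2_inner_integrable[OF H1_L2 H1_L2, OF assms assms]
    by (intro integral_mono_AE) auto
  then show ?thesis by (simp add: l2ip_def)
qed

lemma mass_up:
  obtains K where "0 \<le> K" "\<And>u. u \<in> H1 \<Omega> \<Longrightarrow> mass u u \<le> K * l2ip M u u"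
proof -
  obtain K where K: "0 \<le> K" "AE x in M. norm (\<rho> x) \<le> K" using Linf_bound[OF \<rho>_Linf] by blast
  have "mass u u \<le> K * l2ip M u u" if u: "u \<in> H1 \<Omega>" for u
  proof -
    have "AE x in M. (\<rho> x *\<^sub>R u x) \<bullet> u x \<le> K * (u x \<bullet> u x)"
      using K(2) by eventually_elim (auto intro!: mult_right_mono)
    then have "mass u u \<le> (LINT x|M. K * (u x \<bullet> u x))"
      unfolding mass_form_def using mass_integrable[OF u u] L2_inner_integrable[OF H1_L2 H1_L2, OF u u]
      by (intro integral_mono_AE) auto
    then show ?thesis by (simp add: l2ip_def)
  qed
  then show thesis using that K(1) by blast
qed

lemma mass_semi_inner: "semi_inner (H1 \<Omega>) mass"
proof
  have l: "linear_form (H1 \<Omega>) (\<lambda>u. mass u v)" if v: "v \<in> H1 \<Omega>" for v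
    unfolding linear_form_def mass_l2ip using l2ip_combination[OF H1_L2 H1_L2 density_L2[OF H1_L2[OF v]]] by blast
  moreover have "linear_form (H1 \<Omega>) (mass v)" if v: "v \<in> H1 \<Omega>" for v
    using l[OF v] mass_sym[of v] by (simp add: linear_form_def)
  ultimately show "bilinear_form (H1 \<Omega>) (H1 \<Omega>) mass" by (simp add: bilinear_form_def)
  show "0 \<le> mass u u" if "u \<in> H1 \<Omega>" for u
    using mass_low[OF that] \<rho>0_pos by (meson l2ip_nonneg mult_nonneg_nonneg less_imp_le order_trans)
qed (use subspace_H1 mass_sym in auto)

sublocale st: semi_inner "H1 \<Omega>" stiff by (rule stiff_semi_inner)
sublocale ms: semi_inner "H1 \<Omega>" mass by (rule mass_semi_inner)

lemma energy_semi_inner: "semi_inner (H1 \<Omega>) energy"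
proof
  show "bilinear_form (H1 \<Omega>) (H1 \<Omega>) energy"
    using st.bilinear ms.bilinear by (simp add: bilinear_form_def linear_form_def energy_def algebra_simps)
  show "energy u v = energy v u" if "u \<in> H1 \<Omega>" "v \<in> H1 \<Omega>" for u v
    using stiff_sym[OF that] mass_sym[of u v] by (simp add: energy_def)
  show "0 \<le> energy u u" if "u \<in> H1 \<Omega>" for u
    using st.nonneg[OF that] ms.nonneg[OF that] by (simp add: energy_def)
qed (rule subspace_H1)

sublocale en: semi_inner "H1 \<Omega>" energy by (rule energy_semi_inner)

lemma stiff_le_energy: "u \<in> H1 \<Omega> \<Longrightarrow> stiff u u \<le> energy u u"
  using ms.nonneg by (simp add: energy_def)

lemma mass_le_energy: "u \<in> H1 \<Omega> \<Longrightarrow> \<omega>\<^sup>2 * mass u u \<le> energy u u"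
  using st.nonneg by (simp add: energy_def)

text \<open>Korn's inequality without boundary conditions: the stiffness controls the strain through
  \<open>c0\<close>, and the mass term controls the L2 norm through \<omega>^2
  \<open>\<rho>0\<close>.\<close>

lemma energy_h1_low:
  obtains c where "0 < c" "\<And>u. u \<in> H1 \<Omega> \<Longrightarrow> c * h1ip u u \<le> energy u u"
proof -
  obtain K where K: "\<And>v. v \<in> H1 \<Omega> \<Longrightarrow> H1_norm \<Omega> v \<le> K * (L2_norm M v + L2_norm M (strain \<Omega> v))"
    using regular unfolding regular_boundary_def korn_inequality_def by blast
  define Q where "Q = 2 * K\<^sup>2 * (1 / (\<omega>\<^sup>2 * \<rho>0) + 1 / c0) + 1"
  have r: "0 \<le> 1 / (\<omega>\<^sup>2 * \<rho>0)" "0 \<le> 1 / c0" using \<omega>_pos \<rho>0_pos c0_pos by auto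
  have Q: "0 < Q" unfolding Q_def using r by (intro add_nonneg_pos mult_nonneg_nonneg add_nonneg_nonneg) auto
  have "1 / Q * h1ip u u \<le> energy u u" if u: "u \<in> H1 \<Omega>" for u
  proof -
    have a: "l2ip M u u \<le> 1 / (\<omega>\<^sup>2 * \<rho>0) * energy u u"
    proof -
      have "\<omega>\<^sup>2 * (\<rho>0 * l2ip M u u) \<le> energy u u"
        using mult_left_mono[OF mass_low[OF u], of "\<omega>\<^sup>2"] mass_le_energy[OF u] by simp
      then show ?thesis using \<omega>_pos \<rho>0_pos by (simp add: field_simps)
    qed
    have b: "l2ip M (strain \<Omega> u) (strain \<Omega> u) \<le> 1 / c0 * energy u u"
      using stiff_low[OF u] stiff_le_energy[OF u] c0_pos by (simp add: field_simps)
    have "h1ip u u = (H1_norm \<Omega> u)\<^sup>2" by (simp add: H1_norm_ipnorm h1.norm_sq[OF u])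
    also have "\<dots> \<le> (K * (L2_norm M u + L2_norm M (strain \<Omega> u)))\<^sup>2"
      using K[OF u] h1.norm_nonneg[OF u] by (intro power_mono) (auto simp: H1_norm_ipnorm)
    also have "\<dots> = K\<^sup>2 * (L2_norm M u + L2_norm M (strain \<Omega> u))\<^sup>2" by (simp add: power_mult_distrib)
    also have "\<dots> \<le> K\<^sup>2 * (2 * (L2_norm M u)\<^sup>2 + 2 * (L2_norm M (strain \<Omega> u))\<^sup>2)"
      using sum_squares_bound[of "L2_norm M u" "L2_norm M (strain \<Omega> u)"]
      by (intro mult_left_mono) (auto simp: power2_sum)
    also have "\<dots> \<le> K\<^sup>2 * (2 * (1 / (\<omega>\<^sup>2 * \<rho>0) * energy u u) + 2 * (1 / c0 * energy u u))"
      unfolding L2_norm_sq using a b by (intro mult_left_mono add_mono) auto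
    also have "\<dots> \<le> Q * energy u u" using en.nonneg[OF u] by (simp add: Q_def algebra_simps)
    finally show ?thesis using Q by (simp add: field_simps)
  qed
  then show thesis using that[of "1 / Q"] Q by simp
qed

lemma energy_h1_up:
  obtains K where "0 \<le> K" "\<And>u. u \<in> H1 \<Omega> \<Longrightarrow> energy u u \<le> K * h1ip u u"
proof -
  obtain Ka where Ka: "0 \<le> Ka" "\<And>u. u \<in> H1 \<Omega> \<Longrightarrow> stiff u u \<le> Ka * h1ip u u" by (rule stiff_up) blast
  obtain Km where Km: "0 \<le> Km" "\<And>u. u \<in> H1 \<Omega> \<Longrightarrow> mass u u \<le> Km * l2ip M u u" by (rule mass_up) blast
  have "energy u u \<le> (Ka + \<omega>\<^sup>2 * Km) * h1ip u u" if u: "u \<in> H1 \<Omega>" for u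
  proof -
    have "Km * l2ip M u u \<le> Km * h1ip u u" using Km(1) by (intro mult_left_mono) (auto simp: h1ip_def)
    then have "\<omega>\<^sup>2 * mass u u \<le> \<omega>\<^sup>2 * (Km * h1ip u u)" using Km(2)[OF u] by (intro mult_left_mono) auto
    then show ?thesis using Ka(2)[OF u] by (simp add: energy_def algebra_simps)
  qed
  then show thesis using that[of "Ka + \<omega>\<^sup>2 * Km"] Ka(1) Km(1) by simp
qed

lemma energy_complete:
  assumes "S \<in> sets borel"
  shows "complete_form (H1_zero_on \<Omega> S) energy"
proof -
  obtain c where c: "0 < c" "\<And>u. u \<in> H1 \<Omega> \<Longrightarrow> c * h1ip u u \<le> energy u u" by (rule energy_h1_low) blast
  obtain K where K: "\<And>u. u \<in> H1 \<Omega> \<Longrightarrow> energy u u \<le> K * h1ip u u" by (rule energy_h1_up) blast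
  have "trace_theorem \<Omega>" using regular by (simp add: regular_boundary_def)
  from complete_form_equiv[OF H1_zero_on_complete[OF this assms] subspace_H1_zero_on c(1), of energy K]
  show ?thesis using h1.nonneg c(2) K H1_zero_on_subset by blast
qed

text \<open>Korn's inequality with boundary conditions: fields vanishing on a part of the boundary
  of positive area are controlled by their strain alone, so the stiffness dominates the whole energy
  on them.\<close>

lemma stiff_coercive:
  assumes "S \<in> sets borel" "S \<subseteq> frontier \<Omega>" "emeasure (surface_measure \<Omega>) S > 0"
  obtains \<alpha> where "0 < \<alpha>" "\<And>w. w \<in> H1_zero_on \<Omega> S \<Longrightarrow> \<alpha> * energy w w \<le> stiff w w"
proof -
  obtain K where K: "\<And>v. v \<in> H1_zero_on \<Omega> S \<Longrightarrow> H1_norm \<Omega> v \<le> K * L2_norm M (strain \<Omega> v)"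
    using regular assms unfolding regular_boundary_def korn_inequality_bc_def by blast
  obtain Ke where Ke: "0 \<le> Ke" "\<And>u. u \<in> H1 \<Omega> \<Longrightarrow> energy u u \<le> Ke * h1ip u u" by (rule energy_h1_up) blast
  define Q where "Q = Ke * K\<^sup>2 / c0 + 1"
  have Q: "0 < Q" using Ke c0_pos by (simp add: Q_def add_nonneg_pos)
  have "1 / Q * energy w w \<le> stiff w w" if w: "w \<in> H1_zero_on \<Omega> S" for w
  proof -
    have wH: "w \<in> H1 \<Omega>" using w H1_zero_on_subset by blast
    have "h1ip w w = (H1_norm \<Omega> w)\<^sup>2" by (simp add: H1_norm_ipnorm h1.norm_sq[OF wH])
    also have "\<dots> \<le> (K * L2_norm M (strain \<Omega> w))\<^sup>2"
      using K[OF w] h1.norm_nonneg[OF wH] by (intro power_mono) (auto simp: H1_norm_ipnorm)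
    also have "\<dots> = K\<^sup>2 * l2ip M (strain \<Omega> w) (strain \<Omega> w)" by (simp add: power_mult_distrib L2_norm_sq)
    also have "\<dots> \<le> K\<^sup>2 * (stiff w w / c0)"
      using stiff_low[OF wH] c0_pos by (intro mult_left_mono) (auto simp: field_simps)
    finally have "Ke * h1ip w w \<le> Ke * (K\<^sup>2 * (stiff w w / c0))" using Ke(1) by (rule mult_left_mono)
    also have "\<dots> \<le> Q * stiff w w" using st.nonneg[OF wH] by (simp add: Q_def algebra_simps)
    finally show ?thesis using Ke(2)[OF wH] Q by (simp add: field_simps)
  qed
  then show thesis using that[of "1 / Q"] Q by simp
qed

text \<open>\<omega>^2 times the mass form is dominated by the energy on the diagonal, and
  Cauchy-Schwarz for the mass form extends this to pairs; hence the constant 2.\<close>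

lemma mass_bound:
  assumes "u \<in> H1 \<Omega>" "v \<in> H1 \<Omega>"
  shows "\<bar>2 * \<omega>\<^sup>2 * mass u v\<bar> \<le> 2 * ipnorm energy u * ipnorm energy v"
proof -
  have n: "\<omega> * ipnorm mass u \<le> ipnorm energy u" if "u \<in> H1 \<Omega>" for u
    using mass_le_energy[OF that] \<omega>_pos
    by (metis ipnorm_def real_sqrt_le_mono real_sqrt_mult real_sqrt_abs abs_of_pos)
  have "\<omega>\<^sup>2 * \<bar>mass u v\<bar> \<le> \<omega>\<^sup>2 * (ipnorm mass u * ipnorm mass v)"
    using ms.Cauchy_Schwarz[OF assms] by (intro mult_left_mono) auto
  also have "\<dots> = (\<omega> * ipnorm mass u) * (\<omega> * ipnorm mass v)" by (simp add: power2_eq_square)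
  also have "\<dots> \<le> ipnorm energy u * ipnorm energy v"
    using n[OF assms(1)] n[OF assms(2)] \<omega>_pos ms.norm_nonneg[OF assms(2)] en.norm_nonneg[OF assms(1)]
    by (intro mult_mono) auto
  finally show ?thesis by (simp add: abs_mult)
qed

text \<open>Bounded energy means bounded H1 norm, so the compact embedding yields a subsequence
  converging in L2, and the L2 norm dominates the mass form.\<close>

lemma mass_compact:
  fixes s :: "nat \<Rightarrow> 's field"
  assumes s: "\<And>n. s n \<in> H1 \<Omega>" "\<And>n. ipnorm energy (s n) \<le> 1"
  shows "\<exists>r::nat \<Rightarrow> nat. strict_mono r \<and> (\<forall>e>0. \<exists>L. \<forall>m\<ge>L. \<forall>n\<ge>L.
    2 * \<omega>\<^sup>2 * mass (s (r m) - s (r n)) (s (r m) - s (r n)) < e)"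
proof -
  interpret L: semi_inner "L2 M :: 's field set" "l2ip M" by (rule l2_semi_inner)
  obtain c where c: "0 < c" "\<And>u. u \<in> H1 \<Omega> \<Longrightarrow> c * h1ip u u \<le> energy u u" by (rule energy_h1_low) blast
  obtain Km where Km: "0 \<le> Km" "\<And>u. u \<in> H1 \<Omega> \<Longrightarrow> mass u u \<le> Km * l2ip M u u" by (rule mass_up) blast
  have "H1_norm \<Omega> (s n) \<le> sqrt (1 / c)" for n
  proof -
    have "c * h1ip (s n) (s n) \<le> 1"
      using c(2)[OF s(1)[of n]] s(2)[of n] by (auto simp: ipnorm_def)
    then show ?thesis using c(1) by (auto simp: H1_norm_ipnorm ipnorm_def field_simps)
  qed
  then obtain r u where r: "strict_mono r" and u: "u \<in> L2 M"
      "(\<lambda>n. L2_norm M (fdiff (s (r n)) u)) \<longlonglongrightarrow> 0"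
    using regular s(1) unfolding regular_boundary_def compact_embedding_def by metis
  have sL: "s n \<in> L2 M" for n using s(1) H1_L2 by blast
  have "\<exists>L. \<forall>m\<ge>L. \<forall>n\<ge>L. 2 * \<omega>\<^sup>2 * mass (s (r m) - s (r n)) (s (r m) - s (r n)) < e" if e: "e > 0" for e
  proof -
    define q where "q = 2 * \<omega>\<^sup>2 * Km + 1"
    have q: "0 < q" "2 * \<omega>\<^sup>2 * Km < q" using Km(1) by (auto simp: q_def add_nonneg_pos)
    \<comment> \<open>Distances below t to the L2 limit give pairwise distances below 2 t, and (2
      t)^2 = e/q, where q exceeds the constant 2 \<omega>^2 \<open>Km\<close>.\<close>
    define t where "t = sqrt (e / q) / 2"
    have t: "t > 0" using e q by (simp add: t_def)
    have "\<forall>\<^sub>F n in sequentially. L2_norm M (fdiff (s (r n)) u) < t" using order_tendstoD(2)[OF u(2) t] .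
    then obtain L where L: "\<And>n. n \<ge> L \<Longrightarrow> ipnorm (l2ip M) (s (r n) - u) < t"
      by (auto simp: eventually_sequentially field_ops L2_norm_ipnorm)
    have "2 * \<omega>\<^sup>2 * mass (s (r m) - s (r n)) (s (r m) - s (r n)) < e" if mn: "m \<ge> L" "n \<ge> L" for m n
    proof -
      let ?d = "s (r m) - s (r n)"
      have d: "?d \<in> H1 \<Omega>" using s(1) h1.mem(3) by blast
      have dL: "?d \<in> L2 M" using d H1_L2 by blast
      have "ipnorm (l2ip M) ?d \<le> ipnorm (l2ip M) (s (r m) - u) + ipnorm (l2ip M) (u - s (r n))"
        by (rule L.norm_triangle_via[OF sL u(1) sL])
      also have "\<dots> < 2 * t"
        using L[OF mn(1)] L[OF mn(2)] L.norm_minus_commute[OF u(1) sL] by simp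
      finally have "(ipnorm (l2ip M) ?d)\<^sup>2 < (2 * t)\<^sup>2"
        using L.norm_nonneg[OF dL] by (intro power_strict_mono) auto
      then have "l2ip M ?d ?d < e / q" using e q by (simp add: L.norm_sq[OF dL] t_def)
      then have "q * l2ip M ?d ?d < e" using q by (simp add: field_simps)
      moreover have "2 * \<omega>\<^sup>2 * mass ?d ?d \<le> 2 * \<omega>\<^sup>2 * (Km * l2ip M ?d ?d)"
        using Km(2)[OF d] by (intro mult_left_mono) auto
      moreover have "2 * \<omega>\<^sup>2 * (Km * l2ip M ?d ?d) \<le> q * l2ip M ?d ?d"
        using q(2) by (simp add: mult.assoc[symmetric] mult_right_mono)
      ultimately show ?thesis by linarith
    qed
    then show ?thesis by blast
  qed
  then show ?thesis using r by blast
qed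

text \<open>Turns the seminorm uniqueness of the abstract results into equality of elements of the
  function space.\<close>

lemma energy_null_ae_eq:
  assumes "u \<in> H1 \<Omega>" "v \<in> H1 \<Omega>" "ipnorm energy (u - v) = 0"
  shows "ae_eq \<Omega> u v"
proof -
  obtain c where c: "0 < c" "\<And>u. u \<in> H1 \<Omega> \<Longrightarrow> c * h1ip u u \<le> energy u u" by (rule energy_h1_low) blast
  have d: "u - v \<in> H1 \<Omega>" using assms h1.mem(3) by blast
  have "energy (u - v) (u - v) = 0" using assms(3) by (simp add: ipnorm_def)
  then have "c * h1ip (u - v) (u - v) \<le> 0" using c(2)[OF d] by simp
  then have "h1ip (u - v) (u - v) \<le> 0" using c(1) by (simp add: mult_le_0_iff)
  then have "l2ip M (u - v) (u - v) = 0"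
    using l2ip_nonneg[of M "u - v"] l2ip_nonneg[of M "weak_grad \<Omega> (u - v)"] unfolding h1ip_def by linarith
  then have "L2_norm M (u - v) = 0" by (simp add: L2_norm_ipnorm ipnorm_def)
  from L2_norm_zero_AE[OF H1_L2[OF d] this] show ?thesis
    unfolding ae_eq_def by eventually_elim simp
qed

end

section \<open>The expansion\<close>

lemma form_norm_ipnorm: "form_norm ip = ipnorm ip"
  by (simp add: fun_eq_iff form_norm_def ipnorm_def)

lemma dual_iff: "l \<in> dual (ipnorm ip) X \<longleftrightarrow> linear_form X l \<and> bounded_form X ip l"
  by (simp add: dual_def linear_on_fields_iff bounded_form_def)

text \<open>Boundedness of \<open>l\<close> makes the real supremum meaningful. Vectors of seminorm
  zero cannot be normalised; on them \<open>l\<close> vanishes by its own bound.\<close>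

lemma dual_norm_bound:
  assumes "semi_inner X ip" "l \<in> dual (ipnorm ip) X"
  shows "v \<in> X \<Longrightarrow> \<bar>l v\<bar> \<le> dual_norm (ipnorm ip) X l * ipnorm ip v"
    and "0 \<le> dual_norm (ipnorm ip) X l"
proof -
  interpret semi_inner X ip by fact
  have lin: "linear_form X l" using assms(2) by (simp add: dual_iff)
  obtain K where K: "\<And>v. v \<in> X \<Longrightarrow> \<bar>l v\<bar> \<le> K * ipnorm ip v"
    using assms(2) by (auto simp: dual_iff bounded_form_def)
  let ?S = "{v \<in> X. ipnorm ip v \<le> 1}"
  have "\<bar>l v\<bar> \<le> \<bar>K\<bar>" if "v \<in> ?S" for v
  proof -
    have "K * ipnorm ip v \<le> \<bar>K\<bar> * 1" using that norm_nonneg[of v] by (intro mult_mono) auto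
    then show ?thesis using K[of v] that by simp
  qed
  then have bdd: "bdd_above ((\<lambda>v. \<bar>l v\<bar>) ` ?S)" by (intro bdd_aboveI2) auto
  then have up: "\<bar>l v\<bar> \<le> dual_norm (ipnorm ip) X l" if "v \<in> ?S" for v
    unfolding dual_norm_def using that by (intro cSUP_upper)
  have "0 \<in> ?S" using mem(1) norm_zero by simp
  from up[OF this] show "0 \<le> dual_norm (ipnorm ip) X l" by linarith
  assume v: "v \<in> X"
  show "\<bar>l v\<bar> \<le> dual_norm (ipnorm ip) X l * ipnorm ip v"
  proof (cases "ipnorm ip v = 0")
    case True
    then show ?thesis using K[OF v] by simp
  next
    case False
    then have pos: "0 < ipnorm ip v" using norm_nonneg[OF v] by simp
    have "(1 / ipnorm ip v) *\<^sub>R v \<in> ?S" using mem(4)[OF v] norm_scale[OF v] pos by simp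
    from up[OF this] have "\<bar>l v\<bar> / ipnorm ip v \<le> dual_norm (ipnorm ip) X l"
      using linear_form_scale[OF lin v] pos by (simp add: abs_mult)
    then show ?thesis using pos by (simp add: field_simps)
  qed
qed

theorem proposition2:
  fixes \<Omega> \<Gamma>\<^sub>D \<Gamma>\<^sub>N \<Gamma>\<^sub>c :: "(real^'s::finite) set"
    and \<rho> :: "real^'s \<Rightarrow> real" and C :: "real^'s \<Rightarrow> 's tensor4"
    and \<omega> \<rho>0 c0 \<delta> :: real
    and U W H N N_perp :: "'s field set"
    and A B D ip :: "'s field \<Rightarrow> 's field \<Rightarrow> real"
    and nrm f d :: "'s field \<Rightarrow> real" and um :: "'s field"
  assumes "CARD('s) \<le> 3"
    and "bounded_domain \<Omega>" and "regular_boundary \<Omega>"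
    and "\<Gamma>\<^sub>D \<subseteq> frontier \<Omega>" "\<Gamma>\<^sub>N \<subseteq> frontier \<Omega>" "\<Gamma>\<^sub>D \<in> sets borel" "\<Gamma>\<^sub>N \<in> sets borel"
    and "\<Gamma>\<^sub>D \<inter> \<Gamma>\<^sub>N = {}" "\<Gamma>\<^sub>c = frontier \<Omega> - (\<Gamma>\<^sub>N \<union> \<Gamma>\<^sub>D)"
    and "emeasure (surface_measure \<Omega>) (\<Gamma>\<^sub>D \<union> \<Gamma>\<^sub>c) > 0"
    and "\<omega> > 0"
    and "\<rho> \<in> Linf (lebesgue_on \<Omega>)" "\<rho>0 > 0" "AE x in lebesgue_on \<Omega>. \<rho> x \<ge> \<rho>0"
    and "c0 > 0" "elasticity_tensor \<Omega> c0 C"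
    and "U = H1_zero_on \<Omega> \<Gamma>\<^sub>D"
    and "W = H1_zero_on \<Omega> (\<Gamma>\<^sub>D \<union> \<Gamma>\<^sub>c)"
    and "A = stiffness_form \<Omega> C"
    and "B = (\<lambda>v v'. A v v' - \<omega>\<^sup>2 * mass_form \<Omega> \<rho> v v')"
    and "ip = (\<lambda>v v'. A v v' + \<omega>\<^sup>2 * mass_form \<Omega> \<rho> v v')"
    and "nrm = form_norm ip"
    and "sym_psd_continuous_form nrm U D"
    and "H = {u \<in> U. \<forall>w\<in>W. B u w = 0}"
    and "N = {u \<in> U. \<forall>v\<in>U. D u v = 0}"
    and "N_perp = orth_compl ip U N"
    and "N \<subset> orth_compl ip U H"
    and "\<delta> > 0" "\<forall>v\<in>N_perp. D v v \<ge> \<delta> * (nrm v)\<^sup>2"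
    and "f \<in> dual nrm W"
    and "um \<in> N_perp"
    and "d \<in> dual nrm U" "\<forall>v\<in>U. d v = D um v"
  shows
    "(\<forall>\<kappa>>0. \<exists>w\<in>W. \<exists>u0\<in>N_perp. \<exists>u1\<in>N. stationary W U A B D f d \<kappa> w (fadd u0 u1) \<and>
        (\<forall>w'\<in>W. \<forall>u0'\<in>N_perp. \<forall>u1'\<in>N. stationary W U A B D f d \<kappa> w' (fadd u0' u1') \<longrightarrow>
           ae_eq \<Omega> w' w \<and> ae_eq \<Omega> u0' u0 \<and> ae_eq \<Omega> u1' u1))
     \<and> misfit_well_posed \<Omega> nrm N_perp D
     \<and> mixed_well_posed \<Omega> nrm W N A B
     \<and> (\<exists>w0\<in>W. \<exists>u00\<in>N_perp. \<exists>u10\<in>N.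
          solves_misfit N_perp D d u00 \<and> ae_eq \<Omega> u00 um \<and>
          solves_mixed W N A B (\<lambda>w'. f w' - B um w') (\<lambda>v. 0) w0 u10 \<and>
          (\<forall>w u0 u1 :: real \<Rightarrow> 's field.
             (\<forall>\<kappa>>0. w \<kappa> \<in> W \<and> u0 \<kappa> \<in> N_perp \<and> u1 \<kappa> \<in> N \<and>
                stationary W U A B D f d \<kappa> (w \<kappa>) (fadd (u0 \<kappa>) (u1 \<kappa>))) \<longrightarrow>
             (\<lambda>\<kappa>. sqrt ((nrm (fdiff (w \<kappa>) w0))\<^sup>2
                        + (nrm (fdiff (fadd (u0 \<kappa>) (u1 \<kappa>)) (fadd u00 u10)))\<^sup>2))
               \<in> O[at_top](\<lambda>\<kappa>. 1 / \<kappa>)))"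
proof -
  interpret bounded_open \<Omega> using assms(2) by unfold_locales (auto simp: bounded_domain_def)
  interpret elastic_body \<Omega> C \<rho> c0 \<rho>0 \<omega> by unfold_locales (use assms in auto)
  have ip: "ip = energy" using assms(19,21) by (simp add: fun_eq_iff energy_def)
  have nrm: "nrm = ipnorm energy" using assms(22) ip form_norm_ipnorm by simp
  have S: "\<Gamma>\<^sub>D \<union> \<Gamma>\<^sub>c \<in> sets borel" "\<Gamma>\<^sub>D \<union> \<Gamma>\<^sub>c \<subseteq> frontier \<Omega>"
    using assms(4-9) by (auto intro!: sets.Un sets.Diff borel_closed)
  have UH: "U \<subseteq> H1 \<Omega>" and WH: "W \<subseteq> H1 \<Omega>" using assms(17,18) H1_zero_on_subset by auto
  have WU: "W \<subseteq> U" unfolding assms(17,18) H1_zero_on_def vanishes_on_def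
    by (blast intro: eventually_mono)
  have Us: "subspace U" and Ws: "subspace W" using assms(17,18) subspace_H1_zero_on by auto
  have Uc: "complete_form U energy" and Wc: "complete_form W energy"
    using assms(6,17,18) S energy_complete by auto
  obtain \<alpha> where \<alpha>: "0 < \<alpha>" "\<And>w. w \<in> W \<Longrightarrow> \<alpha> * energy w w \<le> A w w"
    using stiff_coercive[OF S assms(10)] assms(18,19) by blast
  have B: "B u w = energy u w - 2 * \<omega>\<^sup>2 * mass u w" for u w
    using assms(19,20) by (simp add: energy_def)
  note D = assms(23)[unfolded sym_psd_continuous_form_def linear_on_fields_iff nrm]
  obtain KD where KD: "\<And>u v. u \<in> U \<Longrightarrow> v \<in> U \<Longrightarrow> \<bar>D u v\<bar> \<le> KD * ipnorm energy u * ipnorm energy v"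
    using D by blast
  interpret U: semi_inner U energy by (rule en.semi_inner_subspace[OF Us UH])
  have N: "N = {u \<in> U. \<forall>v\<in>U. D u v = 0}" by (rule assms(25))
  have P: "N_perp = {u \<in> U. \<forall>v\<in>N. energy u v = 0}" using assms(26) ip by (simp add: orth_compl_def)
  \<comment> \<open>The inclusion of N in the complement of H, in the form of \<open>N_orth\<close>:
    the condition on h says that h belongs to H.\<close>
  have NH: "energy u h = 0" if "u \<in> N" "h \<in> U" "\<And>w. w \<in> W \<Longrightarrow> B h w = 0" for u h
    using that assms(24,27) ip by (auto simp: orth_compl_def)
  have "inversion U energy W A B (\<lambda>u v. 2 * \<omega>\<^sup>2 * mass u v) D \<alpha> \<delta> 2 KD"
  proof unfold_locales
    show "bilinear_form W W A" using bilinear_form_mono[OF st.bilinear WH WH] assms(19) by simp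
    show "A w z = A z w" if "w \<in> W" "z \<in> W" for w z using stiff_sym that WH assms(19) by blast
    show "A w w \<le> energy w w" if "w \<in> W" for w using stiff_le_energy that WH assms(19) by blast
    show "bilinear_form U U (\<lambda>u v. 2 * \<omega>\<^sup>2 * mass u v)"
      using bilinear_form_mono[OF ms.bilinear UH UH]
      by (simp add: bilinear_form_def linear_form_def algebra_simps)
    show "\<bar>2 * \<omega>\<^sup>2 * mass u v\<bar> \<le> 2 * ipnorm energy u * ipnorm energy v" if "u \<in> U" "v \<in> U" for u v
      using mass_bound that UH by blast
    show "\<exists>r::nat \<Rightarrow> nat. strict_mono r \<and> (\<forall>e>0. \<exists>M. \<forall>m\<ge>M. \<forall>n\<ge>M.
        2 * \<omega>\<^sup>2 * mass (s (r m) - s (r n)) (s (r m) - s (r n)) < e)"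
      if "\<And>n. s n \<in> W \<and> ipnorm energy (s n) \<le> 1" for s :: "nat \<Rightarrow> 's field"
      by (rule mass_compact) (use that WH in auto)
    show "bilinear_form U U D" using D by (simp add: bilinear_form_def)
    show "energy u h = 0"
      if "u \<in> {u \<in> U. \<forall>v\<in>U. D u v = 0}" "h \<in> U" "\<And>w. w \<in> W \<Longrightarrow> B h w = 0" for u h
      using NH that N by blast
    show "\<delta> * energy v v \<le> D v v"
      if "v \<in> {u \<in> U. \<forall>v\<in>{u \<in> U. \<forall>v\<in>U. D u v = 0}. energy u v = 0}" for v
    proof -
      have "v \<in> N_perp" using that P N by simp
      then show ?thesis using assms(29) nrm U.norm_sq[of v] P by auto
    qed
  qed (use Uc Ws WU Wc \<alpha> B D KD assms(28) in auto)
  then interpret inv: inversion U energy W A B "\<lambda>u v. 2 * \<omega>\<^sup>2 * mass u v" D \<alpha> \<delta> 2 KD N N_perp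
    unfolding N P by simp_all
  have fb: "linear_form W f" "bounded_form W energy f" using assms(30) nrm by (simp_all add: dual_iff)
  have db: "linear_form U d" "bounded_form U energy d" using assms(32) nrm by (simp_all add: dual_iff)
  have umU: "um \<in> U" using assms(31) inv.P_sub by blast
  have ae: "ae_eq \<Omega> u v" if "u \<in> U" "v \<in> U" "ipnorm energy (u - v) = 0" for u v
    using energy_null_ae_eq that UH by blast
  have st: "stationary W U A B D f d \<kappa> w (fadd u0 u1) \<longleftrightarrow> w \<in> W \<and> u0 + u1 \<in> U \<and>
      (\<forall>w'\<in>W. A w w' + B (u0 + u1) w' = f w') \<and>
      (\<forall>v\<in>U. B v w - \<kappa> * D (u0 + u1) v = - \<kappa> * d v)" for \<kappa> w u0 u1
    by (simp add: stationary_def field_ops)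
  have part1: "\<exists>w\<in>W. \<exists>u0\<in>N_perp. \<exists>u1\<in>N. stationary W U A B D f d \<kappa> w (fadd u0 u1) \<and>
        (\<forall>w'\<in>W. \<forall>u0'\<in>N_perp. \<forall>u1'\<in>N. stationary W U A B D f d \<kappa> w' (fadd u0' u1') \<longrightarrow>
           ae_eq \<Omega> w' w \<and> ae_eq \<Omega> u0' u0 \<and> ae_eq \<Omega> u1' u1)" if \<kappa>: "0 < \<kappa>" for \<kappa>
  proof -
    have "linear_form U (\<lambda>v. - \<kappa> * d v)" using db(1) by (simp add: linear_form_def algebra_simps)
    moreover have "bounded_form U energy (\<lambda>v. - \<kappa> * d v)"
    proof -
      obtain K where "\<forall>v\<in>U. \<bar>d v\<bar> \<le> K * ipnorm energy v" using db(2) unfolding bounded_form_def by blast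
      then have "\<forall>v\<in>U. \<bar>- \<kappa> * d v\<bar> \<le> (\<kappa> * K) * ipnorm energy v"
        using \<kappa> by (simp add: abs_mult)
      then show ?thesis unfolding bounded_form_def by blast
    qed
    ultimately obtain w u where wu: "w \<in> W" "u \<in> U" "\<And>w'. w' \<in> W \<Longrightarrow> A w w' + B u w' = f w'"
      "\<And>v. v \<in> U \<Longrightarrow> B v w - \<kappa> * D u v = - \<kappa> * d v"
      using inv.stationary_exists[OF \<kappa> fb] by blast
    obtain u0 u1 where s: "u0 \<in> N_perp" "u1 \<in> N" "u = u0 + u1" using inv.split[OF wu(2)] .
    have "ae_eq \<Omega> w' w \<and> ae_eq \<Omega> u0' u0 \<and> ae_eq \<Omega> u1' u1"
      if w': "w' \<in> W" and u0': "u0' \<in> N_perp" and u1': "u1' \<in> N"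
        and st': "stationary W U A B D f d \<kappa> w' (fadd u0' u1')" for w' u0' u1'
    proof -
      let ?u = "u0' + u1'"
      have u': "?u \<in> U" "\<And>z. z \<in> W \<Longrightarrow> A w' z + B ?u z = f z"
        "\<And>v. v \<in> U \<Longrightarrow> B v w' - \<kappa> * D ?u v = - \<kappa> * d v"
        using st' unfolding st by blast+
      have dw: "w' - w \<in> W" using w' wu(1) inv.W.mem(3) by blast
      have du: "?u - u \<in> U" using u'(1) wu(2) U.mem(3) by blast
      have e1: "A (w' - w) z + B (?u - u) z = 0" if "z \<in> W" for z
        using inv.WA.ip_add_diff(3)[OF w' wu(1) that] inv.B_left(2)[OF u'(1) wu(2) that]
          u'(2)[OF that] wu(3)[OF that] by linarith
      have e2: "B v (w' - w) - \<kappa> * D (?u - u) v = 0" if "v \<in> U" for v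
        using inv.B_right[OF that w' wu(1)] inv.D_left(2)[OF u'(1) wu(2) that]
          u'(3)[OF that] wu(4)[OF that] by (simp add: right_diff_distrib)
      note null = inv.stationary_unique[OF \<kappa> dw du e1 e2]
      have d0: "u0' - u0 \<in> N_perp" "u1' - u1 \<in> N" using s u0' u1' inv.P.mem(3) inv.N.mem(3) by blast+
      have eq: "?u - u = (u0' - u0) + (u1' - u1)" using s(3) by (simp add: algebra_simps)
      have "energy (?u - u) (?u - u) = 0" using null(2) by (simp add: ipnorm_def)
      \<comment> \<open>By Pythagoras, uniqueness of the sum u0 + u1 passes to its two orthogonal
        components.\<close>
      then have "energy (u0' - u0) (u0' - u0) + energy (u1' - u1) (u1' - u1) = 0"
        unfolding eq inv.split_norm[OF d0] .
      then have "ipnorm energy (u0' - u0) = 0" "ipnorm energy (u1' - u1) = 0"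
        using inv.P.nonneg[OF d0(1)] inv.N.nonneg[OF d0(2)] by (simp_all add: ipnorm_def)
      then show ?thesis using ae null(1) s u0' u1' w' wu(1) inv.P_sub inv.N_sub WU by blast
    qed
    moreover have "stationary W U A B D f d \<kappa> w (fadd u0 u1)" unfolding st using wu s(3) by blast
    ultimately show ?thesis using wu(1) s by blast
  qed
  have part2: "misfit_well_posed \<Omega> nrm N_perp D"
    unfolding misfit_well_posed_def nrm
  proof (rule exI[of _ "1 / \<delta>"], intro ballI)
    fix e assume e: "e \<in> dual (ipnorm energy) N_perp"
    then obtain u where u: "u \<in> N_perp" "\<And>v. v \<in> N_perp \<Longrightarrow> D u v = e v"
      using inv.misfit_exists unfolding dual_iff by blast
    have "ae_eq \<Omega> u' u" if u': "solves_misfit N_perp D e u'" for u'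
    proof -
      have u'P: "u' \<in> N_perp" "\<And>v. v \<in> N_perp \<Longrightarrow> D u' v = e v" using u' by (auto simp: solves_misfit_def)
      have d: "u' - u \<in> N_perp" using u'P(1) u(1) inv.P.mem(3) by blast
      have "D (u' - u) v = 0" if "v \<in> N_perp" for v
        using inv.D_left(2)[OF inv.P_sub[OF u'P(1)] inv.P_sub[OF u(1)] inv.P_sub[OF that]] u'P(2)[OF that] u(2)[OF that]
        by simp
      then have "ipnorm energy (u' - u) \<le> 0"
        using inv.misfit_bound[OF d, of "\<lambda>_. 0" 0] by simp
      then show ?thesis using ae inv.P.norm_nonneg[OF d] u'P(1) u(1) inv.P_sub by (meson order_antisym)
    qed
    moreover have "ipnorm energy u \<le> 1 / \<delta> * dual_norm (ipnorm energy) N_perp e"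
      using inv.misfit_bound[OF u] dual_norm_bound[OF inv.P.semi_inner_axioms e] by blast
    ultimately show "\<exists>u. solves_misfit N_perp D e u \<and> (\<forall>u'. solves_misfit N_perp D e u' \<longrightarrow> ae_eq \<Omega> u' u) \<and>
        ipnorm energy u \<le> 1 / \<delta> * dual_norm (ipnorm energy) N_perp e"
      using u by (auto simp: solves_misfit_def)
  qed
  have part3: "mixed_well_posed \<Omega> nrm W N A B"
  proof -
    obtain K where K: "0 \<le> K"
      "\<forall>w\<in>W. \<forall>u\<in>N. \<forall>kF\<ge>0. \<forall>kG\<ge>0. (\<forall>z\<in>W. \<bar>A w z + B u z\<bar> \<le> kF * ipnorm energy z) \<longrightarrow>
        (\<forall>v\<in>N. \<bar>B v w\<bar> \<le> kG * ipnorm energy v) \<longrightarrow>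
        ipnorm energy w + ipnorm energy u \<le> K * (kF + kG)" by (rule inv.mixed_bound)
    show ?thesis
      unfolding mixed_well_posed_def nrm
    proof (rule exI[of _ K], intro ballI)
      fix F G assume F: "F \<in> dual (ipnorm energy) W" and G: "G \<in> dual (ipnorm energy) N"
      obtain w u where wu: "w \<in> W" "u \<in> N" "\<And>w'. w' \<in> W \<Longrightarrow> A w w' + B u w' = F w'"
          "\<And>v. v \<in> N \<Longrightarrow> B v w = G v"
        using inv.mixed_exists[of F G] F G unfolding dual_iff by blast
      have "ae_eq \<Omega> w' w \<and> ae_eq \<Omega> u' u" if sol: "solves_mixed W N A B F G w' u'" for w' u'
      proof -
        have s: "w' \<in> W" "u' \<in> N" "\<And>z. z \<in> W \<Longrightarrow> A w' z + B u' z = F z" "\<And>v. v \<in> N \<Longrightarrow> B v w' = G v"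
          using sol by (auto simp: solves_mixed_def)
        have dw: "w' - w \<in> W" and du: "u' - u \<in> N"
          using s wu inv.W.mem(3) inv.N.mem(3) by blast+
        have e1: "A (w' - w) z + B (u' - u) z = 0" if "z \<in> W" for z
          using inv.WA.ip_add_diff(3)[OF s(1) wu(1) that] inv.B_left(2)[OF inv.N_sub[OF s(2)] inv.N_sub[OF wu(2)] that]
            s(3)[OF that] wu(3)[OF that] by linarith
        have e2: "B v (w' - w) = 0" if "v \<in> N" for v
          using inv.B_right[OF inv.N_sub[OF that] s(1) wu(1)] s(4)[OF that] wu(4)[OF that] by simp
        have "ipnorm energy (w' - w) + ipnorm energy (u' - u) \<le> K * (0 + 0)"
          using K(2)[rule_format, OF dw du, of 0 0] e1 e2 by simp
        then have "ipnorm energy (w' - w) = 0" "ipnorm energy (u' - u) = 0"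
          using inv.W.norm_nonneg[OF dw] inv.N.norm_nonneg[OF du] by simp_all
        then show ?thesis using ae s(1,2) wu(1,2) inv.N_sub WU by blast
      qed
      moreover have "ipnorm energy w + ipnorm energy u
          \<le> K * (dual_norm (ipnorm energy) W F + dual_norm (ipnorm energy) N G)"
        \<comment> \<open>The residuals of a solution are its data, whose bounds are the dual norms;
          so \<open>K\<close> is the Hadamard constant.\<close>
        using K(2)[rule_format, OF wu(1,2), of "dual_norm (ipnorm energy) W F" "dual_norm (ipnorm energy) N G"]
          wu(3,4) dual_norm_bound[OF inv.W.semi_inner_axioms F] dual_norm_bound[OF inv.N.semi_inner_axioms G]
        by simp
      ultimately show "\<exists>w u. solves_mixed W N A B F G w u \<and>
          (\<forall>w' u'. solves_mixed W N A B F G w' u' \<longrightarrow> ae_eq \<Omega> w' w \<and> ae_eq \<Omega> u' u) \<and>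
          ipnorm energy w + ipnorm energy u \<le> K * (dual_norm (ipnorm energy) W F + dual_norm (ipnorm energy) N G)"
        using wu unfolding solves_mixed_def by blast
    qed
  qed
  have "linear_form W (\<lambda>w'. f w' - B um w')"
    using fb(1) bilinear_form_right[OF inv.B_bilinear umU] by (simp add: linear_form_def algebra_simps)
  moreover have "bounded_form W energy (\<lambda>w'. f w' - B um w')"
  proof -
    obtain K where K: "\<And>w. w \<in> W \<Longrightarrow> \<bar>f w\<bar> \<le> K * ipnorm energy w"
      using fb(2) unfolding bounded_form_def by blast
    have "\<bar>f w - B um w\<bar> \<le> (K + inv.MB * ipnorm energy um) * ipnorm energy w" if "w \<in> W" for w
      using K[OF that] inv.B_bound[OF umU that] by (simp add: algebra_simps)
    then show ?thesis unfolding bounded_form_def by blast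
  qed
  moreover have "linear_form N (\<lambda>_. 0)" "bounded_form N energy (\<lambda>_. 0)"
    by (auto simp: linear_form_def bounded_form_def intro: exI[of _ 0])
  ultimately obtain w0 u10 where lim: "w0 \<in> W" "u10 \<in> N"
      "\<And>w'. w' \<in> W \<Longrightarrow> A w0 w' + B u10 w' = f w' - B um w'" "\<And>v. v \<in> N \<Longrightarrow> B v w0 = 0"
    using inv.mixed_exists by blast
  obtain K where K: "\<forall>\<kappa>>0. \<forall>w\<in>W. \<forall>u0\<in>N_perp. \<forall>u1\<in>N. (\<forall>z\<in>W. A w z + B (u0 + u1) z = f z) \<longrightarrow>
      (\<forall>v\<in>U. B v w - \<kappa> * D (u0 + u1) v = - \<kappa> * D um v) \<longrightarrow>
      ipnorm energy (w - w0) + ipnorm energy ((u0 + u1) - (um + u10)) \<le> K / \<kappa>"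
    by (rule inv.expansion[OF assms(31) lim])
  have rate: "(\<lambda>\<kappa>. sqrt ((nrm (fdiff (w \<kappa>) w0))\<^sup>2 + (nrm (fdiff (fadd (u0 \<kappa>) (u1 \<kappa>)) (fadd um u10)))\<^sup>2))
      \<in> O[at_top](\<lambda>\<kappa>. 1 / \<kappa>)"
    if sol: "\<forall>\<kappa>>0. w \<kappa> \<in> W \<and> u0 \<kappa> \<in> N_perp \<and> u1 \<kappa> \<in> N \<and>
        stationary W U A B D f d \<kappa> (w \<kappa>) (fadd (u0 \<kappa>) (u1 \<kappa>))" for w u0 u1 :: "real \<Rightarrow> 's field"
  proof (rule bigoI[of _ K])
    have "norm (sqrt ((nrm (fdiff (w \<kappa>) w0))\<^sup>2 + (nrm (fdiff (fadd (u0 \<kappa>) (u1 \<kappa>)) (fadd um u10)))\<^sup>2))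
        \<le> K * norm (1 / \<kappa>)" if \<kappa>: "\<kappa> > 0" for \<kappa>
    proof -
      have s: "w \<kappa> \<in> W" "u0 \<kappa> \<in> N_perp" "u1 \<kappa> \<in> N"
        and s': "stationary W U A B D f d \<kappa> (w \<kappa>) (fadd (u0 \<kappa>) (u1 \<kappa>))" using sol \<kappa> by blast+
      let ?a = "ipnorm energy (w \<kappa> - w0)" and ?b = "ipnorm energy ((u0 \<kappa> + u1 \<kappa>) - (um + u10))"
      have "w \<kappa> - w0 \<in> W" "(u0 \<kappa> + u1 \<kappa>) - (um + u10) \<in> U"
        using s lim(1,2) umU inv.W.mem(3) U.mem(2,3) inv.P_sub inv.N_sub by auto
      then have "0 \<le> ?a" "0 \<le> ?b" using inv.W.norm_nonneg U.norm_nonneg by auto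
      then have "sqrt (?a\<^sup>2 + ?b\<^sup>2) \<le> ?a + ?b" by (rule sqrt_sum_squares_le_sum)
      also have "\<dots> \<le> K / \<kappa>"
        using K \<kappa> s s' assms(33) by (simp add: st)
      finally show ?thesis using \<kappa> by (simp add: field_ops nrm)
    qed
    then show "\<forall>\<^sub>F \<kappa> in at_top. norm (sqrt ((nrm (fdiff (w \<kappa>) w0))\<^sup>2
        + (nrm (fdiff (fadd (u0 \<kappa>) (u1 \<kappa>)) (fadd um u10)))\<^sup>2)) \<le> K * norm (1 / \<kappa>)"
      using eventually_gt_at_top[of 0] by (rule eventually_mono[rotated])
  qed
  \<comment> \<open>\<open>um\<close> itself serves as the limit component in \<open>N_perp\<close>,
    since d is D um on all of \<open>U\<close>.\<close>
  have "solves_misfit N_perp D d um"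
    using assms(31,33) inv.P_sub by (auto simp: solves_misfit_def)
  moreover have "ae_eq \<Omega> um um" by (simp add: ae_eq_def)
  moreover have "solves_mixed W N A B (\<lambda>w'. f w' - B um w') (\<lambda>v. 0) w0 u10"
    using lim by (simp add: solves_mixed_def)
  ultimately show ?thesis using part1 part2 part3 lim(1,2) assms(31) rate by blast
qed

end
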